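(* Let $K\in\mathbb{R}$ and let $D$ be a convex compact domain in $\mathbb{X}_K$ whose boundary is either a geodesic polygon or $C^1$. Then the $\mu_K$-measure of the set $\mathcal{G}^K_D$ of geodesics of $\mathbb{X}_K$ intersecting $D$ equals the length of the boundary of $D$: $$\mu_K(\mathcal{G}^K_D)=L_K(\partial D).$$
   Context: $\mathbb{X}_K$ is the maximally symmetric, simply connected, 2-dimensional Riemannian manifold of constant sectional curvature $K$ (sphere of radius $1/\sqrt K$ if $K>0$, Euclidean plane if $K=0$, rescaled hyperbolic plane if $K<0$). $\mathcal{G}^K$ is the set of unoriented complete geodesics of $\mathbb{X}_K$ (great circles if $K>0$), and $\mu_K$ is the isometry-invariant measure on $\mathcal{G}^K$ normalized so that, locally, near a geodesic crossing a given geodesic segment, $\mathrm{d}\mu_K=\sin\alpha\,\mathrm{d}l\,\mathrm{d}\alpha$, where $l$ is the arclength position of the crossing point and $\alpha\in(0,\pi)$ the crossing angle. $L_K(\partial D)$ is the length of $\partial D$. *)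

theory Defs
  imports "HOL-Analysis.Analysis"
begin

text \<open>
  The plane of constant curvature \<open>K\<close> is realised in \<open>\<real>\<^sup>3\<close>: the round sphere of radius
  \<open>1 / sqrt K\<close>, an affine Euclidean plane, or the upper sheet of the hyperboloid in Minkowski
  space. The Riemannian metric is in each case the restriction of \<open>form K\<close> to the tangent
  planes. For \<open>K = 0\<close> the third coordinate is constant on the surface, so its (zero) weight in
  \<open>form K\<close> plays no role there.
\<close>

definition form :: "real \<Rightarrow> real^3 \<Rightarrow> real^3 \<Rightarrow> real" where
  "form K u v = u $ 1 * v $ 1 + u $ 2 * v $ 2 + sgn K * (u $ 3 * v $ 3)"

definition surface :: "real \<Rightarrow> (real^3) set" where
  "surface K =
     (if K = 0 then {x. x $ 3 = 1}
      else {x. form K x x = 1 / K \<and> (K < 0 \<longrightarrow> x $ 3 > 0)})"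

definition tangent_plane :: "real \<Rightarrow> real^3 \<Rightarrow> (real^3) set" where
  "tangent_plane K p = (if K = 0 then {v. v $ 3 = 0} else {v. form K p v = 0})"

text \<open>
  Length of a curve parametrised over \<open>[0,1]\<close>. It takes values in \<open>ennreal\<close> because a
  \<open>valid_path\<close> may have unbounded derivative near its break points, hence infinite length.
\<close>

definition curve_length :: "real \<Rightarrow> (real \<Rightarrow> real^3) \<Rightarrow> ennreal" where
  "curve_length K c =
     (\<integral>\<^sup>+t\<in>{0..1}. ennreal (sqrt (form K (vector_derivative c (at t)) (vector_derivative c (at t))))
        \<partial>lborel)"

definition surface_dist :: "real \<Rightarrow> real^3 \<Rightarrow> real^3 \<Rightarrow> ennreal" where
  "surface_dist K p q =
     Inf {curve_length K c |c. valid_path c \<and> path_image c \<subseteq> surface K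
                              \<and> pathstart c = p \<and> pathfinish c = q}"

text \<open>
  Complete unit-speed geodesics. The covariant acceleration is the tangential part of the
  ambient second derivative, so the geodesic equation says that the latter is normal to the
  surface with respect to \<open>form K\<close>.
\<close>

definition unit_geodesic :: "real \<Rightarrow> (real \<Rightarrow> real^3) \<Rightarrow> bool" where
  "unit_geodesic K \<gamma> \<longleftrightarrow>
     (\<forall>t. \<gamma> t \<in> surface K) \<and>
     (\<exists>\<gamma>' \<gamma>''. \<forall>t. (\<gamma> has_vector_derivative \<gamma>' t) (at t) \<and>
                 (\<gamma>' has_vector_derivative \<gamma>'' t) (at t) \<and>
                 form K (\<gamma>' t) (\<gamma>' t) = 1 \<and>
                 (\<forall>w\<in>tangent_plane K (\<gamma> t). form K (\<gamma>'' t) w = 0))"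

text \<open>Unoriented complete geodesics are identified with their traces.\<close>

definition geodesics :: "real \<Rightarrow> (real^3) set set" where
  "geodesics K = {range \<gamma> |\<gamma>. unit_geodesic K \<gamma>}"

definition geodesics_meeting :: "real \<Rightarrow> (real^3) set \<Rightarrow> (real^3) set set" where
  "geodesics_meeting K S = {g \<in> geodesics K. g \<inter> S \<noteq> {}}"

text \<open>
  The Borel sigma-algebra of the natural topology on the space of geodesics; it is generated by
  the sets of geodesics that meet a given open set.
\<close>

definition geodesic_borel :: "real \<Rightarrow> (real^3) set measure" where
  "geodesic_borel K = sigma (geodesics K) {geodesics_meeting K U |U. open U}"

definition geodesic_from :: "real \<Rightarrow> real^3 \<Rightarrow> real^3 \<Rightarrow> (real^3) set" where
  "geodesic_from K p v =
     (THE g. \<exists>\<gamma>. unit_geodesic K \<gamma> \<and> \<gamma> 0 = p \<and> (\<gamma> has_vector_derivative v) (at 0) \<and> g = range \<gamma>)"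

definition unit_normal_field :: "real \<Rightarrow> (real \<Rightarrow> real^3) \<Rightarrow> (real \<Rightarrow> real^3) \<Rightarrow> bool" where
  "unit_normal_field K \<gamma> N \<longleftrightarrow>
     continuous_on UNIV N \<and>
     (\<forall>t. N t \<in> tangent_plane K (\<gamma> t) \<and> form K (N t) (N t) = 1 \<and>
          form K (N t) (vector_derivative \<gamma> (at t)) = 0)"

text \<open>The geodesic that crosses \<open>\<gamma>\<close> at arclength position \<open>l\<close> under the angle \<open>\<alpha>\<close>.\<close>

definition crossing ::
  "real \<Rightarrow> (real \<Rightarrow> real^3) \<Rightarrow> (real \<Rightarrow> real^3) \<Rightarrow> real \<times> real \<Rightarrow> (real^3) set" where
  "crossing K \<gamma> N = (\<lambda>(l, \<alpha>).
     geodesic_from K (\<gamma> l) (cos \<alpha> *\<^sub>R vector_derivative \<gamma> (at l) + sin \<alpha> *\<^sub>R N l))"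

definition surface_isometry :: "real \<Rightarrow> (real^3 \<Rightarrow> real^3) \<Rightarrow> bool" where
  "surface_isometry K f \<longleftrightarrow>
     bij_betw f (surface K) (surface K) \<and>
     (\<forall>p\<in>surface K. \<forall>q\<in>surface K. surface_dist K (f p) (f q) = surface_dist K p q)"

text \<open>
  The invariant measure on the space of geodesics, normalised by
  \<open>d\<mu> = sin \<alpha> dl d\<alpha>\<close> wherever \<open>(l, \<alpha>)\<close> are coordinates on the set of geodesics crossing the open
  geodesic segment \<open>\<gamma> ` {a<..<b}\<close>. The injectivity condition matters only for \<open>K > 0\<close>, where it
  says that the segment is at most half a great circle. As every geodesic crosses such a segment,
  the normalisation determines \<open>\<mu>\<close>.
\<close>

definition invariant_geodesic_measure :: "real \<Rightarrow> (real^3) set measure \<Rightarrow> bool" where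
  "invariant_geodesic_measure K \<mu> \<longleftrightarrow>
     sets \<mu> = sets (geodesic_borel K) \<and>
     (\<forall>f. surface_isometry K f \<longrightarrow>
        (\<forall>E\<in>sets \<mu>. emeasure \<mu> ((\<lambda>g. f ` g) ` E) = emeasure \<mu> E)) \<and>
     (\<forall>\<gamma> N a b. unit_geodesic K \<gamma> \<longrightarrow> unit_normal_field K \<gamma> N \<longrightarrow> a < b \<longrightarrow>
        inj_on (crossing K \<gamma> N) ({a<..<b} \<times> {0<..<pi}) \<longrightarrow>
        (\<forall>E\<in>sets \<mu>. E \<subseteq> crossing K \<gamma> N ` ({a<..<b} \<times> {0<..<pi}) \<longrightarrow>
           emeasure \<mu> E =
             (\<integral>\<^sup>+l\<in>{a<..<b}. (\<integral>\<^sup>+\<alpha>\<in>{0<..<pi}.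
                ennreal (sin \<alpha>) * indicator E (crossing K \<gamma> N (l, \<alpha>)) \<partial>lborel) \<partial>lborel)))"

text \<open>
  Any two points are joined by a minimising geodesic segment inside the set. On the sphere this
  is the most permissive usual convention: it admits closed hemispheres and lunes.
\<close>

definition geodesically_convex :: "real \<Rightarrow> (real^3) set \<Rightarrow> bool" where
  "geodesically_convex K D \<longleftrightarrow>
     (\<forall>p\<in>D. \<forall>q\<in>D. \<exists>\<sigma> l. unit_geodesic K \<sigma> \<and> 0 \<le> l \<and> \<sigma> 0 = p \<and> \<sigma> l = q \<and>
        ennreal l = surface_dist K p q \<and> \<sigma> ` {0..l} \<subseteq> D)"

definition compact_domain :: "real \<Rightarrow> (real^3) set \<Rightarrow> bool" where
  "compact_domain K D \<longleftrightarrow>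
     compact D \<and>
     (\<exists>U. openin (top_of_set (surface K)) U \<and> connected U \<and> U \<noteq> {} \<and>
          D = top_of_set (surface K) closure_of U)"

definition surface_boundary :: "real \<Rightarrow> (real^3) set \<Rightarrow> (real^3) set" where
  "surface_boundary K D = top_of_set (surface K) frontier_of D"

text \<open>
  \<open>c\<close> runs once around \<open>S\<close>, a simple closed curve. In particular \<open>S\<close> is nonempty, so the whole
  sphere does not have such a boundary.
\<close>

definition parametrizes_closed_curve :: "(real \<Rightarrow> real^3) \<Rightarrow> (real^3) set \<Rightarrow> bool" where
  "parametrizes_closed_curve c S \<longleftrightarrow>
     simple_path c \<and> pathstart c = pathfinish c \<and> path_image c = S"

definition geodesic_polygon :: "real \<Rightarrow> (real \<Rightarrow> real^3) \<Rightarrow> bool" where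
  "geodesic_polygon K c \<longleftrightarrow>
     (\<exists>(n::nat) \<tau>. \<tau> 0 = 0 \<and> \<tau> n = 1 \<and>
        (\<forall>i<n. \<tau> i < \<tau> (Suc i) \<and>
           (\<exists>\<sigma> v. unit_geodesic K \<sigma> \<and> v > 0 \<and>
              (\<forall>t\<in>{\<tau> i..\<tau> (Suc i)}. c t = \<sigma> (v * (t - \<tau> i))))))"

definition C1_closed_curve :: "(real \<Rightarrow> real^3) \<Rightarrow> bool" where
  "C1_closed_curve c \<longleftrightarrow>
     (\<forall>t. c (t + 1) = c t) \<and> c C1_differentiable_on UNIV \<and>
     (\<forall>t. vector_derivative c (at t) \<noteq> 0)"

end

theory Submission
  imports Defs
begin

text \<open>
  A geodesic segment of length \<open>d\<close> is crossed by geodesics of total measure \<open>2 d\<close>, directly from the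
  normalisation of \<open>\<mu>\<close>; by additivity every pencil of geodesics through a point is therefore null.
  Inscribe in the boundary curve the closed geodesic polygon with vertices \<open>c (i / 2^k)\<close>. A geodesic
  that meets the interior of \<open>D\<close> and misses all these vertices crosses the polygon at most twice, and
  exactly twice once \<open>k\<close> is large, because it meets the boundary in at most two points and leaves
  boundary points on both sides; a geodesic that misses the interior leaves \<open>D\<close> on one side and never
  crosses. Integrating the number of crossings and letting \<open>k\<close> tend to infinity (Fatou's lemma on one
  side, convergence of the polygon lengths on the other) gives the measure of the geodesics meeting
  the interior. The remaining geodesics support \<open>D\<close>; they form a null set by Fubini's theorem, since
  at most two of them pass through a given point that is not in \<open>D\<close> (nor antipodal to one).

  All three geometries are treated at once: geodesics are the sections of the surface by planes
  through the origin, and a convex set is a section of a convex cone.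
\<close>

subsection \<open>Trigonometry of constant curvature\<close>

text \<open>Crossings are counted on inscribed polygons and not on the boundary curve, so no change
  of variables along that curve occurs: the normalisation of \<mu> enters only through geodesic
  segments. The curve itself enters through a Lipschitz bound and a derivative off a finite set,
  which covers polygons and C1 curves alike. Dyadic vertices form one countable set, so a single
  null set of geodesics is discarded for all \<open>k\<close>.

  The sphere shapes the convexity arguments. Closed hemispheres and lunes contain antipodal pairs,
  whose minimising segments are not unique, and a line through the origin meets the surface in two
  points. Each step therefore either excludes antipodes or carries a sign along.

  The interior of \<open>D\<close> is represented by the open connected set \<open>U\<close> whose
  closure is \<open>D\<close>. Connectedness puts \<open>U\<close> on one side of every geodesic
  that misses it, and passing to the closure puts \<open>D\<close> there as well. Geodesics that
  miss \<open>U\<close> may still touch \<open>D\<close>, and for them no crossing is ever counted;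
  this is why they must be shown null separately.\<close>

definition cs :: "real \<Rightarrow> real \<Rightarrow> real" where
  "cs K t = (if K = 0 then 1 else if K > 0 then cos (sqrt K * t) else cosh (sqrt (- K) * t))"

text \<open>\<open>cs K\<close> and \<open>sn K\<close> are the solutions of
  \<open>y'' = - K y\<close> with initial values (1, 0) and (0, 1). They let all later formulas be
  stated without a case distinction on the sign of \<open>K\<close>.\<close>

definition sn :: "real \<Rightarrow> real \<Rightarrow> real" where
  "sn K t = (if K = 0 then t else if K > 0 then sin (sqrt K * t) / sqrt K
             else sinh (sqrt (- K) * t) / sqrt (- K))"

lemma cs_0 [simp]: "cs K 0 = 1" and sn_0 [simp]: "sn K 0 = 0"
  by (auto simp: cs_def sn_def)

lemma cs_minus [simp]: "cs K (- t) = cs K t" and sn_minus [simp]: "sn K (- t) = - sn K t"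
  by (auto simp: cs_def sn_def)

lemma cs_has_deriv: "(cs K has_real_derivative - K * sn K t) (at t)"
proof -
  consider "K = 0" | "K > 0" | "K < 0" by linarith
  then show ?thesis
  proof cases
    case 1
    then have "cs K = (\<lambda>_. 1)" by (auto simp: cs_def)
    then show ?thesis using 1 by simp
  next
    case 2
    then have "cs K = (\<lambda>t. cos (sqrt K * t))" by (auto simp: cs_def)
    moreover have "K * (sin (sqrt K * t) / sqrt K) = sqrt K * sin (sqrt K * t)"
      using 2 by (simp add: field_simps)
    ultimately show ?thesis using 2
      by (auto intro!: derivative_eq_intros simp: sn_def)
  next
    case 3
    then have "cs K = (\<lambda>t. cosh (sqrt (- K) * t))" by (auto simp: cs_def)
    moreover have "- K * (sinh (sqrt (- K) * t) / sqrt (- K)) = sqrt (- K) * sinh (sqrt (- K) * t)"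
    proof -
      have "- K / sqrt (- K) = sqrt (- K)" using 3 real_div_sqrt[of "- K"] by linarith
      then show ?thesis by (metis times_divide_eq_left times_divide_eq_right)
    qed
    ultimately show ?thesis using 3
      by (auto intro!: derivative_eq_intros simp: sn_def)
  qed
qed

lemma sn_has_deriv: "(sn K has_real_derivative cs K t) (at t)"
proof -
  consider "K = 0" | "K > 0" | "K < 0" by linarith
  then show ?thesis
  proof cases
    case 1
    then have "sn K = (\<lambda>t. t)" by (auto simp: sn_def)
    then show ?thesis using 1 by (simp add: cs_def)
  next
    case 2
    then have "sn K = (\<lambda>t. sin (sqrt K * t) / sqrt K)" by (auto simp: sn_def)
    moreover have "cos (sqrt K * t) * sqrt K / sqrt K = cos (sqrt K * t)"
      using 2 nonzero_mult_div_cancel_right[of "sqrt K"] by auto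
    moreover have "((\<lambda>t. sin (sqrt K * t) / sqrt K) has_real_derivative
        (cos (sqrt K * t) * (sqrt K * 1)) / sqrt K) (at t)"
      by (intro DERIV_cdivide DERIV_chain'[OF _ DERIV_sin] DERIV_cmult DERIV_ident)
    ultimately show ?thesis using 2
      by (simp only: cs_def) auto
  next
    case 3
    then have "sn K = (\<lambda>t. sinh (sqrt (- K) * t) / sqrt (- K))" by (auto simp: sn_def)
    moreover have "cosh (sqrt (- K) * t) * sqrt (- K) / sqrt (- K) = cosh (sqrt (- K) * t)"
      using 3 nonzero_mult_div_cancel_right[of "sqrt (- K)"] by auto
    moreover have "((\<lambda>t. sinh (sqrt (- K) * t) / sqrt (- K)) has_real_derivative
        (cosh (sqrt (- K) * t) * (sqrt (- K) * 1)) / sqrt (- K)) (at t)"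
      by (intro DERIV_cdivide has_field_derivative_sinh DERIV_cmult DERIV_ident)
    ultimately show ?thesis using 3
      by (simp only: cs_def) auto
  qed
qed

lemma cs_sn_sq: "(cs K t)\<^sup>2 + K * (sn K t)\<^sup>2 = 1"
proof -
  consider "K = 0" | "K > 0" | "K < 0" by linarith
  then show ?thesis
    by cases (auto simp: cs_def sn_def power_divide cosh_square_eq)
qed

lemma cs_add: "cs K (s + t) = cs K s * cs K t - K * (sn K s * sn K t)"
proof -
  consider "K = 0" | "K > 0" | "K < 0" by linarith
  then show ?thesis
    by cases (auto simp: cs_def sn_def cos_add cosh_add distrib_left)
qed

lemma sn_add: "sn K (s + t) = sn K s * cs K t + cs K s * sn K t"
proof -
  consider "K = 0" | "K > 0" | "K < 0" by linarith
  then show ?thesis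
    by cases (auto simp: cs_def sn_def sin_add sinh_add distrib_left add_divide_distrib)
qed

text \<open>\<open>pi / sqrt K\<close> is half the length of a great circle. This first positive
  zero of \<open>sn K\<close> is behind every length restriction imposed below for
  \<open>K > 0\<close>.\<close>

lemma sn_pos:
  assumes "0 < t" "K > 0 \<Longrightarrow> t < pi / sqrt K"
  shows "sn K t > 0"
proof -
  consider "K = 0" | "K > 0" | "K < 0" by linarith
  then show ?thesis
  proof cases
    case 2
    then have "sqrt K * t < pi" using assms by (simp add: field_simps)
    then show ?thesis using 2 assms by (auto simp: sn_def intro!: sin_gt_zero divide_pos_pos)
  qed (use assms in \<open>auto simp: sn_def\<close>)
qed

lemma sn_mono_sign:
  assumes "s < l" "l < t" "K > 0 \<Longrightarrow> t - s < pi / sqrt K"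
  shows "sn K (s - l) < 0" "sn K (t - l) > 0"
proof -
  have "sn K (l - s) > 0" using assms by (intro sn_pos) auto
  then show "sn K (s - l) < 0" using sn_minus[of K "l - s"] by simp
  show "sn K (t - l) > 0" using assms by (intro sn_pos) auto
qed

text \<open>For \<open>K \<le> 0\<close> the curve \<open>a\<^sup>2 + K * b\<^sup>2 = 1\<close> has
  two branches, and \<open>a > 0\<close> selects the one that is parametrised. For
  \<open>K > 0\<close> it is closed; the bound of \<open>t\<close> by one period later locates a
  point on a given segment.\<close>

lemma cs_sn_surj:
  assumes "a\<^sup>2 + K * b\<^sup>2 = 1" "K \<le> 0 \<Longrightarrow> a > 0"
  obtains t where "cs K t = a" "sn K t = b" "K > 0 \<Longrightarrow> 0 \<le> t \<and> t < 2 * pi / sqrt K"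
proof -
  consider "K = 0" | "K > 0" | "K < 0" by linarith
  then show ?thesis
  proof cases
    case 1
    then have "a = 1" using assms by (simp add: power2_eq_1_iff)
    then show ?thesis using 1 that[of b] by (simp add: cs_def sn_def)
  next
    case 2
    then have "a\<^sup>2 + (sqrt K * b)\<^sup>2 = 1" using assms by (simp add: power_mult_distrib)
    then obtain t where t: "0 \<le> t" "t < 2 * pi" "a = cos t" "sqrt K * b = sin t"
      using sincos_total_2pi by metis
    then show ?thesis using 2
      by (intro that[of "t / sqrt K"]) (auto simp: cs_def sn_def field_simps divide_right_mono divide_strict_right_mono)
  next
    case 3
    define t where "t = arsinh (sqrt (- K) * b) / sqrt (- K)"
    have "sn K t = b" using 3 by (simp add: sn_def t_def)
    moreover from this have "(cs K t)\<^sup>2 = a\<^sup>2" using cs_sn_sq[of K t] assms by simp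
    moreover have "cs K t > 0" using 3 by (auto simp: cs_def)
    ultimately show ?thesis using 3 assms that[of t]
      by (metis less_eq_real_def linorder_not_less power2_eq_iff_nonneg)
  qed
qed

subsection \<open>The form\<close>

lemma bounded_bilinear_form: "bounded_bilinear (form K)"
proof
  fix a a' b b' :: "real^3" and r :: real
  show "form K (a + a') b = form K a b + form K a' b"
    "form K a (b + b') = form K a b + form K a b'"
    "form K (r *\<^sub>R a) b = r *\<^sub>R form K a b"
    "form K a (r *\<^sub>R b) = r *\<^sub>R form K a b"
    by (simp_all add: form_def algebra_simps)
  have "norm (form K a b) \<le> norm a * norm b * 3" for a b
  proof -
    have c: "\<bar>a $ i * b $ i\<bar> \<le> norm a * norm b" for i
      unfolding abs_mult by (intro mult_mono component_le_norm_cart) auto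
    have "\<bar>sgn K * (a $ 3 * b $ 3)\<bar> \<le> \<bar>a $ 3 * b $ 3\<bar>"
      by (simp add: abs_mult sgn_real_def)
    then show ?thesis using c[of 1] c[of 2] c[of 3] by (simp add: form_def)
  qed
  then show "\<exists>C. \<forall>a b. norm (form K a b) \<le> norm a * norm b * C" by blast
qed

lemmas form_simps = bounded_bilinear.add_left[OF bounded_bilinear_form]
  bounded_bilinear.add_right[OF bounded_bilinear_form]
  bounded_bilinear.diff_left[OF bounded_bilinear_form]
  bounded_bilinear.diff_right[OF bounded_bilinear_form]
  bounded_bilinear.minus_left[OF bounded_bilinear_form]
  bounded_bilinear.minus_right[OF bounded_bilinear_form]
  bounded_bilinear.zero_left[OF bounded_bilinear_form]
  bounded_bilinear.zero_right[OF bounded_bilinear_form]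
  bounded_bilinear.scaleR_left[OF bounded_bilinear_form]
  bounded_bilinear.scaleR_right[OF bounded_bilinear_form]

lemmas continuous_on_form [continuous_intros] =
  bounded_bilinear.continuous_on[OF bounded_bilinear_form]

lemmas tendsto_form = bounded_bilinear.tendsto[OF bounded_bilinear_form]

lemma form_commute: "form K u v = form K v u"
  by (simp add: form_def mult.commute)

lemma form_le_norm: "form K v v \<le> (norm v)\<^sup>2"
  by (simp add: form_def norm_vec_def L2_set_def sum_3 power2_eq_square sgn_real_def sum_nonneg)

lemma surface_form: "p \<in> surface K \<Longrightarrow> K \<noteq> 0 \<Longrightarrow> form K p p = 1 / K"
  by (simp add: surface_def)

lemma surface_nth_3_pos: "p \<in> surface K \<Longrightarrow> K \<le> 0 \<Longrightarrow> p $ 3 > 0"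
  by (auto simp: surface_def split: if_splits)

lemma surface_nonzero: "p \<in> surface K \<Longrightarrow> p \<noteq> 0"
  by (auto simp: surface_def form_simps split: if_splits)

text \<open>For \<open>K < 0\<close> the form is indefinite on the ambient space, but it is positive
  on vectors orthogonal to a point with negative form: this is the Cauchy-Schwarz inequality in the
  first two coordinates. For \<open>K = 0\<close> the degenerate direction is not tangent.\<close>

lemma tangent_form_pos:
  assumes p: "p \<in> surface K" and v: "v \<in> tangent_plane K p" "v \<noteq> 0"
  shows "form K v v > 0"
proof -
  have nz: "v $ 1 \<noteq> 0 \<or> v $ 2 \<noteq> 0 \<or> v $ 3 \<noteq> 0"
    using v(2) by (auto simp: vec_eq_iff forall_3)
  consider "K = 0" | "K > 0" | "K < 0" by linarith
  then show ?thesis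
  proof cases
    case 1
    then have "v $ 1 \<noteq> 0 \<or> v $ 2 \<noteq> 0" using v nz by (auto simp: tangent_plane_def)
    then have "v $ 1 * v $ 1 + v $ 2 * v $ 2 > 0"
      by (metis not_sum_squares_lt_zero not_less_iff_gr_or_eq sum_squares_eq_zero_iff)
    then show ?thesis using 1 by (simp add: form_def)
  next
    case 2
    then have "form K v v = v $ 1 * v $ 1 + v $ 2 * v $ 2 + v $ 3 * v $ 3" by (simp add: form_def)
    moreover have "v $ 1 * v $ 1 \<ge> 0" "v $ 2 * v $ 2 \<ge> 0" "v $ 3 * v $ 3 \<ge> 0" by simp_all
    moreover have "v $ 1 * v $ 1 \<noteq> 0 \<or> v $ 2 * v $ 2 \<noteq> 0 \<or> v $ 3 * v $ 3 \<noteq> 0" using nz by simp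
    ultimately show ?thesis by linarith
  next
    case 3
    define r where "r = v $ 1 * v $ 1 + v $ 2 * v $ 2"
    have orth: "p $ 1 * v $ 1 + p $ 2 * v $ 2 = p $ 3 * v $ 3"
      using v 3 by (simp add: form_def tangent_plane_def)
    have pp: "p $ 1 * p $ 1 + p $ 2 * p $ 2 = p $ 3 * p $ 3 + 1 / K"
      using p 3 by (simp add: form_def surface_def)
    have p3: "p $ 3 > 0" using p 3 surface_nth_3_pos by simp
    have rpos: "r > 0"
    proof (rule ccontr)
      assume "\<not> r > 0"
      then have "v $ 1 = 0" "v $ 2 = 0"
        unfolding r_def by (smt (verit) mult_eq_0_iff zero_le_square)+
      then show False using orth p3 nz by auto
    qed
    have "(p $ 3 * v $ 3)\<^sup>2 \<le> (p $ 3 * p $ 3 + 1 / K) * r"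
      unfolding pp[symmetric] orth[symmetric] r_def
      using zero_le_power2[of "p $ 1 * v $ 2 - p $ 2 * v $ 1"]
      by (simp add: power2_eq_square algebra_simps)
    also have "\<dots> < p $ 3 * p $ 3 * r"
      using rpos 3 by (simp add: mult_less_cancel_right_disj)
    finally have "p $ 3 * p $ 3 * (v $ 3 * v $ 3) < p $ 3 * p $ 3 * r"
      by (simp add: power2_eq_square algebra_simps)
    then have "v $ 3 * v $ 3 < r" using p3 by (simp add: mult_less_cancel_left_disj)
    then show ?thesis using 3 by (simp add: form_def r_def)
  qed
qed

subsection \<open>Geodesics\<close>

text \<open>The closed solution of \<open>x'' = - K x\<close> with position \<open>p\<close> and
  velocity \<open>v\<close> at time 0. Being linear in \<open>p\<close> and \<open>v\<close>, it
  stays in the plane that they span.\<close>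

definition geo :: "real \<Rightarrow> real^3 \<Rightarrow> real^3 \<Rightarrow> real \<Rightarrow> real^3" where
  "geo K p v t = cs K t *\<^sub>R p + sn K t *\<^sub>R v"

definition geo_vel :: "real \<Rightarrow> real^3 \<Rightarrow> real^3 \<Rightarrow> real \<Rightarrow> real^3" where
  "geo_vel K p v t = (- K * sn K t) *\<^sub>R p + cs K t *\<^sub>R v"

lemma geo_has_deriv: "(geo K p v has_vector_derivative geo_vel K p v t) (at t)"
proof -
  have "((\<lambda>t. cs K t *\<^sub>R p + sn K t *\<^sub>R v) has_vector_derivative
      (cs K t *\<^sub>R 0 + (- K * sn K t) *\<^sub>R p) + (sn K t *\<^sub>R 0 + cs K t *\<^sub>R v)) (at t)"
    by (intro has_vector_derivative_add has_vector_derivative_scaleR cs_has_deriv sn_has_deriv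
        has_vector_derivative_const)
  then show ?thesis by (simp add: geo_def[abs_def] geo_vel_def)
qed

lemma geo_vel_has_deriv: "(geo_vel K p v has_vector_derivative - K *\<^sub>R geo K p v t) (at t)"
proof -
  have d: "((\<lambda>t. - K * sn K t) has_real_derivative - K * cs K t) (at t)"
    using sn_has_deriv[THEN DERIV_cmult] by blast
  have "((\<lambda>t. (- K * sn K t) *\<^sub>R p + cs K t *\<^sub>R v) has_vector_derivative
      ((- K * sn K t) *\<^sub>R 0 + (- K * cs K t) *\<^sub>R p) + (cs K t *\<^sub>R 0 + (- K * sn K t) *\<^sub>R v)) (at t)"
    by (intro has_vector_derivative_add has_vector_derivative_scaleR cs_has_deriv d
        has_vector_derivative_const)
  then show ?thesis by (simp add: geo_def geo_vel_def[abs_def] algebra_simps)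
qed

lemma geo_0 [simp]: "geo K p v 0 = p" and geo_vel_0 [simp]: "geo_vel K p v 0 = v"
  by (auto simp: geo_def geo_vel_def)

lemma continuous_geo: "continuous_on S (geo K p v)"
  by (meson continuous_at_imp_continuous_on geo_has_deriv has_vector_derivative_continuous)

lemma geo_add: "geo K p v (s + t) = geo K (geo K p v s) (geo_vel K p v s) t"
  by (simp add: geo_def geo_vel_def cs_add sn_add algebra_simps)

lemma geo_diff: "geo K p v t = geo K (geo K p v l) (geo_vel K p v l) (t - l)"
  using geo_add[of K p v l "t - l"] by simp

lemma closed_surface: "closed (surface K)"
proof -
  consider "K = 0" | "K > 0" | "K < 0" by linarith
  then show ?thesis
  proof cases
    case 1
    then have "surface K = {x. x $ 3 = 1}" by (auto simp: surface_def)
    then show ?thesis by (auto intro!: closed_Collect_eq continuous_intros)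
  next
    case 2
    then have "surface K = {x. form K x x = 1 / K}" by (auto simp: surface_def)
    then show ?thesis by (auto intro!: closed_Collect_eq continuous_intros)
  next
    case 3
    have "x $ 3 \<noteq> 0" if "form K x x = 1 / K" for x
    proof
      assume "x $ 3 = 0"
      then have "form K x x \<ge> 0" by (simp add: form_def)
      then show False using that 3 by (simp add: zero_le_divide_iff)
    qed
    then have "surface K = {x. form K x x = 1 / K} \<inter> {x. 0 \<le> x $ 3}" using 3
      by (force simp: surface_def)
    then show ?thesis by (auto intro!: closed_Collect_eq closed_Collect_le continuous_intros)
  qed
qed

text \<open>On the upper sheet the third coordinate is positive and exceeds the length of the planar
  part, so Cauchy-Schwarz in the plane bounds the planar product by the product of the third
  coordinates.\<close>

lemma surface_form_neg:
  assumes "K < 0" "x \<in> surface K" "y \<in> surface K"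
  shows "form K x y < 0"
proof -
  have neg: "1 / K < 0" using assms(1) by simp
  have x: "x $ 1 * x $ 1 + x $ 2 * x $ 2 < x $ 3 * x $ 3" and x3: "x $ 3 > 0"
    using surface_form[of x K] surface_nth_3_pos[of x K] neg assms
    by (auto simp: form_def simp del: divide_less_0_1_iff)
  have y: "y $ 1 * y $ 1 + y $ 2 * y $ 2 < y $ 3 * y $ 3" and y3: "y $ 3 > 0"
    using surface_form[of y K] surface_nth_3_pos[of y K] neg assms
    by (auto simp: form_def simp del: divide_less_0_1_iff)
  have "(x $ 1 * y $ 1 + x $ 2 * y $ 2)\<^sup>2
      \<le> (x $ 1 * x $ 1 + x $ 2 * x $ 2) * (y $ 1 * y $ 1 + y $ 2 * y $ 2)"
    using zero_le_power2[of "x $ 1 * y $ 2 - x $ 2 * y $ 1"]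
    by (simp add: power2_eq_square algebra_simps)
  also have "\<dots> < (x $ 3 * x $ 3) * (y $ 3 * y $ 3)"
    using x y x3 by (intro mult_strict_mono) (auto simp: add_nonneg_nonneg)
  finally have "(x $ 1 * y $ 1 + x $ 2 * y $ 2)\<^sup>2 < (x $ 3 * y $ 3)\<^sup>2"
    by (simp add: power2_eq_square algebra_simps)
  then have "x $ 1 * y $ 1 + x $ 2 * y $ 2 < x $ 3 * y $ 3"
    using x3 y3 by (auto intro: power_less_imp_less_base)
  then show ?thesis using assms by (simp add: form_def)
qed

section \<open>Orthonormal frames and planes through the origin\<close>

definition frame :: "real \<Rightarrow> real^3 \<Rightarrow> real^3 \<Rightarrow> real^3 \<Rightarrow> bool" where
  "frame K p v w \<longleftrightarrow> p \<in> surface K \<and> v \<in> tangent_plane K p \<and> w \<in> tangent_plane K p \<and>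
     form K v v = 1 \<and> form K w w = 1 \<and> form K v w = 0"

text \<open>A frame is a basis of the whole space even for \<open>K = 0\<close>, where
  \<open>form K\<close> is degenerate; there the third coordinate, 1 at \<open>p\<close> and 0 on
  tangent vectors, replaces the pairing with \<open>p\<close>.\<close>

lemma frame_independent:
  assumes "frame K p v w" "a *\<^sub>R p + b *\<^sub>R v + c *\<^sub>R w = 0"
  shows "a = 0" "b = 0" "c = 0"
proof -
  note f = assms(1)[unfolded frame_def]
  show a: "a = 0"
  proof (cases "K = 0")
    case True
    then show ?thesis using f arg_cong[OF assms(2), of "\<lambda>x. x $ 3"]
      by (auto simp: tangent_plane_def surface_def)
  next
    case False
    then show ?thesis using f arg_cong[OF assms(2), of "form K p"]
      by (auto simp: tangent_plane_def surface_form form_simps)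
  qed
  show "b = 0" using f arg_cong[OF assms(2), of "form K v"] a
    by (auto simp: form_simps)
  show "c = 0" using f arg_cong[OF assms(2), of "form K w"] a
    by (auto simp: form_simps form_commute[of K w v])
qed

lemma frame_decomp:
  assumes "frame K p v w"
  obtains a b c where "x = a *\<^sub>R p + b *\<^sub>R v + c *\<^sub>R w"
proof -
  define f where "f = (\<lambda>a::real^3. a $ 1 *\<^sub>R p + a $ 2 *\<^sub>R v + a $ 3 *\<^sub>R w)"
  have lin: "linear f"
    by (rule linearI) (auto simp: f_def algebra_simps)
  moreover have "inj f"
  proof (subst linear_injective_0[OF lin], intro allI impI)
    fix a assume "f a = 0"
    then have "a $ 1 *\<^sub>R p + a $ 2 *\<^sub>R v + a $ 3 *\<^sub>R w = 0" by (simp add: f_def)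
    from frame_independent[OF assms this] show "a = 0" by (simp add: vec_eq_iff forall_3)
  qed
  ultimately have "surj f" using linear_injective_imp_surjective by blast
  then obtain a where "x = f a" by (metis surjD)
  then show ?thesis using that by (auto simp: f_def)
qed

text \<open>The Euclidean inner product is used here and not \<open>form K\<close>: \<open>n\<close>
  serves as a linear functional, which works uniformly in \<open>K\<close>.\<close>

lemma frame_orth_zero:
  assumes "frame K p v w" "n \<bullet> p = 0" "n \<bullet> v = 0" "n \<bullet> w = 0"
  shows "n = 0"
proof -
  obtain a b c where "n = a *\<^sub>R p + b *\<^sub>R v + c *\<^sub>R w" using frame_decomp[OF assms(1)] .
  then have "n \<bullet> n = n \<bullet> (a *\<^sub>R p + b *\<^sub>R v + c *\<^sub>R w)" by simp
  also have "\<dots> = 0" using assms by (simp add: inner_add_right)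
  finally show ?thesis by simp
qed

lemma frame_plane:
  assumes "frame K p v w" "n \<noteq> 0" "n \<bullet> p = 0" "n \<bullet> v = 0" "n \<bullet> x = 0"
  obtains a b where "x = a *\<^sub>R p + b *\<^sub>R v"
proof -
  obtain a b c where x: "x = a *\<^sub>R p + b *\<^sub>R v + c *\<^sub>R w" using frame_decomp[OF assms(1)] .
  have "n \<bullet> w \<noteq> 0" using frame_orth_zero[OF assms(1)] assms by blast
  moreover have "c * (n \<bullet> w) = 0" using assms x by (simp add: inner_add_right)
  ultimately show ?thesis using that x by simp
qed

lemma geo_form_self:
  assumes "frame K p v w" "K \<noteq> 0"
  shows "form K (geo K p v t) (geo K p v t) = 1 / K"
proof -
  have "form K (geo K p v t) (geo K p v t) = (cs K t)\<^sup>2 / K + (sn K t)\<^sup>2"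
    using assms by (auto simp: geo_def form_simps frame_def tangent_plane_def surface_form
        form_commute[of K v p] power2_eq_square)
  also have "\<dots> = ((cs K t)\<^sup>2 + K * (sn K t)\<^sup>2) / K" using assms(2) by (simp add: field_simps)
  finally show ?thesis by (simp add: cs_sn_sq)
qed

lemma geo_in_surface:
  assumes "frame K p v w"
  shows "geo K p v t \<in> surface K"
proof -
  consider "K = 0" | "K > 0" | "K < 0" by linarith
  then show ?thesis
  proof cases
    case 1
    then show ?thesis using assms
      by (auto simp: geo_def frame_def tangent_plane_def surface_def cs_def)
  next
    case 2
    then show ?thesis using geo_form_self[OF assms] by (auto simp: surface_def)
  next
    case 3
    \<comment> \<open>Points of the hyperboloid have nonzero third coordinate, so by the
      intermediate value theorem the curve cannot change sheets.\<close>
    have nz: "geo K p v t $ 3 \<noteq> 0" for t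
    proof
      assume "geo K p v t $ 3 = 0"
      then have "form K (geo K p v t) (geo K p v t) \<ge> 0" by (simp add: form_def)
      then show False using geo_form_self[OF assms, of t] 3 by (simp add: zero_le_divide_iff)
    qed
    have "geo K p v t $ 3 > 0"
    proof (rule ccontr)
      assume "\<not> geo K p v t $ 3 > 0"
      moreover have "connected ((\<lambda>t. geo K p v t $ 3) ` UNIV)"
        by (intro connected_continuous_image continuous_intros continuous_geo connected_UNIV)
      moreover have "geo K p v 0 $ 3 > 0"
        using assms 3 surface_nth_3_pos[of p K] by (simp add: frame_def)
      ultimately have "0 \<in> (\<lambda>t. geo K p v t $ 3) ` UNIV"
        by (meson connectedD_interval linorder_not_less order_less_imp_le rangeI)
      then show False using nz by force
    qed
    then show ?thesis using geo_form_self[OF assms] 3 by (auto simp: surface_def)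
  qed
qed

text \<open>The normal \<open>w\<close> is orthogonal to the plane that contains the geodesic, so it
  is a unit normal at every point without being transported. Hence the constant field
  \<open>\<lambda>_. w\<close> can serve in the crossing charts.\<close>

lemma frame_geo:
  assumes "frame K p v w"
  shows "frame K (geo K p v t) (geo_vel K p v t) w"
proof -
  note f = assms[unfolded frame_def]
  have "form K (geo_vel K p v t) (geo_vel K p v t) = (cs K t)\<^sup>2 + K * (sn K t)\<^sup>2"
  proof (cases "K = 0")
    case True
    then show ?thesis using f by (auto simp: geo_vel_def form_simps power2_eq_square)
  next
    case False
    then show ?thesis using f
      by (auto simp: geo_vel_def form_simps tangent_plane_def surface_form
          form_commute[of K v p] power2_eq_square)
  qed
  moreover have "geo_vel K p v t \<in> tangent_plane K (geo K p v t)"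
    using f by (auto simp: geo_def geo_vel_def form_simps tangent_plane_def surface_form
          form_commute[of K v p] algebra_simps)
  moreover have "w \<in> tangent_plane K (geo K p v t)"
    using f by (auto simp: geo_def form_simps tangent_plane_def)
  moreover have "form K (geo_vel K p v t) w = 0"
    using f by (cases "K = 0") (auto simp: geo_vel_def form_simps tangent_plane_def)
  ultimately show ?thesis
    using f geo_in_surface[OF assms] unfolding frame_def by (simp add: cs_sn_sq)
qed

lemma tangent_plane_lin:
  "v \<in> tangent_plane K p \<Longrightarrow> w \<in> tangent_plane K p \<Longrightarrow> a *\<^sub>R v + b *\<^sub>R w \<in> tangent_plane K p"
  by (auto simp: tangent_plane_def form_simps)

lemma frame_rot:
  assumes "frame K p v w"
  shows "frame K p (cos a *\<^sub>R v + sin a *\<^sub>R w) ((- sin a) *\<^sub>R v + cos a *\<^sub>R w)"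
proof -
  note f = assms[unfolded frame_def]
  have e: "sin a * sin a + cos a * cos a = 1" "cos a * cos a + sin a * sin a = 1"
    using sin_cos_squared_add[of a] by (simp_all add: power2_eq_square algebra_simps)
  show ?thesis
    using f unfolding frame_def
    by (intro conjI tangent_plane_lin) (auto simp: form_simps form_commute[of K w v] e)
qed

lemma frame_swap: "frame K p v w \<Longrightarrow> frame K p w v"
  by (auto simp: frame_def form_commute)

lemma frame_exists:
  assumes p: "p \<in> surface K" and v: "v \<in> tangent_plane K p" "form K v v = 1"
  obtains w where "frame K p v w"
proof (cases "K = 0")
  case True
  define w :: "real^3" where "w = vector [- (v $ 2), v $ 1, 0]"
  have "frame K p v w" using True p v
    by (auto simp: frame_def w_def form_def tangent_plane_def vector_3)
  then show ?thesis by (rule that)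
next
  case False
  define s where "s = sqrt \<bar>K\<bar>"
  \<comment> \<open>The cross product of \<open>p\<close> and \<open>v\<close>, with the sign of its
    third coordinate adapted to the form. Since \<open>form K p p = 1 / K\<close>, the factor
    \<open>sqrt \<bar>K\<bar>\<close> normalises it.\<close>
  define w :: "real^3" where "w = s *\<^sub>R vector [p $ 2 * v $ 3 - p $ 3 * v $ 2,
     p $ 3 * v $ 1 - p $ 1 * v $ 3, sgn K * (p $ 1 * v $ 2 - p $ 2 * v $ 1)]"
  have ss: "s * s = \<bar>K\<bar>" by (simp add: s_def)
  have sg: "sgn K * sgn K = 1" "sgn K * (sgn K * x) = x" for x
    using False by (auto simp: sgn_real_def)
  have pp: "form K p p = 1 / K" and pv: "form K p v = 0"
    using p v False by (auto simp: surface_form tangent_plane_def)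
  have "form K p w = 0" "form K v w = 0"
    using sg by (simp_all add: form_def w_def vector_3 algebra_simps)
  moreover have "form K w w = 1"
  proof -
    have "form K w w = (s * s) * ((p $ 2 * v $ 3 - p $ 3 * v $ 2)\<^sup>2 + (p $ 3 * v $ 1 - p $ 1 * v $ 3)\<^sup>2
       + sgn K * (sgn K * sgn K) * (p $ 1 * v $ 2 - p $ 2 * v $ 1)\<^sup>2)"
      by (simp add: form_def w_def vector_3 power2_eq_square algebra_simps)
    \<comment> \<open>Lagrange's identity for \<open>form K\<close>.\<close>
    also have "\<dots> = (s * s) * (sgn K * (form K p p * form K v v - (form K p v)\<^sup>2))"
      using False by (cases "K > 0") (auto simp: form_def power2_eq_square algebra_simps)
    also have "\<dots> = 1" using False by (simp add: ss pp pv v sgn_real_def)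
    finally show ?thesis .
  qed
  ultimately have "frame K p v w" using p v False
    by (auto simp: frame_def tangent_plane_def)
  then show ?thesis by (rule that)
qed

lemma frame_exists_at:
  assumes p: "p \<in> surface K"
  obtains v w where "frame K p v w"
proof -
  obtain u where u: "u \<in> tangent_plane K p" "u \<noteq> 0"
  proof (cases "K = 0")
    case True
    then show ?thesis using that[of "vector [1, 0, 0]"]
      by (auto simp: tangent_plane_def vec_eq_iff vector_3 forall_3)
  next
    case False
    show ?thesis
    proof (cases "p $ 1 = 0 \<and> p $ 2 = 0")
      case True
      then show ?thesis using False that[of "vector [1, 0, 0]"]
        by (auto simp: tangent_plane_def form_def vec_eq_iff vector_3 forall_3)
    next
      case f: False
      then show ?thesis using False that[of "vector [p $ 2, - (p $ 1), 0]"]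
        by (auto simp: tangent_plane_def form_def vec_eq_iff vector_3 forall_3)
    qed
  qed
  define v where "v = (1 / sqrt (form K u u)) *\<^sub>R u"
  have "form K u u > 0" using tangent_form_pos[OF p] u by blast
  then have "form K v v = 1" by (simp add: v_def form_simps)
  moreover have "v \<in> tangent_plane K p" using u by (auto simp: v_def tangent_plane_def form_simps)
  ultimately show ?thesis using frame_exists[OF p] that by blast
qed

section \<open>Unit speed geodesics and their equation\<close>

lemma unit_geodesic_geo:
  assumes "frame K p v w"
  shows "unit_geodesic K (geo K p v)"
proof -
  have "form K (- K *\<^sub>R geo K p v t) u = 0" if "u \<in> tangent_plane K (geo K p v t)" for t u
    using that by (cases "K = 0") (auto simp: tangent_plane_def form_simps)
  then show ?thesis
    unfolding unit_geodesic_def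
    using geo_in_surface[OF assms] geo_has_deriv[of K p v] geo_vel_has_deriv[of K p v]
      frame_geo[OF assms, unfolded frame_def]
    by (intro conjI exI[of _ "geo_vel K p v"] exI[of _ "\<lambda>t. - K *\<^sub>R geo K p v t"]) auto
qed

text \<open>The tangential part \<open>r\<close> of \<open>a\<close> is orthogonal to itself, so it
  vanishes by positivity of the form on the tangent plane.\<close>

lemma normal_vector_collinear:
  assumes "K \<noteq> 0" "p \<in> surface K" "\<And>u. u \<in> tangent_plane K p \<Longrightarrow> form K a u = 0"
  shows "a = (K * form K a p) *\<^sub>R p"
proof (rule ccontr)
  define r where "r = a - (K * form K a p) *\<^sub>R p"
  assume "a \<noteq> (K * form K a p) *\<^sub>R p"
  then have "r \<noteq> 0" by (simp add: r_def)
  have r: "r \<in> tangent_plane K p" using assms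
    by (auto simp: r_def tangent_plane_def form_simps surface_form form_commute[of K p a])
  have "form K r r = form K a r - K * form K a p * form K p r"
    by (simp add: r_def form_simps form_commute[of K p a] algebra_simps)
  then have "form K r r = 0" using assms(3)[OF r] assms(1) r by (simp add: tangent_plane_def)
  then show False using tangent_form_pos[OF assms(2) r \<open>r \<noteq> 0\<close>] by simp
qed

lemma has_vector_derivative_const_zero:
  assumes "\<And>t. f t = c" "(f has_vector_derivative d) (at t)"
  shows "d = 0"
proof -
  have "f = (\<lambda>_. c)" using assms by auto
  then show ?thesis using assms(2) has_vector_derivative_const vector_derivative_unique_at by blast
qed

text \<open>The geodesic equation is the linear equation \<open>\<gamma>'' = - K \<gamma>\<close>.\<close>

lemma unit_geodesic_accel:
  assumes surf: "\<And>t. \<gamma> t \<in> surface K"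
    and d1: "\<And>t. (\<gamma> has_vector_derivative \<gamma>' t) (at t)"
    and d2: "\<And>t. (\<gamma>' has_vector_derivative \<gamma>'' t) (at t)"
    and unit: "\<And>t. form K (\<gamma>' t) (\<gamma>' t) = 1"
    and normal: "\<And>t u. u \<in> tangent_plane K (\<gamma> t) \<Longrightarrow> form K (\<gamma>'' t) u = 0"
  shows "\<gamma>'' t = - K *\<^sub>R \<gamma> t" and "\<gamma>' t \<in> tangent_plane K (\<gamma> t)"
proof -
  note dform = bounded_bilinear.has_vector_derivative[OF bounded_bilinear_form]
  have tang: "\<gamma>' t \<in> tangent_plane K (\<gamma> t)" for t
  proof (cases "K = 0")
    case True
    have "((\<lambda>t. \<gamma> t $ 3) has_vector_derivative \<gamma>' t $ 3) (at t)"
      using bounded_linear.has_vector_derivative[OF bounded_linear_vec_nth d1] .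
    then have "\<gamma>' t $ 3 = 0"
      using has_vector_derivative_const_zero[of "\<lambda>t. \<gamma> t $ 3" 1] surf True by (simp add: surface_def)
    then show ?thesis using True by (simp add: tangent_plane_def)
  next
    case False
    have "form K (\<gamma> t) (\<gamma>' t) + form K (\<gamma>' t) (\<gamma> t) = 0"
      using has_vector_derivative_const_zero[of "\<lambda>t. form K (\<gamma> t) (\<gamma> t)" "1 / K", OF _ dform[OF d1 d1]]
        surf False surface_form by blast
    then show ?thesis using False by (simp add: tangent_plane_def form_commute[of K "\<gamma>' t"])
  qed
  then show "\<gamma>' t \<in> tangent_plane K (\<gamma> t)" .
  show "\<gamma>'' t = - K *\<^sub>R \<gamma> t"
  proof (cases "K = 0")
    case True
    have "((\<lambda>t. \<gamma>' t $ 3) has_vector_derivative \<gamma>'' t $ 3) (at t)"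
      using bounded_linear.has_vector_derivative[OF bounded_linear_vec_nth d2] .
    then have "\<gamma>'' t $ 3 = 0"
      using has_vector_derivative_const_zero[of "\<lambda>t. \<gamma>' t $ 3" 0 "\<gamma>'' t $ 3" t]
        tang True by (simp add: tangent_plane_def)
    then have "\<gamma>'' t \<in> tangent_plane K (\<gamma> t)" using True by (simp add: tangent_plane_def)
    then show ?thesis using normal tangent_form_pos[OF surf[of t], of "\<gamma>'' t"] True by force
  next
    case False
    \<comment> \<open>Differentiating the orthogonality of \<gamma> and its velocity fixes the
      normal component of the acceleration.\<close>
    have "form K (\<gamma> t) (\<gamma>'' t) + form K (\<gamma>' t) (\<gamma>' t) = 0"
    proof (rule has_vector_derivative_const_zero)
      show "((\<lambda>t. form K (\<gamma> t) (\<gamma>' t)) has_vector_derivative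
          (form K (\<gamma> t) (\<gamma>'' t) + form K (\<gamma>' t) (\<gamma>' t))) (at t)"
        using dform[OF d1 d2] .
      show "form K (\<gamma> t) (\<gamma>' t) = 0" for t using tang[of t] False by (simp add: tangent_plane_def)
    qed
    then have "form K (\<gamma>'' t) (\<gamma> t) = - 1" using unit by (simp add: form_commute[of K "\<gamma>'' t"])
    then show ?thesis using normal_vector_collinear[OF False surf[of t], of "\<gamma>'' t"] normal by simp
  qed
qed

lemma unit_geodesic_eq_geo:
  assumes "unit_geodesic K \<gamma>"
  obtains v w where "frame K (\<gamma> 0) v w" "(\<gamma> has_vector_derivative v) (at 0)" "\<gamma> = geo K (\<gamma> 0) v"
proof -
  obtain \<gamma>' \<gamma>'' where surf: "\<And>t. \<gamma> t \<in> surface K"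
    and d1: "\<And>t. (\<gamma> has_vector_derivative \<gamma>' t) (at t)"
    and d2: "\<And>t. (\<gamma>' has_vector_derivative \<gamma>'' t) (at t)"
    and unit: "\<And>t. form K (\<gamma>' t) (\<gamma>' t) = 1"
    and normal: "\<And>t u. u \<in> tangent_plane K (\<gamma> t) \<Longrightarrow> form K (\<gamma>'' t) u = 0"
    using assms unfolding unit_geodesic_def by blast
  note acc = unit_geodesic_accel[OF surf d1 d2 unit normal]
  \<comment> \<open>Applying the inverse of the flow to position and velocity at time
    \<open>t\<close> should recover the initial data. The equation for the acceleration makes
    \<open>A\<close> and \<open>B\<close> constant, which is the uniqueness of the solution.\<close>
  define A where "A = (\<lambda>t. cs K t *\<^sub>R \<gamma> t - sn K t *\<^sub>R \<gamma>' t)"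
  define B where "B = (\<lambda>t. cs K t *\<^sub>R \<gamma>' t + (K * sn K t) *\<^sub>R \<gamma> t)"
  have dA: "(A has_vector_derivative 0) (at t)" for t
  proof -
    have "(A has_vector_derivative (cs K t *\<^sub>R \<gamma>' t + (- K * sn K t) *\<^sub>R \<gamma> t)
       - (sn K t *\<^sub>R \<gamma>'' t + cs K t *\<^sub>R \<gamma>' t)) (at t)"
      unfolding A_def by (intro has_vector_derivative_diff has_vector_derivative_scaleR
          cs_has_deriv sn_has_deriv d1 d2)
    then show ?thesis by (simp add: acc mult.commute)
  qed
  have dB: "(B has_vector_derivative 0) (at t)" for t
  proof -
    have d: "((\<lambda>t. K * sn K t) has_real_derivative K * cs K t) (at t)"
      using sn_has_deriv[THEN DERIV_cmult] by blast
    have "(B has_vector_derivative (cs K t *\<^sub>R \<gamma>'' t + (- K * sn K t) *\<^sub>R \<gamma>' t)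
       + ((K * sn K t) *\<^sub>R \<gamma>' t + (K * cs K t) *\<^sub>R \<gamma> t)) (at t)"
      unfolding B_def by (intro has_vector_derivative_add has_vector_derivative_scaleR
          cs_has_deriv d d1 d2)
    then show ?thesis by (simp add: acc mult.commute)
  qed
  have const: "f t = f 0" if "\<And>t. (f has_vector_derivative 0) (at t)" for f :: "real \<Rightarrow> real^3" and t
  proof -
    have "f t = f 0"
      by (rule has_derivative_zero_unique[of UNIV])
        (use that in \<open>auto simp: has_vector_derivative_def\<close>)
    then show ?thesis .
  qed
  have A0: "A t = \<gamma> 0" and B0: "B t = \<gamma>' 0" for t
    using const[OF dA, of t] const[OF dB, of t] by (simp_all add: A_def B_def)
  have "\<gamma> t = geo K (\<gamma> 0) (\<gamma>' 0) t" for t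
  proof -
    have "geo K (A t) (B t) t = ((cs K t)\<^sup>2 + K * (sn K t)\<^sup>2) *\<^sub>R \<gamma> t"
      by (simp add: geo_def A_def B_def power2_eq_square algebra_simps)
    then show ?thesis by (simp add: cs_sn_sq A0 B0)
  qed
  moreover obtain w where "frame K (\<gamma> 0) (\<gamma>' 0) w"
    using frame_exists surf acc(2) unit by blast
  ultimately show ?thesis using that d1 by blast
qed

section \<open>Geodesics as plane sections and their normals\<close>

lemma geodesics_eq: "geodesics K = {range (geo K p v) |p v. \<exists>w. frame K p v w}"
  unfolding geodesics_def
  by (auto intro: unit_geodesic_geo) (metis unit_geodesic_eq_geo)

lemma geodesicE:
  assumes "g \<in> geodesics K"
  obtains p v w where "frame K p v w" "g = range (geo K p v)"
  using assms unfolding geodesics_eq by blast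

lemma geodesicI: "frame K p v w \<Longrightarrow> range (geo K p v) \<in> geodesics K"
  unfolding geodesics_eq by blast

lemma geodesic_subset_surface: "g \<in> geodesics K \<Longrightarrow> g \<subseteq> surface K"
  using geo_in_surface by (elim geodesicE) auto

text \<open>In the coordinates \<open>a\<close>, \<open>b\<close> of the plane of a geodesic, the
  surface becomes the conic branch that \<open>cs_sn_surj\<close> parametrises.\<close>

lemma frame_surface_coords:
  assumes "frame K p v w" "x \<in> surface K" and ab: "x = a *\<^sub>R p + b *\<^sub>R v"
  shows "a\<^sup>2 + K * b\<^sup>2 = 1" and "K \<le> 0 \<Longrightarrow> a > 0"
proof -
  note f = assms(1)[unfolded frame_def] and x = assms(2)
  show "a\<^sup>2 + K * b\<^sup>2 = 1"
  proof (cases "K = 0")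
    case True
    then show ?thesis using x ab f by (auto simp: surface_def tangent_plane_def)
  next
    case False
    then have "form K x x = 1 / K" using x surface_form by blast
    then have "a\<^sup>2 / K + b\<^sup>2 = 1 / K" using f False ab
      by (auto simp: form_simps tangent_plane_def surface_form form_commute[of K v p] power2_eq_square)
    then show ?thesis using False by (simp add: field_simps)
  qed
  show "a > 0" if "K \<le> 0"
  proof (cases "K = 0")
    case True
    then show ?thesis using x ab f by (auto simp: surface_def tangent_plane_def)
  next
    case False
    then have K: "K < 0" using that by simp
    have "form K x p = a / K" using f ab False
      by (simp add: form_simps tangent_plane_def surface_form form_commute[of K v p])
    moreover have "form K x p < 0" using surface_form_neg[OF K] x f by blast
    ultimately show ?thesis using K by (simp add: divide_less_0_iff)
  qed
qed

lemma range_geo_eq_plane: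
  assumes "frame K p v w" "n \<noteq> 0" "n \<bullet> p = 0" "n \<bullet> v = 0"
  shows "range (geo K p v) = {x \<in> surface K. n \<bullet> x = 0}"
proof (intro equalityI subsetI)
  fix x assume "x \<in> range (geo K p v)"
  then show "x \<in> {x \<in> surface K. n \<bullet> x = 0}"
    using geo_in_surface[OF assms(1)] assms by (auto simp: geo_def inner_add_right)
next
  fix x assume x: "x \<in> {x \<in> surface K. n \<bullet> x = 0}"
  then obtain a b where ab: "x = a *\<^sub>R p + b *\<^sub>R v" using frame_plane[OF assms, of x] by auto
  have xs: "x \<in> surface K" using x by simp
  obtain t where "cs K t = a" "sn K t = b"
  proof (rule cs_sn_surj[of a K b])
    show "a\<^sup>2 + K * b\<^sup>2 = 1" by (rule frame_surface_coords(1)[OF assms(1) xs ab])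
    show "a > 0" if "K \<le> 0" by (rule frame_surface_coords(2)[OF assms(1) xs ab that])
  qed blast
  then have "x = geo K p v t" using ab by (simp add: geo_def)
  then show "x \<in> range (geo K p v)" by simp
qed

text \<open>A geodesic is cut out of the surface by a plane through the origin; \<open>nrm K g\<close> is some
  Euclidean normal of it, so only the signs of products of two values \<open>nrm K g \<bullet> x\<close> are meaningful.\<close>

definition nrm :: "real \<Rightarrow> (real^3) set \<Rightarrow> real^3" where
  "nrm K g = (SOME n. n \<noteq> 0 \<and> g = {x \<in> surface K. n \<bullet> x = 0})"

lemma frame_normal_exists:
  assumes "frame K p v w"
  obtains n where "n \<noteq> 0" "n \<bullet> p = 0" "n \<bullet> v = 0"
proof -
  have "dim {p, v} \<le> card {p, v}" by (rule dim_le_card') auto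
  also have "\<dots> \<le> 2" by (auto simp: card_insert_if)
  finally have "dim (span {p, v}) < DIM(real^3)" by simp
  then obtain n where "n \<noteq> 0" "\<And>x. x \<in> span (span {p, v}) \<Longrightarrow> orthogonal n x"
    using orthogonal_to_subspace_exists by metis
  then show ?thesis using that[of n] by (auto simp: orthogonal_def span_base)
qed

lemma nrm:
  assumes "g \<in> geodesics K"
  shows "nrm K g \<noteq> 0" and geodesic_eq_nrm: "g = {x \<in> surface K. nrm K g \<bullet> x = 0}"
proof -
  obtain p v w where f: "frame K p v w" "g = range (geo K p v)" using geodesicE[OF assms] .
  obtain n where "n \<noteq> 0" "n \<bullet> p = 0" "n \<bullet> v = 0" using frame_normal_exists[OF f(1)] .
  then have "\<exists>n. n \<noteq> 0 \<and> g = {x \<in> surface K. n \<bullet> x = 0}"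
    using range_geo_eq_plane[OF f(1)] f(2) by blast
  from someI_ex[OF this] show "nrm K g \<noteq> 0" "g = {x \<in> surface K. nrm K g \<bullet> x = 0}"
    unfolding nrm_def by blast+
qed

lemma mem_geodesic_iff: "g \<in> geodesics K \<Longrightarrow> x \<in> surface K \<Longrightarrow> x \<in> g \<longleftrightarrow> nrm K g \<bullet> x = 0"
  using geodesic_eq_nrm by blast

lemma sn_nonzero_exists: obtains e where "sn K e \<noteq> 0"
proof (cases "K > 0")
  case True
  then have "sn K (pi / sqrt K / 2) > 0" by (intro sn_pos) (auto simp: field_simps)
  then show ?thesis using that by force
next
  case False
  then have "sn K 1 > 0" by (intro sn_pos) auto
  then show ?thesis using that by force
qed

lemma nrm_range_geo:
  assumes "frame K p v w" "g = range (geo K p v)"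
  shows "nrm K g \<bullet> p = 0" "nrm K g \<bullet> v = 0"
proof -
  have g: "g \<in> geodesics K" using assms geodesicI by simp
  have t: "nrm K g \<bullet> geo K p v t = 0" for t using geodesic_eq_nrm[OF g] assms(2) by blast
  show *: "nrm K g \<bullet> p = 0" using t[of 0] by simp
  obtain e where "sn K e \<noteq> 0" using sn_nonzero_exists .
  then show "nrm K g \<bullet> v = 0" using t[of e] * by (simp add: geo_def inner_add_right)
qed

lemma geodesic_eqI:
  assumes "g \<in> geodesics K" "frame K p v w" "nrm K g \<bullet> p = 0" "nrm K g \<bullet> v = 0"
  shows "g = range (geo K p v)"
  using range_geo_eq_plane[OF assms(2) nrm(1)[OF assms(1)] assms(3,4)] geodesic_eq_nrm[OF assms(1)]
  by simp

lemma geodesic_from_eq: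
  assumes "frame K p v w"
  shows "geodesic_from K p v = range (geo K p v)"
  unfolding geodesic_from_def
proof (rule the_equality)
  show "\<exists>\<gamma>. unit_geodesic K \<gamma> \<and> \<gamma> 0 = p \<and> (\<gamma> has_vector_derivative v) (at 0) \<and>
      range (geo K p v) = range \<gamma>"
    using unit_geodesic_geo[OF assms] geo_has_deriv[of K p v 0] by (intro exI[of _ "geo K p v"]) auto
next
  fix g assume "\<exists>\<gamma>. unit_geodesic K \<gamma> \<and> \<gamma> 0 = p \<and> (\<gamma> has_vector_derivative v) (at 0) \<and> g = range \<gamma>"
  then obtain \<gamma> where \<gamma>: "unit_geodesic K \<gamma>" "\<gamma> 0 = p" "(\<gamma> has_vector_derivative v) (at 0)" "g = range \<gamma>"
    by blast
  obtain v' w' where "(\<gamma> has_vector_derivative v') (at 0)" "\<gamma> = geo K (\<gamma> 0) v'"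
    using unit_geodesic_eq_geo[OF \<gamma>(1)] .
  then show "g = range (geo K p v)"
    using \<gamma> vector_derivative_unique_at by metis
qed

lemma closed_geodesic:
  assumes "g \<in> geodesics K" shows "closed g"
proof -
  have "g = surface K \<inter> {x. nrm K g \<bullet> x = 0}" using geodesic_eq_nrm[OF assms] by blast
  then show ?thesis using closed_surface closed_hyperplane by (metis closed_Int)
qed

subsection \<open>Crossing charts\<close>

definition cross_dir :: "real \<Rightarrow> real^3 \<Rightarrow> real^3 \<Rightarrow> real^3 \<Rightarrow> real \<Rightarrow> real \<Rightarrow> real^3" where
  "cross_dir K p v w l \<alpha> = cos \<alpha> *\<^sub>R geo_vel K p v l + sin \<alpha> *\<^sub>R w"

lemma frame_cross_dir:
  assumes "frame K p v w"
  obtains u where "frame K (geo K p v l) (cross_dir K p v w l \<alpha>) u"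
  by (rule that, unfold cross_dir_def, rule frame_rot, rule frame_geo, rule assms)

lemma crossing_eq:
  assumes "frame K p v w"
  shows "crossing K (geo K p v) (\<lambda>_. w) (l, \<alpha>) = range (geo K (geo K p v l) (cross_dir K p v w l \<alpha>))"
proof -
  have "vector_derivative (geo K p v) (at l) = geo_vel K p v l"
    using geo_has_deriv vector_derivative_at by blast
  moreover obtain u where u: "frame K (geo K p v l) (cross_dir K p v w l \<alpha>) u"
    using frame_cross_dir[OF assms] .
  ultimately show ?thesis
    using geodesic_from_eq[OF u] unfolding crossing_def cross_dir_def by simp
qed

lemma unit_normal_field_geo:
  assumes f: "frame K p v w"
  shows "unit_normal_field K (geo K p v) (\<lambda>_. w)"
proof -
  have "w \<in> tangent_plane K (geo K p v t) \<and> form K w w = 1 \<and>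
      form K w (vector_derivative (geo K p v) (at t)) = 0" for t
  proof -
    have "vector_derivative (geo K p v) (at t) = geo_vel K p v t"
      using geo_has_deriv vector_derivative_at by blast
    moreover have "form K w (geo_vel K p v t) = 0"
      using frame_geo[OF f, of t] form_commute[of K w "geo_vel K p v t"] unfolding frame_def by metis
    ultimately show ?thesis using frame_geo[OF f, of t] unfolding frame_def by metis
  qed
  then show ?thesis unfolding unit_normal_field_def by (simp add: continuous_on_const)
qed

text \<open>Along a geodesic a linear functional with a zero at \<open>l\<close> is a multiple of
  \<open>sn K (t - l)\<close>. This reduces every question about sides of a crossing geodesic to the
  sign of \<open>sn\<close>.\<close>

lemma inner_geo:
  assumes "n \<bullet> geo K p v l = 0"
  shows "n \<bullet> geo K p v t = sn K (t - l) * (n \<bullet> geo_vel K p v l)"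
proof -
  have "geo K p v t = cs K (t - l) *\<^sub>R geo K p v l + sn K (t - l) *\<^sub>R geo_vel K p v l"
    using geo_diff[of K p v t l] unfolding geo_def[of K "geo K p v l"] .
  then show ?thesis using assms by (simp add: inner_add_right)
qed

text \<open>The product makes the condition independent of the choice of the normal. Only the
  endpoints enter, and strictness excludes geodesics through an endpoint as well as the one that
  contains the segment.\<close>

definition sep :: "real \<Rightarrow> real^3 \<Rightarrow> real^3 \<Rightarrow> (real^3) set set" where
  "sep K p q = {g \<in> geodesics K. (nrm K g \<bullet> p) * (nrm K g \<bullet> q) < 0}"

lemma crossing_nrm:
  assumes f: "frame K p v w" and \<alpha>: "0 < \<alpha>" "\<alpha> < pi"
    and g: "g = crossing K (geo K p v) (\<lambda>_. w) (l, \<alpha>)"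
  shows "g \<in> geodesics K" "nrm K g \<bullet> geo K p v l = 0"
    "cos \<alpha> * (nrm K g \<bullet> geo_vel K p v l) + sin \<alpha> * (nrm K g \<bullet> w) = 0"
    "nrm K g \<bullet> geo_vel K p v l \<noteq> 0"
proof -
  obtain u where u: "frame K (geo K p v l) (cross_dir K p v w l \<alpha>) u"
    using frame_cross_dir[OF f] .
  have eq: "g = range (geo K (geo K p v l) (cross_dir K p v w l \<alpha>))"
    using g crossing_eq[OF f] by simp
  then show g': "g \<in> geodesics K" using geodesicI[OF u] by simp
  show *: "nrm K g \<bullet> geo K p v l = 0" using nrm_range_geo[OF u eq] by simp
  show **: "cos \<alpha> * (nrm K g \<bullet> geo_vel K p v l) + sin \<alpha> * (nrm K g \<bullet> w) = 0"
    using nrm_range_geo(2)[OF u eq] by (simp add: cross_dir_def inner_add_right)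
  show "nrm K g \<bullet> geo_vel K p v l \<noteq> 0"
  proof
    assume z: "nrm K g \<bullet> geo_vel K p v l = 0"
    moreover have "sin \<alpha> \<noteq> 0" using sin_gt_zero[OF \<alpha>] by simp
    ultimately have "nrm K g \<bullet> w = 0" using ** by simp
    then show False using frame_orth_zero[OF frame_geo[OF f] * z] nrm(1)[OF g'] by simp
  qed
qed

text \<open>The functional that cuts out the crossing geodesic has a single zero on a short segment,
  which recovers \<open>l\<close>; its kernel in the tangent plane at that point then recovers the
  angle.\<close>

lemma crossing_inj:
  assumes f: "frame K p v w" and short: "K > 0 \<Longrightarrow> b - a < pi / sqrt K"
  shows "inj_on (crossing K (geo K p v) (\<lambda>_. w)) ({a<..<b} \<times> {0<..<pi})"
proof (rule inj_onI, clarsimp)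
  fix l \<alpha> l' \<alpha>'
  assume l: "a < l" "l < b" "a < l'" "l' < b" and \<alpha>: "0 < \<alpha>" "\<alpha> < pi" "0 < \<alpha>'" "\<alpha>' < pi"
    and eq: "crossing K (geo K p v) (\<lambda>_. w) (l, \<alpha>) = crossing K (geo K p v) (\<lambda>_. w) (l', \<alpha>')"
  define n where "n = nrm K (crossing K (geo K p v) (\<lambda>_. w) (l, \<alpha>))"
  have n: "n \<bullet> geo K p v l = 0" "cos \<alpha> * (n \<bullet> geo_vel K p v l) + sin \<alpha> * (n \<bullet> w) = 0"
    "n \<bullet> geo_vel K p v l \<noteq> 0"
    using crossing_nrm[OF f \<alpha>(1,2) refl] unfolding n_def by blast+
  have n': "n \<bullet> geo K p v l' = 0" "cos \<alpha>' * (n \<bullet> geo_vel K p v l') + sin \<alpha>' * (n \<bullet> w) = 0"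
    using crossing_nrm[OF f \<alpha>(3,4) refl, of l'] unfolding n_def eq by blast+
  have "sn K (l' - l) = 0" using inner_geo[OF n(1), of l'] n'(1) n(3) by simp
  then have ll: "l = l'"
  proof (cases l l' rule: linorder_cases)
    case less
    then have "sn K (l' - l) > 0" using l short by (intro sn_pos) auto
    then show ?thesis using \<open>sn K (l' - l) = 0\<close> by simp
  next
    case greater
    then have "sn K (l - l') > 0" using l short by (intro sn_pos) auto
    then show ?thesis using \<open>sn K (l' - l) = 0\<close> sn_minus[of K "l' - l"] by simp
  qed
  \<comment> \<open>Eliminating \<open>n \<bullet> w\<close> from the two angle equations leaves the
    sine of the difference of the angles.\<close>
  have "(cos \<alpha> * (n \<bullet> geo_vel K p v l) + sin \<alpha> * (n \<bullet> w)) * sin \<alpha>'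
      - (cos \<alpha>' * (n \<bullet> geo_vel K p v l) + sin \<alpha>' * (n \<bullet> w)) * sin \<alpha> = 0"
    using n(2) n'(2) ll by simp
  then have "(n \<bullet> geo_vel K p v l) * sin (\<alpha>' - \<alpha>) = 0"
    by (simp add: sin_diff algebra_simps)
  then have "sin (\<alpha>' - \<alpha>) = 0" using n(3) by simp
  then have "\<alpha> = \<alpha>'"
    using sin_gt_zero[of "\<alpha>' - \<alpha>"] sin_gt_zero[of "\<alpha> - \<alpha>'"] sin_minus[of "\<alpha>' - \<alpha>"] \<alpha>
    by (cases \<alpha> \<alpha>' rule: linorder_cases) auto
  then show "l = l' \<and> \<alpha> = \<alpha>'" using ll by simp
qed

lemma sign_change_zero:
  fixes f :: "real \<Rightarrow> real"
  assumes "continuous_on {a..b} f" "f a * f b < 0" "a < b"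
  obtains l where "a < l" "l < b" "f l = 0"
proof -
  have "\<exists>l\<ge>a. l \<le> b \<and> f l = 0"
  proof (cases "f a < 0")
    case True
    then have "f b > 0" using assms(2) by (simp add: mult_less_0_iff)
    then show ?thesis using IVT'[of f a 0 b] True assms by force
  next
    case False
    then have "f a > 0" "f b < 0" using assms(2) by (auto simp: mult_less_0_iff)
    then show ?thesis using IVT2'[of f b 0 a] assms by force
  qed
  then obtain l where "a \<le> l" "l \<le> b" "f l = 0" by blast
  moreover have "l \<noteq> a" "l \<noteq> b" using assms(2) \<open>f l = 0\<close> by auto
  ultimately show ?thesis using that[of l] by simp
qed

lemma angle_exists:
  assumes "c \<noteq> 0"
  obtains \<alpha> where "0 < \<alpha>" "\<alpha> < pi" "cos \<alpha> * c + sin \<alpha> * d = (0::real)"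
proof -
  define r where "r = sqrt (c\<^sup>2 + d\<^sup>2)"
  \<comment> \<open>\<open>(x, y)\<close> is the unit vector orthogonal to \<open>(c, d)\<close>
    with positive second coordinate; it exists because \<open>c \<noteq> 0\<close>.\<close>
  define x where "x = - (d * sgn c) / r"
  define y where "y = \<bar>c\<bar> / r"
  have r: "r > 0" "r\<^sup>2 = c\<^sup>2 + d\<^sup>2" using assms by (auto simp: r_def add_pos_nonneg)
  have y: "y > 0" using assms r by (simp add: y_def)
  have "x\<^sup>2 + y\<^sup>2 = (d\<^sup>2 * (sgn c)\<^sup>2 + c\<^sup>2) / r\<^sup>2"
    by (simp add: x_def y_def power_divide power_mult_distrib add_divide_distrib)
  then have xy: "x\<^sup>2 + y\<^sup>2 = 1" using r assms by (simp add: sgn_real_def)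
  have "y\<^sup>2 > 0" using y by simp
  then have "x\<^sup>2 < 1" using xy by linarith
  then have x: "\<bar>x\<bar> < 1" by (simp add: abs_square_less_1)
  show ?thesis
  proof (rule that[of "arccos x"])
    show "0 < arccos x" "arccos x < pi" using x arccos_lt_bounded[of x] by auto
    have "sin (arccos x) = sqrt (1 - x\<^sup>2)" using x by (simp add: sin_arccos)
    also have "1 - x\<^sup>2 = y\<^sup>2" using xy by simp
    finally have "sin (arccos x) = y" using y by simp
    moreover have "cos (arccos x) = x" using x by simp
    moreover have "sgn c * c = \<bar>c\<bar>" by (simp add: abs_sgn)
    ultimately show "cos (arccos x) * c + sin (arccos x) * d = 0"
      by (simp add: x_def y_def field_simps)
  qed
qed

text \<open>A transversal crossing inside a short segment changes the sign of the functional exactly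
  once. Conversely a sign change gives a crossing point by the intermediate value theorem, and the
  kernel of the functional there gives the angle. The range of the chart thus becomes a set that
  depends on the endpoints alone.\<close>

lemma crossing_image:
  assumes f: "frame K p v w" and ab: "a < b" and short: "K > 0 \<Longrightarrow> b - a < pi / sqrt K"
  shows "crossing K (geo K p v) (\<lambda>_. w) ` ({a<..<b} \<times> {0<..<pi}) = sep K (geo K p v a) (geo K p v b)"
proof (intro equalityI subsetI)
  fix g assume "g \<in> crossing K (geo K p v) (\<lambda>_. w) ` ({a<..<b} \<times> {0<..<pi})"
  then obtain l \<alpha> where l: "a < l" "l < b" and \<alpha>: "0 < \<alpha>" "\<alpha> < pi"
    and g: "g = crossing K (geo K p v) (\<lambda>_. w) (l, \<alpha>)" by auto
  note n = crossing_nrm[OF f \<alpha> g]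
  define c where "c = nrm K g \<bullet> geo_vel K p v l"
  have "sn K (a - l) < 0" "sn K (b - l) > 0" using sn_mono_sign[OF l short] by auto
  then have "sn K (a - l) * sn K (b - l) < 0" by (simp add: mult_less_0_iff)
  moreover have "c * c > 0" using n(4) unfolding c_def by (metis not_square_less_zero mult_eq_0_iff linorder_neqE_linordered_idom)
  ultimately have "(sn K (a - l) * sn K (b - l)) * (c * c) < 0" by (simp add: mult_less_0_iff)
  moreover have "(nrm K g \<bullet> geo K p v a) * (nrm K g \<bullet> geo K p v b)
     = (sn K (a - l) * sn K (b - l)) * (c * c)"
    using inner_geo[OF n(2)] by (simp add: c_def)
  ultimately show "g \<in> sep K (geo K p v a) (geo K p v b)"
    using n(1) by (simp add: sep_def)
next
  fix g assume g: "g \<in> sep K (geo K p v a) (geo K p v b)"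
  then have gg: "g \<in> geodesics K" and neg: "(nrm K g \<bullet> geo K p v a) * (nrm K g \<bullet> geo K p v b) < 0"
    by (auto simp: sep_def)
  obtain l where l: "a < l" "l < b" "nrm K g \<bullet> geo K p v l = 0"
    by (rule sign_change_zero[OF _ neg ab]) (intro continuous_intros continuous_geo)
  have "nrm K g \<bullet> geo_vel K p v l \<noteq> 0" using neg inner_geo[OF l(3), of a] by auto
  then obtain \<alpha> where \<alpha>: "0 < \<alpha>" "\<alpha> < pi"
    "cos \<alpha> * (nrm K g \<bullet> geo_vel K p v l) + sin \<alpha> * (nrm K g \<bullet> w) = 0"
    using angle_exists by metis
  obtain u where u: "frame K (geo K p v l) (cross_dir K p v w l \<alpha>) u"
    using frame_cross_dir[OF f] .
  have "g = crossing K (geo K p v) (\<lambda>_. w) (l, \<alpha>)"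
    unfolding crossing_eq[OF f] using \<alpha>(3) l(3)
    by (intro geodesic_eqI[OF gg u]) (auto simp: cross_dir_def inner_add_right)
  then show "g \<in> crossing K (geo K p v) (\<lambda>_. w) ` ({a<..<b} \<times> {0<..<pi})"
    using l \<alpha> by auto
qed

subsection \<open>Measurability\<close>

lemma space_geodesic_borel: "space (geodesic_borel K) = geodesics K"
  unfolding geodesic_borel_def by (rule space_measure_of) (auto simp: geodesics_meeting_def)

lemma geodesics_meeting_open: "open U \<Longrightarrow> geodesics_meeting K U \<in> sets (geodesic_borel K)"
  unfolding geodesic_borel_def
  by (subst sets_measure_of) (auto simp: geodesics_meeting_def[of K])

text \<open>A geodesic is closed, so one that misses the compact set keeps a positive distance from
  it and misses some open neighbourhood of radius \<open>inverse (real (Suc n))\<close>.\<close>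

lemma geodesics_meeting_compact:
  assumes "compact A"
  shows "geodesics_meeting K A \<in> sets (geodesic_borel K)"
proof -
  define U where "U = (\<lambda>n::nat. \<Union>a\<in>A. ball a (inverse (real (Suc n))))"
  have "geodesics_meeting K A = (\<Inter>n. geodesics_meeting K (U n))"
  proof (intro equalityI subsetI)
    fix g assume "g \<in> geodesics_meeting K A"
    moreover have "A \<subseteq> U n" for n by (auto simp: U_def)
    ultimately show "g \<in> (\<Inter>n. geodesics_meeting K (U n))"
      unfolding geodesics_meeting_def by blast
  next
    fix g assume g: "g \<in> (\<Inter>n. geodesics_meeting K (U n))"
    then have gg: "g \<in> geodesics K" and meet: "g \<inter> U n \<noteq> {}" for n
      by (auto simp: geodesics_meeting_def)
    have "g \<inter> A \<noteq> {}"
    proof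
      assume "g \<inter> A = {}"
      then obtain d where d: "d > 0" "\<And>x y. x \<in> A \<Longrightarrow> y \<in> g \<Longrightarrow> d \<le> dist x y"
        using separate_compact_closed[OF assms closed_geodesic[OF gg]] by (auto simp: Int_commute)
      obtain n where "inverse (real (Suc n)) < d" using reals_Archimedean[OF d(1)] by blast
      moreover obtain x a where "x \<in> g" "a \<in> A" "dist a x < inverse (real (Suc n))"
        using meet[of n] by (auto simp: U_def)
      ultimately show False using d(2) by fastforce
    qed
    then show "g \<in> geodesics_meeting K A" using gg by (simp add: geodesics_meeting_def)
  qed
  moreover have "geodesics_meeting K (U n) \<in> sets (geodesic_borel K)" for n
    by (intro geodesics_meeting_open) (auto simp: U_def)
  ultimately show ?thesis by (simp add: sets.countable_INT)
qed

text \<open>This removes the arbitrary choice in \<open>nrm\<close> and makes the set visibly Borel.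
  A geodesic that meets the segment and misses its endpoints is automatically transversal, since
  otherwise it would contain the whole segment.\<close>

lemma sep_eq_meeting:
  assumes f: "frame K p v w" and ab: "a < b" and short: "K > 0 \<Longrightarrow> b - a < pi / sqrt K"
  shows "sep K (geo K p v a) (geo K p v b) = geodesics_meeting K (geo K p v ` {a..b})
     - geodesics_meeting K {geo K p v a} - geodesics_meeting K {geo K p v b}"
proof (intro equalityI subsetI)
  fix g assume g: "g \<in> sep K (geo K p v a) (geo K p v b)"
  then have gg: "g \<in> geodesics K" and neg: "(nrm K g \<bullet> geo K p v a) * (nrm K g \<bullet> geo K p v b) < 0"
    by (auto simp: sep_def)
  obtain l where l: "a < l" "l < b" "nrm K g \<bullet> geo K p v l = 0"
    by (rule sign_change_zero[OF _ neg ab]) (intro continuous_intros continuous_geo)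
  then have "geo K p v l \<in> g \<inter> geo K p v ` {a..b}"
    using mem_geodesic_iff[OF gg] geo_in_surface[OF f] by auto
  then show "g \<in> geodesics_meeting K (geo K p v ` {a..b})
     - geodesics_meeting K {geo K p v a} - geodesics_meeting K {geo K p v b}"
    using neg gg mem_geodesic_iff[OF gg] geo_in_surface[OF f]
    by (auto simp: geodesics_meeting_def)
next
  fix g assume g: "g \<in> geodesics_meeting K (geo K p v ` {a..b})
     - geodesics_meeting K {geo K p v a} - geodesics_meeting K {geo K p v b}"
  then have gg: "g \<in> geodesics K" by (auto simp: geodesics_meeting_def)
  obtain l where l: "a \<le> l" "l \<le> b" "geo K p v l \<in> g"
    using g by (auto simp: geodesics_meeting_def)
  have "geo K p v a \<notin> g" "geo K p v b \<notin> g" using g by (auto simp: geodesics_meeting_def)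
  moreover then have "l \<noteq> a" "l \<noteq> b" using l by auto
  ultimately have ll: "a < l" "l < b" using l by auto
  have 0: "nrm K g \<bullet> geo K p v l = 0"
    using mem_geodesic_iff[OF gg] geo_in_surface[OF f] l by auto
  define c where "c = nrm K g \<bullet> geo_vel K p v l"
  have "c \<noteq> 0" using inner_geo[OF 0, of a] \<open>geo K p v a \<notin> g\<close>
      mem_geodesic_iff[OF gg] geo_in_surface[OF f] by (auto simp: c_def)
  then have "c * c > 0" by (metis not_square_less_zero mult_eq_0_iff linorder_neqE_linordered_idom)
  moreover have "sn K (a - l) * sn K (b - l) < 0"
    using sn_mono_sign[OF ll short] by (simp add: mult_less_0_iff)
  ultimately have "(sn K (a - l) * sn K (b - l)) * (c * c) < 0" by (simp add: mult_less_0_iff)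
  moreover have "(nrm K g \<bullet> geo K p v a) * (nrm K g \<bullet> geo K p v b)
     = (sn K (a - l) * sn K (b - l)) * (c * c)"
    using inner_geo[OF 0] by (simp add: c_def)
  ultimately show "g \<in> sep K (geo K p v a) (geo K p v b)"
    using gg by (simp add: sep_def)
qed

lemma sep_measurable:
  assumes "frame K p v w" "a < b" "K > 0 \<Longrightarrow> b - a < pi / sqrt K"
  shows "sep K (geo K p v a) (geo K p v b) \<in> sets (geodesic_borel K)"
proof -
  have "compact (geo K p v ` {a..b})"
    by (intro compact_continuous_image continuous_geo compact_Icc)
  moreover have "sep K (geo K p v a) (geo K p v b) = geodesics_meeting K (geo K p v ` {a..b})
     - geodesics_meeting K {geo K p v a} - geodesics_meeting K {geo K p v b}"
    using assms by (rule sep_eq_meeting)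
  ultimately show ?thesis
    by (simp add: sets.Diff geodesics_meeting_compact)
qed

subsection \<open>Crofton's formula for a geodesic segment\<close>

lemma chart_formula:
  assumes \<mu>: "invariant_geodesic_measure K \<mu>" and f: "frame K p v w"
    and ab: "a < b" and short: "K > 0 \<Longrightarrow> b - a < pi / sqrt K"
    and E: "E \<in> sets \<mu>" "E \<subseteq> sep K (geo K p v a) (geo K p v b)"
  shows "emeasure \<mu> E = (\<integral>\<^sup>+l\<in>{a<..<b}. (\<integral>\<^sup>+\<alpha>\<in>{0<..<pi}.
     ennreal (sin \<alpha>) * indicator E (crossing K (geo K p v) (\<lambda>_. w) (l, \<alpha>)) \<partial>lborel) \<partial>lborel)"
proof -
  have "\<forall>\<gamma> N a b. unit_geodesic K \<gamma> \<longrightarrow> unit_normal_field K \<gamma> N \<longrightarrow> a < b \<longrightarrow>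
        inj_on (crossing K \<gamma> N) ({a<..<b} \<times> {0<..<pi}) \<longrightarrow>
        (\<forall>E\<in>sets \<mu>. E \<subseteq> crossing K \<gamma> N ` ({a<..<b} \<times> {0<..<pi}) \<longrightarrow>
           emeasure \<mu> E = (\<integral>\<^sup>+l\<in>{a<..<b}. (\<integral>\<^sup>+\<alpha>\<in>{0<..<pi}.
                ennreal (sin \<alpha>) * indicator E (crossing K \<gamma> N (l, \<alpha>)) \<partial>lborel) \<partial>lborel))"
    using \<mu> unfolding invariant_geodesic_measure_def by (elim conjE)
  note formula = this[rule_format, OF unit_geodesic_geo[OF f] unit_normal_field_geo[OF f] ab]
  show ?thesis
  proof (rule formula)
    show "inj_on (crossing K (geo K p v) (\<lambda>_. w)) ({a<..<b} \<times> {0<..<pi})"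
      using f short by (rule crossing_inj)
    show "E \<subseteq> crossing K (geo K p v) (\<lambda>_. w) ` ({a<..<b} \<times> {0<..<pi})"
      using E(2) crossing_image[OF f ab] short by simp
  qed (rule E)
qed

lemma sets_invariant: "invariant_geodesic_measure K \<mu> \<Longrightarrow> sets \<mu> = sets (geodesic_borel K)"
  by (simp add: invariant_geodesic_measure_def)

lemma space_invariant: "invariant_geodesic_measure K \<mu> \<Longrightarrow> space \<mu> = geodesics K"
  using sets_eq_imp_space_eq[OF sets_invariant] space_geodesic_borel by simp

lemma nn_integral_sin: "(\<integral>\<^sup>+\<alpha>\<in>{0<..<pi}. ennreal (sin \<alpha>) \<partial>lborel) = 2"
proof -
  have "AE \<alpha> in lborel. \<alpha> \<noteq> 0 \<and> \<alpha> \<noteq> pi"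
    using AE_lborel_singleton[of 0] AE_lborel_singleton[of pi] by eventually_elim auto
  then have "(\<integral>\<^sup>+\<alpha>\<in>{0<..<pi}. ennreal (sin \<alpha>) \<partial>lborel) = (\<integral>\<^sup>+\<alpha>\<in>{0..pi}. ennreal (sin \<alpha>) \<partial>lborel)"
    by (intro nn_integral_cong_AE) (auto simp: indicator_def)
  also have "\<dots> = ennreal (- cos pi - (- cos 0))"
    by (rule nn_integral_FTC_Icc) (auto intro!: derivative_eq_intros sin_ge_zero)
  finally show ?thesis by simp
qed

lemma emeasure_sep_geo:
  assumes \<mu>: "invariant_geodesic_measure K \<mu>" and f: "frame K p v w"
    and ab: "a < b" and short: "K > 0 \<Longrightarrow> b - a < pi / sqrt K"
  shows "emeasure \<mu> (sep K (geo K p v a) (geo K p v b)) = ennreal (2 * (b - a))"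
proof -
  let ?S = "sep K (geo K p v a) (geo K p v b)"
  have inner: "(\<integral>\<^sup>+\<alpha>\<in>{0<..<pi}. ennreal (sin \<alpha>) *
      indicator ?S (crossing K (geo K p v) (\<lambda>_. w) (l, \<alpha>)) \<partial>lborel) = 2" if "l \<in> {a<..<b}" for l
  proof -
    have "(\<integral>\<^sup>+\<alpha>\<in>{0<..<pi}. ennreal (sin \<alpha>) *
      indicator ?S (crossing K (geo K p v) (\<lambda>_. w) (l, \<alpha>)) \<partial>lborel)
      = (\<integral>\<^sup>+\<alpha>\<in>{0<..<pi}. ennreal (sin \<alpha>) \<partial>lborel)"
      using that crossing_image[OF f ab short]
      by (intro nn_integral_cong) (auto simp: indicator_def)
    then show ?thesis by (simp add: nn_integral_sin)
  qed
  have "emeasure \<mu> ?S = (\<integral>\<^sup>+l\<in>{a<..<b}. (\<integral>\<^sup>+\<alpha>\<in>{0<..<pi}.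
     ennreal (sin \<alpha>) * indicator ?S (crossing K (geo K p v) (\<lambda>_. w) (l, \<alpha>)) \<partial>lborel) \<partial>lborel)"
    using sep_measurable[OF f ab short] sets_invariant[OF \<mu>]
    by (intro chart_formula[OF \<mu> f ab short]) auto
  also have "\<dots> = (\<integral>\<^sup>+l\<in>{a<..<b}. 2 \<partial>lborel)"
    using inner by (intro nn_integral_cong) (auto simp: indicator_def)
  also have "\<dots> = ennreal (2 * (b - a))"
    using ab by (simp add: ennreal_mult[of 2 "b - a", simplified, symmetric] nn_integral_cmult)
  finally show ?thesis .
qed

text \<open>Splitting a short segment at \<open>x\<close> shows that the pencil of geodesics through \<open>x\<close> has
  measure \<open>0\<close>, by additivity of length.\<close>

lemma pencil_minus_null:
  assumes \<mu>: "invariant_geodesic_measure K \<mu>" and f: "frame K x v w"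
  shows "emeasure \<mu> (geodesics_meeting K {x} - {range (geo K x v)}) = 0"
    "geodesics_meeting K {x} - {range (geo K x v)} \<in> sets \<mu>"
proof -
  obtain e where e: "e > 0" "K > 0 \<Longrightarrow> 2 * e < pi / sqrt K" "K > 0 \<Longrightarrow> e < pi / sqrt K"
    using that[of "if K > 0 then pi / sqrt K / 4 else 1"] by (cases "K > 0") (auto simp: field_simps)
  define c where "c = crossing K (geo K x v) (\<lambda>_. w)"
  let ?S1 = "sep K (geo K x v (- e)) x" and ?S2 = "sep K x (geo K x v e)"
    and ?S = "sep K (geo K x v (- e)) (geo K x v e)"
  let ?P = "geodesics_meeting K {x} - {range (geo K x v)}"
  have img: "?S1 = c ` ({-e<..<0} \<times> {0<..<pi})" "?S2 = c ` ({0<..<e} \<times> {0<..<pi})"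
    "?S = c ` ({-e<..<e} \<times> {0<..<pi})"
    using crossing_image[OF f, of "-e" 0] crossing_image[OF f, of 0 e] crossing_image[OF f, of "-e" e] e
    unfolding c_def by simp_all
  have inj: "inj_on c ({-e<..<e} \<times> {0<..<pi})"
    unfolding c_def by (rule crossing_inj[OF f]) (use e in auto)
  have disj: "?S1 \<inter> ?S2 = {}"
  proof -
    have "c ` (({-e<..<0} \<times> {0<..<pi}) \<inter> ({0<..<e} \<times> {0<..<pi})) = ?S1 \<inter> ?S2"
      unfolding img using e by (intro inj_on_image_Int[OF inj]) auto
    moreover have "({-e<..<0} \<times> {0<..<pi}) \<inter> ({0<..<e} \<times> {0<..<pi}) = {}" by auto
    ultimately show ?thesis by (metis image_empty)
  qed
  have meas: "?S1 \<in> sets \<mu>" "?S2 \<in> sets \<mu>" "?S \<in> sets \<mu>"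
    using sep_measurable[OF f, of "-e" 0] sep_measurable[OF f, of 0 e] sep_measurable[OF f, of "-e" e] e
    unfolding sets_invariant[OF \<mu>] by auto
  have em: "emeasure \<mu> ?S1 = ennreal (2 * e)" "emeasure \<mu> ?S2 = ennreal (2 * e)"
    "emeasure \<mu> ?S = ennreal (4 * e)"
    using emeasure_sep_geo[OF \<mu> f, of "-e" 0] emeasure_sep_geo[OF \<mu> f, of 0 e]
      emeasure_sep_geo[OF \<mu> f, of "-e" e] e by auto
  have emU: "emeasure \<mu> (?S1 \<union> ?S2) = ennreal (4 * e)"
    using plus_emeasure[OF meas(1,2) disj] em e(1) by (simp flip: ennreal_plus)
  have "emeasure \<mu> (?S - (?S1 \<union> ?S2)) = emeasure \<mu> ?S - emeasure \<mu> (?S1 \<union> ?S2)"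
  proof (rule emeasure_Diff)
    show "emeasure \<mu> (?S1 \<union> ?S2) \<noteq> \<infinity>"
      by (simp add: emU)
    show "?S1 \<union> ?S2 \<subseteq> ?S" unfolding img using e by (intro Un_least image_mono) auto
  qed (use meas in auto)
  also have "\<dots> = 0" unfolding emU em by simp
  finally have null: "emeasure \<mu> (?S - (?S1 \<union> ?S2)) = 0" .
  have pencil: "g \<in> geodesics K" "nrm K g \<bullet> x = 0" "nrm K g \<bullet> v \<noteq> 0" if "g \<in> ?P" for g
  proof -
    show g: "g \<in> geodesics K" using that by (auto simp: geodesics_meeting_def)
    show x: "nrm K g \<bullet> x = 0"
      using that mem_geodesic_iff[OF g] f by (auto simp: geodesics_meeting_def frame_def)
    show "nrm K g \<bullet> v \<noteq> 0" using geodesic_eqI[OF g f x] that by auto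
  qed
  \<comment> \<open>A geodesic through \<open>x\<close> other than the carrier of the segment
    crosses at the common endpoint of the two halves, so it separates the outer endpoints but
    neither half.\<close>
  have sub: "?P \<subseteq> ?S - (?S1 \<union> ?S2)"
  proof
    fix g assume g: "g \<in> ?P"
    note pc = pencil[OF g]
    have t: "nrm K g \<bullet> geo K x v t = sn K t * (nrm K g \<bullet> v)" for t
      using inner_geo[of "nrm K g" K x v 0 t] pc by simp
    have "(nrm K g \<bullet> geo K x v (- e)) * (nrm K g \<bullet> geo K x v e) = - ((sn K e * (nrm K g \<bullet> v))\<^sup>2)"
      unfolding t by (simp add: power2_eq_square)
    moreover have "sn K e > 0" using e by (intro sn_pos) auto
    ultimately have "g \<in> ?S" using pc by (auto simp: sep_def)
    moreover have "g \<notin> ?S1" "g \<notin> ?S2" using pc by (auto simp: sep_def)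
    ultimately show "g \<in> ?S - (?S1 \<union> ?S2)" by blast
  qed
  \<comment> \<open>Measurability: among the geodesics through \<open>x\<close>, only the carrier of
    the segment also passes through the nearby point \<open>geo K x v e\<close>.\<close>
  have "?P = geodesics_meeting K {x} - geodesics_meeting K {geo K x v e}"
  proof -
    have "geo K x v e \<notin> g" if g: "g \<in> ?P" for g
    proof -
      have "nrm K g \<bullet> geo K x v e = sn K e * (nrm K g \<bullet> v)"
        using inner_geo[of "nrm K g" K x v 0 e] pencil[OF g] by simp
      moreover have "sn K e > 0" using e by (intro sn_pos) auto
      ultimately show ?thesis
        using mem_geodesic_iff[OF pencil(1)[OF g] geo_in_surface[OF f]] pencil(3)[OF g] by simp
    qed
    then show ?thesis by (auto simp: geodesics_meeting_def)
  qed
  then show P: "?P \<in> sets \<mu>" unfolding sets_invariant[OF \<mu>]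
    by (simp add: sets.Diff geodesics_meeting_compact)
  show "emeasure \<mu> ?P = 0"
    using emeasure_mono[OF sub, of \<mu>] null meas by auto
qed

text \<open>A chart never sees the geodesic that carries its own segment. The perpendicular segment
  through \<open>x\<close> accounts for it.\<close>

lemma pencil_null:
  assumes \<mu>: "invariant_geodesic_measure K \<mu>" and x: "x \<in> surface K"
  shows "geodesics_meeting K {x} \<in> null_sets \<mu>"
proof -
  obtain v w where f: "frame K x v w" using frame_exists_at[OF x] .
  note a = pencil_minus_null[OF \<mu> f] and b = pencil_minus_null[OF \<mu> frame_swap[OF f]]
  have "range (geo K x v) \<noteq> range (geo K x w)"
  proof
    assume eq: "range (geo K x v) = range (geo K x w)"
    show False
      using frame_orth_zero[OF f nrm_range_geo[OF f refl]] nrm_range_geo(2)[OF frame_swap[OF f] eq]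
        nrm(1)[OF geodesicI[OF f]] by simp
  qed
  then have sub: "geodesics_meeting K {x} \<subseteq> (geodesics_meeting K {x} - {range (geo K x v)})
      \<union> (geodesics_meeting K {x} - {range (geo K x w)})" by auto
  have "(geodesics_meeting K {x} - {range (geo K x v)})
      \<union> (geodesics_meeting K {x} - {range (geo K x w)}) \<in> null_sets \<mu>"
    using a b by (intro null_sets.Un) auto
  moreover have "geodesics_meeting K {x} \<in> sets \<mu>"
    using geodesics_meeting_compact[of "{x}" K] sets_invariant[OF \<mu>] by auto
  ultimately show ?thesis using sub by (rule null_sets_subset)
qed

subsection \<open>Chords and arcs\<close>

definition chord :: "real \<Rightarrow> real^3 \<Rightarrow> real^3 \<Rightarrow> real" where
  "chord K p q = sqrt (form K (q - p) (q - p))"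

text \<open>A geodesic arc of length \<open>d\<close>, at most half a great circle if
  \<open>K > 0\<close>, has ambient chord \<open>2 * sn K (d / 2)\<close>. This is the inverse
  function, so arc lengths become explicit functions of the coordinates of the endpoints.\<close>

definition arc_of_chord :: "real \<Rightarrow> real \<Rightarrow> real" where
  "arc_of_chord K y = (if K = 0 then y else if K > 0 then 2 * arcsin (sqrt K * y / 2) / sqrt K
     else 2 * arsinh (sqrt (- K) * y / 2) / sqrt (- K))"

lemma arc_of_chord_0 [simp]: "arc_of_chord K 0 = 0"
  by (simp add: arc_of_chord_def)

lemma arc_of_chord_has_deriv: "(arc_of_chord K has_real_derivative 1) (at 0)"
proof -
  consider "K = 0" | "K > 0" | "K < 0" by linarith
  then show ?thesis
  proof cases
    case 1
    then have "arc_of_chord K = (\<lambda>y. y)" by (auto simp: arc_of_chord_def)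
    then show ?thesis by simp
  next
    case 2
    then have "arc_of_chord K = (\<lambda>y. 2 * arcsin (sqrt K * y / 2) / sqrt K)"
      by (auto simp: arc_of_chord_def)
    then show ?thesis using 2 by (auto intro!: derivative_eq_intros)
  next
    case 3
    then have "arc_of_chord K = (\<lambda>y. 2 * arsinh (sqrt (- K) * y / 2) / sqrt (- K))"
      by (auto simp: arc_of_chord_def)
    moreover have "((\<lambda>y. 2 * arsinh (sqrt (- K) * y / 2) / sqrt (- K)) has_real_derivative
        2 * (1 / sqrt ((sqrt (- K) * 0 / 2)\<^sup>2 + 1) * (sqrt (- K) * 1 / 2)) / sqrt (- K)) (at 0)"
      by (intro DERIV_cdivide DERIV_cmult DERIV_chain'[OF _ arsinh_real_has_field_derivative] DERIV_ident)
    ultimately show ?thesis using 3 by (simp only:) auto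
  qed
qed

lemma sn_arc_of_chord:
  assumes "0 \<le> y" "K > 0 \<Longrightarrow> sqrt K * y \<le> 2"
  shows "sn K (arc_of_chord K y / 2) = y / 2"
proof -
  consider "K = 0" | "K > 0" | "K < 0" by linarith
  then show ?thesis
  proof cases
    case 2
    moreover from this have "sin (arcsin (sqrt K * y / 2)) = sqrt K * y / 2"
      using assms(2) mult_nonneg_nonneg[OF real_sqrt_ge_zero[of K] assms(1)] by (intro sin_arcsin) linarith+
    ultimately show ?thesis by (simp add: sn_def arc_of_chord_def)
  qed (auto simp: sn_def arc_of_chord_def)
qed

lemma arc_of_chord_bounds:
  assumes "0 < y" "K > 0 \<Longrightarrow> sqrt K * y < 2"
  shows "arc_of_chord K y > 0" "K > 0 \<Longrightarrow> arc_of_chord K y < pi / sqrt K"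
proof -
  have *: "arc_of_chord K y > 0 \<and> (K > 0 \<longrightarrow> arc_of_chord K y < pi / sqrt K)"
  proof -
    consider "K = 0" | "K > 0" | "K < 0" by linarith
    then show ?thesis
    proof cases
      case 2
      then have "0 < sqrt K * y / 2" "sqrt K * y / 2 < 1" using assms by auto
      then have "arcsin 0 < arcsin (sqrt K * y / 2)" "arcsin (sqrt K * y / 2) < pi / 2"
        using arcsin_less_arcsin[of 0 "sqrt K * y / 2"] arcsin_lt_bounded[of "sqrt K * y / 2"] by auto
      then show ?thesis using 2 by (auto simp: arc_of_chord_def divide_strict_right_mono)
    qed (use assms in \<open>auto simp: arc_of_chord_def\<close>)
  qed
  then show "arc_of_chord K y > 0" "K > 0 \<Longrightarrow> arc_of_chord K y < pi / sqrt K" by auto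
qed

text \<open>For \<open>K \<noteq> 0\<close> the direction is the component of \<open>q\<close>
  orthogonal to \<open>p\<close>. It vanishes only if \<open>q\<close> is a multiple of
  \<open>p\<close>, that is, for equal or antipodal points.\<close>

lemma minimal_segment:
  assumes p: "p \<in> surface K" and q: "q \<in> surface K" and ne: "p \<noteq> q" and anti: "K > 0 \<Longrightarrow> q \<noteq> - p"
  obtains v w where "frame K p v w" "geo K p v (arc_of_chord K (chord K p q)) = q"
    "arc_of_chord K (chord K p q) > 0"
    "K > 0 \<Longrightarrow> arc_of_chord K (chord K p q) < pi / sqrt K"
proof (cases "K = 0")
  case True
  define u where "u = q - p"
  define v where "v = (1 / sqrt (form K u u)) *\<^sub>R u"
  have u: "u \<in> tangent_plane K p" "u \<noteq> 0"
    using p q ne True by (auto simp: u_def tangent_plane_def surface_def)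
  then have pos: "form K u u > 0" using tangent_form_pos[OF p] by blast
  have "v \<in> tangent_plane K p" using u True by (simp add: v_def tangent_plane_def)
  moreover have "form K v v = 1" using pos by (simp add: v_def form_simps)
  ultimately obtain w where "frame K p v w" using frame_exists[OF p] by blast
  moreover have ch: "arc_of_chord K (chord K p q) = sqrt (form K u u)"
    using True by (simp add: chord_def u_def arc_of_chord_def)
  moreover have "geo K p v (sqrt (form K u u)) = q"
    using True pos by (simp add: geo_def cs_def sn_def v_def u_def)
  ultimately show ?thesis using that pos True by simp
next
  case False
  \<comment> \<open>\<open>\<kappa>\<close> will turn out to be \<open>cs K d\<close>, and the form
    of the tangential part \<open>u\<close> to be \<open>(sn K d)\<^sup>2\<close>.\<close>
  define \<kappa> where "\<kappa> = K * form K p q"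
  define u where "u = q - \<kappa> *\<^sub>R p"
  define y where "y = chord K p q"
  define d where "d = arc_of_chord K y"
  have sf: "form K p p = 1 / K" "form K q q = 1 / K" "form K p q = \<kappa> / K"
    using p q surface_form False by (auto simp: \<kappa>_def)
  have u: "u \<in> tangent_plane K p" using sf False by (simp add: u_def tangent_plane_def form_simps)
  have fu: "form K u u = (1 - \<kappa>\<^sup>2) / K"
  proof -
    have "form K u u = form K q q - 2 * \<kappa> * form K p q + \<kappa> * \<kappa> * form K p p"
      by (simp add: u_def form_simps form_commute[of K q p] algebra_simps)
    then show ?thesis unfolding sf by (simp add: power2_eq_square diff_divide_distrib)
  qed
  have \<kappa>pos: "\<kappa> > 0" if "K < 0"
    using surface_form_neg[OF that p q] that by (simp add: \<kappa>_def mult_neg_neg)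
  have "u \<noteq> 0"
  proof
    assume z: "u = 0"
    then have "\<kappa>\<^sup>2 = 1" using fu False by (simp add: form_simps)
    then have "\<kappa> = 1 \<or> \<kappa> = - 1" by (simp add: power2_eq_1_iff)
    moreover have "q = \<kappa> *\<^sub>R p" using z by (simp add: u_def)
    ultimately show False using ne anti \<kappa>pos False by (cases "K > 0") auto
  qed
  then have pos: "form K u u > 0" using tangent_form_pos[OF p u] by blast
  have fy: "form K (q - p) (q - p) = 2 * (1 - \<kappa>) / K"
    using sf False by (simp add: form_simps form_commute[of K q p] field_simps)
  have \<kappa>: "(K > 0 \<and> -1 < \<kappa> \<and> \<kappa> < 1) \<or> (K < 0 \<and> \<kappa> > 1)"
  proof (cases "K > 0")
    case True
    then have "\<kappa>\<^sup>2 < 1" using pos fu by (simp add: zero_less_divide_iff)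
    then have "\<bar>\<kappa>\<bar> < 1" by (simp only: abs_square_less_1)
    then show ?thesis using True by linarith
  next
    case f: False
    then have "1 < \<kappa>\<^sup>2" "\<kappa> > 0" using pos fu False \<kappa>pos by (simp_all add: zero_less_divide_iff)
    then have "\<kappa> > 1" by (metis abs_of_pos abs_square_le_1 linorder_not_less)
    then show ?thesis using f False by simp
  qed
  then have fpos: "2 * (1 - \<kappa>) / K > 0" by (auto simp: zero_less_divide_iff)
  then have ypos: "y > 0" and yy: "y\<^sup>2 = 2 * (1 - \<kappa>) / K" by (simp_all add: y_def chord_def fy)
  have ysm: "sqrt K * y < 2" if "K > 0"
  proof -
    have "(sqrt K * y)\<^sup>2 = 2 * (1 - \<kappa>)" using that by (simp add: power_mult_distrib yy)
    also have "\<dots> < 2\<^sup>2" using \<kappa> that by simp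
    finally show ?thesis by (rule power_less_imp_less_base) simp
  qed
  note d = arc_of_chord_bounds[OF ypos ysm, folded d_def]
  have s2: "sn K (d / 2) = y / 2"
    unfolding d_def using ypos ysm by (intro sn_arc_of_chord) (auto simp: less_imp_le)
  \<comment> \<open>The half-angle formula links the chord, which determines
    \<open>sn K (d / 2)\<close>, with the value \<open>cs K d\<close> needed to reach
    \<open>q\<close>.\<close>
  have "cs K (d / 2 + d / 2) = 1 - 2 * K * (sn K (d / 2))\<^sup>2"
    unfolding cs_add using cs_sn_sq[of K "d / 2"] by (simp add: power2_eq_square)
  also have "\<dots> = \<kappa>" unfolding s2 using yy False by (simp add: power_divide field_simps)
  finally have cd: "cs K d = \<kappa>" by simp
  have sd: "sn K d > 0" using d by (intro sn_pos) auto
  have "(sn K d)\<^sup>2 = form K u u"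
    using cs_sn_sq[of K d] cd False by (simp add: fu field_simps)
  then have sd': "sn K d = sqrt (form K u u)" using sd by (metis real_sqrt_unique less_imp_le)
  define v where "v = (1 / sn K d) *\<^sub>R u"
  have "v \<in> tangent_plane K p" using u False by (simp add: v_def tangent_plane_def form_simps)
  moreover have "form K v v = 1" using pos by (simp add: v_def form_simps sd')
  ultimately obtain w where "frame K p v w" using frame_exists[OF p] by blast
  moreover have "geo K p v d = q" using sd by (simp add: geo_def cd v_def u_def)
  ultimately show ?thesis using that d unfolding d_def y_def by blast
qed

lemma emeasure_sep:
  assumes \<mu>: "invariant_geodesic_measure K \<mu>" and p: "p \<in> surface K" and q: "q \<in> surface K"
    and anti: "K > 0 \<Longrightarrow> q \<noteq> - p"
  shows "sep K p q \<in> sets \<mu>" "emeasure \<mu> (sep K p q) = ennreal (2 * arc_of_chord K (chord K p q))"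
    "arc_of_chord K (chord K p q) \<ge> 0"
proof -
  have "sep K p q \<in> sets \<mu> \<and> emeasure \<mu> (sep K p q) = ennreal (2 * arc_of_chord K (chord K p q)) \<and>
    arc_of_chord K (chord K p q) \<ge> 0"
  proof (cases "p = q")
    case True
    then have "sep K p q = {}" by (auto simp: sep_def not_less)
    then show ?thesis using True by (simp add: chord_def form_simps)
  next
    case False
    define d where "d = arc_of_chord K (chord K p q)"
    obtain v w where f: "frame K p v w" "geo K p v d = q" "d > 0" "K > 0 \<Longrightarrow> d < pi / sqrt K"
      unfolding d_def using minimal_segment[OF p q False anti] by metis
    show ?thesis
      using sep_measurable[OF f(1,3)] emeasure_sep_geo[OF \<mu> f(1,3)] f sets_invariant[OF \<mu>]
      unfolding d_def by simp
  qed
  then show "sep K p q \<in> sets \<mu>" "emeasure \<mu> (sep K p q) = ennreal (2 * arc_of_chord K (chord K p q))"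
    "arc_of_chord K (chord K p q) \<ge> 0" by auto
qed

subsection \<open>Convexity\<close>

lemma geo_path_length:
  assumes f: "frame K p v w" and d: "0 \<le> d"
  shows "surface_dist K p (geo K p v d) \<le> ennreal d"
proof -
  define c where "c = (\<lambda>t. geo K p v (d * t))"
  have dc: "(c has_vector_derivative d *\<^sub>R geo_vel K p v (d * t)) (at t)" for t
  proof -
    have "((\<lambda>t. d * t) has_vector_derivative d) (at t)"
      using has_vector_derivative_mult_right[of "\<lambda>t. t" 1 "at t" d] by simp
    from vector_diff_chain_at[OF this geo_has_deriv] show ?thesis by (simp add: c_def o_def)
  qed
  have cvel: "continuous_on S (geo_vel K p v)" for S
    by (meson continuous_at_imp_continuous_on geo_vel_has_deriv has_vector_derivative_continuous)
  have "c C1_differentiable_on {0..1}"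
    unfolding C1_differentiable_on_def using dc
    by (intro exI[of _ "\<lambda>t. d *\<^sub>R geo_vel K p v (d * t)"])
      (auto intro!: continuous_intros continuous_on_compose2[OF cvel[of UNIV]])
  then have "valid_path c" unfolding valid_path_def by (rule C1_differentiable_imp_piecewise)
  moreover have "path_image c \<subseteq> surface K" using geo_in_surface[OF f] by (auto simp: path_image_def c_def)
  moreover have "pathstart c = p" "pathfinish c = geo K p v d" by (auto simp: pathstart_def pathfinish_def c_def)
  moreover have "curve_length K c = ennreal d"
  proof -
    have "sqrt (form K (vector_derivative c (at t)) (vector_derivative c (at t))) = d" for t
      unfolding vector_derivative_at[OF dc] using frame_geo[OF f, of "d * t"] d
      by (simp add: form_simps frame_def)
    then have "curve_length K c = (\<integral>\<^sup>+t\<in>{0..1::real}. ennreal d \<partial>lborel)" unfolding curve_length_def by simp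
    then show ?thesis by (simp add: nn_integral_cmult)
  qed
  ultimately have "ennreal d \<in> {curve_length K c |c. valid_path c \<and> path_image c \<subseteq> surface K
      \<and> pathstart c = p \<and> pathfinish c = geo K p v d}" by (metis (mono_tags, lifting) mem_Collect_eq)
  then show ?thesis unfolding surface_dist_def by (rule Inf_lower)
qed

text \<open>This upper bound for the distance confines the minimising segments of the convexity
  condition to half a great circle.\<close>

lemma surface_dist_sphere:
  assumes K: "K > 0" and p: "p \<in> surface K" and q: "q \<in> surface K"
  shows "surface_dist K p q \<le> ennreal (pi / sqrt K)"
proof -
  obtain v w where f: "frame K p v w" using frame_exists_at[OF p] .
  have "\<exists>v w d. frame K p v w \<and> 0 \<le> d \<and> d \<le> pi / sqrt K \<and> geo K p v d = q"
  proof -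
    consider "q = p" | "q = - p" | "p \<noteq> q" "q \<noteq> - p" by blast
    then show ?thesis
    proof cases
      case 1
      then show ?thesis using f K by (intro exI[of _ v] exI[of _ w] exI[of _ 0]) simp
    next
      case 2
      have "geo K p v (pi / sqrt K) = - p" using K by (simp add: geo_def cs_def sn_def)
      then show ?thesis using f K 2 by (intro exI[of _ v] exI[of _ w] exI[of _ "pi / sqrt K"]) simp
    next
      case 3
      obtain v w d where "frame K p v w" "geo K p v d = q" "d > 0" "d < pi / sqrt K"
        by (rule minimal_segment[OF p q 3(1)]) (use 3 K in auto)
      then show ?thesis using less_imp_le by blast
    qed
  qed
  then obtain v w d where "frame K p v w" "0 \<le> d" "d \<le> pi / sqrt K" "geo K p v d = q" by blast
  then show ?thesis using geo_path_length[of K p v w d] by (auto intro: order_trans ennreal_leI)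
qed

section \<open>Convex sets as sections of convex cones\<close>

lemma surface_scaleR:
  assumes "x \<in> surface K" "c *\<^sub>R x \<in> surface K"
  shows "c = 1 \<or> K > 0 \<and> c = - 1"
proof (cases "K = 0")
  case True
  then show ?thesis using assms by (simp add: surface_def)
next
  case False
  then have "c * c * (1 / K) = 1 / K"
    using assms surface_form[of x K] surface_form[of "c *\<^sub>R x" K] by (simp add: form_simps)
  then have "c = 1 \<or> c = - 1" using False by (simp add: square_eq_1_iff)
  moreover have "c > 0" if "K < 0"
    using surface_nth_3_pos[of x K] surface_nth_3_pos[of "c *\<^sub>R x" K] assms that
    by (simp add: zero_less_mult_iff)
  ultimately show ?thesis using False by force
qed

text \<open>A surface point in the cone spanned by \<open>p\<close> and \<open>q\<close> lies on the
  minimising segment between them, provided that they are independent. For equal or antipodal points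
  the cone degenerates to a ray or a line, which meets the surface only in \<open>p\<close> and
  \<open>q\<close>.\<close>

lemma geodesically_convex_comb:
  assumes conv: "geodesically_convex K D" and p: "p \<in> D" and q: "q \<in> D"
    and ab: "0 \<le> a" "0 \<le> b" and x: "x \<in> surface K" "x = a *\<^sub>R p + b *\<^sub>R q"
  shows "x \<in> D"
proof -
  obtain \<sigma> l where \<sigma>: "unit_geodesic K \<sigma>" "0 \<le> l" "\<sigma> 0 = p" "\<sigma> l = q"
    "ennreal l = surface_dist K p q" "\<sigma> ` {0..l} \<subseteq> D"
    using conv p q unfolding geodesically_convex_def by blast
  obtain v w where "frame K (\<sigma> 0) v w" "\<sigma> = geo K (\<sigma> 0) v"
    by (rule unit_geodesic_eq_geo[OF \<sigma>(1)])
  then have f: "frame K p v w" and \<sigma>geo: "\<sigma> = geo K p v" by (simp_all only: \<sigma>(3))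
  have ps: "p \<in> surface K" and qs: "q \<in> surface K"
    using f geo_in_surface[OF f, of l] \<sigma>(4) unfolding \<sigma>geo frame_def by simp_all
  have lK: "l \<le> pi / sqrt K" if "K > 0"
  proof -
    have "ennreal l \<le> ennreal (pi / sqrt K)"
      unfolding \<sigma>(5) by (rule surface_dist_sphere[OF that ps qs])
    then show ?thesis using that by (subst (asm) ennreal_le_iff) auto
  qed
  have qeq: "q = cs K l *\<^sub>R p + sn K l *\<^sub>R v" using \<sigma>(4) unfolding \<sigma>geo geo_def by simp
  show ?thesis
  proof (cases "sn K l = 0")
    case True
    then have qp: "q = cs K l *\<^sub>R p" using qeq by simp
    then have "cs K l = 1 \<or> K > 0 \<and> cs K l = - 1" using surface_scaleR[OF ps, of "cs K l"] qs by simp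
    then show ?thesis
    proof
      assume "cs K l = 1"
      then have xp: "x = (a + b) *\<^sub>R p" using x qp by (simp add: scaleR_left_distrib)
      then have "a + b = 1 \<or> K > 0 \<and> a + b = - 1" using surface_scaleR[OF ps, of "a + b"] x(1) by simp
      then show ?thesis using xp p ab by auto
    next
      assume "K > 0 \<and> cs K l = - 1"
      then have qp: "q = - p" using qp by simp
      then have xp: "x = (a - b) *\<^sub>R p" using x by (simp add: scaleR_left_diff_distrib)
      then have "a - b = 1 \<or> K > 0 \<and> a - b = - 1" using surface_scaleR[OF ps, of "a - b"] x(1) by simp
      then show ?thesis using xp p q qp by auto
    qed
  next
    case False
    then have "l \<noteq> 0" by auto
    then have l: "l > 0" using \<sigma>(2) by simp
    have lK': "l < pi / sqrt K" if "K > 0"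
    proof -
      have "sn K (pi / sqrt K) = 0" using that by (simp add: sn_def)
      then have "l \<noteq> pi / sqrt K" using False by auto
      then show ?thesis using lK[OF that] by simp
    qed
    have sl: "sn K l > 0" using l lK' by (intro sn_pos) auto
    have xeq: "x = (a + b * cs K l) *\<^sub>R p + (b * sn K l) *\<^sub>R v"
      using x qeq by (simp add: algebra_simps)
    obtain t where t: "cs K t = a + b * cs K l" "sn K t = b * sn K l"
      "K > 0 \<Longrightarrow> 0 \<le> t \<and> t < 2 * pi / sqrt K"
    proof (rule cs_sn_surj)
      show "(a + b * cs K l)\<^sup>2 + K * (b * sn K l)\<^sup>2 = 1" by (rule frame_surface_coords(1)[OF f x(1) xeq])
      show "a + b * cs K l > 0" if "K \<le> 0" by (rule frame_surface_coords(2)[OF f x(1) xeq that])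
    qed blast
    \<comment> \<open>The coefficients \<open>a\<close> and \<open>b\<close> are
      \<open>sn K (l - t)\<close> and \<open>sn K t\<close> divided by \<open>sn K l\<close>. Their
      signs force \<open>t\<close> into \<open>{0..l}\<close>, because within half a great circle
      \<open>sn\<close> is negative only at negative arguments.\<close>
    have "sn K (l - t) = a * sn K l"
      using sn_add[of K l "- t"] by (simp add: t algebra_simps)
    then have slt: "sn K (l - t) \<ge> 0" using ab sl by simp
    have st: "sn K t \<ge> 0" using t ab sl by simp
    have "0 \<le> t \<and> t \<le> l"
    proof (cases "K > 0")
      case True
      then have t0: "0 \<le> t" "sqrt K * t < 2 * pi" using t(3) by (auto simp: field_simps)
      have "sqrt K * t \<le> pi"
      proof (rule ccontr)
        assume "\<not> sqrt K * t \<le> pi"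
        then have "sin (sqrt K * t) < 0" using t0 by (intro sin_lt_zero) auto
        then have "sn K t < 0" using True by (simp add: sn_def divide_less_0_iff)
        then show False using st by simp
      qed
      then have tK: "t \<le> pi / sqrt K" using True by (simp add: field_simps)
      have "t \<le> l"
      proof (rule ccontr)
        assume "\<not> t \<le> l"
        then have "sn K (t - l) > 0" using tK l by (intro sn_pos) auto
        then show False using slt sn_minus[of K "t - l"] by simp
      qed
      then show ?thesis using t0 by simp
    next
      case F: False
      have "\<not> t < 0" using sn_pos[of "- t" K] F st by auto
      moreover have "\<not> l < t" using sn_pos[of "t - l" K] sn_minus[of K "t - l"] F slt by auto
      ultimately show ?thesis by simp
    qed
    moreover have "x = \<sigma> t" using xeq t unfolding \<sigma>geo geo_def by simp
    ultimately show ?thesis using \<sigma>(6) by auto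
  qed
qed

text \<open>\<open>scl K x\<close> is the factor by which a point of the cone over the surface has to be divided to
  land on the surface.\<close>

definition scl :: "real \<Rightarrow> real^3 \<Rightarrow> real" where
  "scl K x = (if K = 0 then x $ 3 else sqrt (K * form K x x))"

lemma scl_surface: "x \<in> surface K \<Longrightarrow> scl K x = 1"
  by (auto simp: scl_def surface_def)

lemma continuous_on_scl [continuous_intros]:
  "continuous_on S f \<Longrightarrow> continuous_on S (\<lambda>x. scl K (f x))"
  unfolding scl_def by (cases "K = 0") (auto intro!: continuous_intros)

lemma normalize_in_surface:
  assumes "scl K x > 0" "K < 0 \<Longrightarrow> x $ 3 > 0"
  shows "(1 / scl K x) *\<^sub>R x \<in> surface K"
proof (cases "K = 0")
  case True
  then show ?thesis using assms by (simp add: surface_def scl_def)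
next
  case False
  then have "K * form K x x > 0" using assms(1) by (simp add: scl_def)
  moreover from this have "form K x x \<noteq> 0" by auto
  ultimately have "form K ((1 / scl K x) *\<^sub>R x) ((1 / scl K x) *\<^sub>R x) = 1 / K"
    using False by (simp add: form_simps scl_def field_simps)
  then show ?thesis using False assms by (auto simp: surface_def)
qed

text \<open>For \<open>K \<le> 0\<close> the cone over the surface is convex: the third coordinate
  stays positive, and for \<open>K < 0\<close> mixed products have the right sign. For
  \<open>K > 0\<close> every nonzero vector can be projected, so only cancellation has to be
  excluded.\<close>

lemma comb_normalize:
  assumes p: "p \<in> surface K" and q: "q \<in> surface K" and ab: "0 \<le> a" "0 \<le> b" "a > 0 \<or> b > 0"
    and nz: "K > 0 \<Longrightarrow> a *\<^sub>R p + b *\<^sub>R q \<noteq> 0"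
  shows "scl K (a *\<^sub>R p + b *\<^sub>R q) > 0"
    "(1 / scl K (a *\<^sub>R p + b *\<^sub>R q)) *\<^sub>R (a *\<^sub>R p + b *\<^sub>R q) \<in> surface K"
proof -
  have p3: "(a *\<^sub>R p + b *\<^sub>R q) $ 3 > 0" if "K \<le> 0"
    using surface_nth_3_pos[OF p that] surface_nth_3_pos[OF q that] ab
    by (auto intro: add_pos_nonneg add_nonneg_pos)
  show *: "scl K (a *\<^sub>R p + b *\<^sub>R q) > 0"
  proof -
    consider "K = 0" | "K > 0" | "K < 0" by linarith
    then show ?thesis
    proof cases
      case 1
      then show ?thesis using p3 by (simp add: scl_def)
    next
      case 2
      have "form K x x = x \<bullet> x" for x :: "real^3" using 2 by (simp add: form_def inner_vec_def sum_3)
      then show ?thesis using 2 nz by (simp add: scl_def)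
    next
      case 3
      have "K * form K (a *\<^sub>R p + b *\<^sub>R q) (a *\<^sub>R p + b *\<^sub>R q)
          = a\<^sup>2 * (K * form K p p) + b\<^sup>2 * (K * form K q q) + 2 * (a * b) * (K * form K p q)"
        by (simp add: form_simps form_commute[of K q p] power2_eq_square algebra_simps)
      also have "\<dots> = a\<^sup>2 + b\<^sup>2 + 2 * (a * b) * (K * form K p q)"
        using 3 p q by (simp add: surface_form)
      also have "\<dots> > 0"
      proof -
        have "K * form K p q > 0" using surface_form_neg[OF 3 p q] 3 by (simp add: mult_neg_neg)
        then have "2 * (a * b) * (K * form K p q) \<ge> 0" using ab by simp
        moreover have "a\<^sup>2 + b\<^sup>2 > 0" using ab(3) by (auto simp: add_pos_nonneg add_nonneg_pos)
        ultimately show ?thesis by linarith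
      qed
      finally show ?thesis using 3 by (simp add: scl_def)
    qed
  qed
  show "(1 / scl K (a *\<^sub>R p + b *\<^sub>R q)) *\<^sub>R (a *\<^sub>R p + b *\<^sub>R q) \<in> surface K"
    using normalize_in_surface[OF *] p3 by simp
qed

lemma frame_in_plane:
  assumes "z \<in> surface K" "n \<bullet> z = 0"
  obtains v w where "frame K z v w" "n \<bullet> v = 0"
proof -
  obtain v w where f: "frame K z v w" using frame_exists_at[OF assms(1)] .
  show ?thesis
  proof (cases "n \<bullet> v = 0")
    case True
    then show ?thesis using f that by blast
  next
    case False
    then obtain \<alpha> where "cos \<alpha> * (n \<bullet> v) + sin \<alpha> * (n \<bullet> w) = 0" using angle_exists by metis
    then have "n \<bullet> (cos \<alpha> *\<^sub>R v + sin \<alpha> *\<^sub>R w) = 0" by (simp add: inner_add_right)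
    then show ?thesis using that frame_rot[OF f] by blast
  qed
qed

section \<open>Interior, boundary and sides of a convex domain\<close>

locale convex_domain =
  fixes K :: real and D U :: "(real^3) set"
  assumes compact_D: "compact D"
    and open_U: "openin (top_of_set (surface K)) U"
    and connected_U: "connected U"
    and U_nonempty: "U \<noteq> {}"
    and D_eq: "D = top_of_set (surface K) closure_of U"
    and convex_D: "geodesically_convex K D"
    and boundary_nonempty: "surface_boundary K D \<noteq> {}"
begin

lemma U_subset_surface: "U \<subseteq> surface K"
  using open_U openin_imp_subset by blast

lemma D_subset_surface: "D \<subseteq> surface K"
  unfolding D_eq using closure_of_subset_topspace[of "top_of_set (surface K)"] by simp

lemma U_subset_D: "U \<subseteq> D"
  unfolding D_eq using closure_of_subset[of U "top_of_set (surface K)"] U_subset_surface by simp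

lemma D_subset_closure: "D \<subseteq> closure U"
  unfolding D_eq using U_subset_surface by (auto simp: closure_of_subtopology Int_absorb1)

lemma closedin_D: "closedin (top_of_set (surface K)) D"
  unfolding D_eq by simp

lemma boundary_subset: "surface_boundary K D \<subseteq> D"
  unfolding surface_boundary_def using closedin_D by (rule frontier_of_subset_closedin)

lemma notin_boundary:
  assumes "openin (top_of_set (surface K)) W" "y \<in> W" "W \<subseteq> D"
  shows "y \<notin> surface_boundary K D"
  using interior_of_maximal[OF assms(3,1)] assms(2)
  by (auto simp: surface_boundary_def frontier_of_def)

lemma U_disjoint_boundary: "z \<in> U \<Longrightarrow> z \<notin> surface_boundary K D"
  using notin_boundary[OF open_U _ U_subset_D] by blast

text \<open>A proper convex combination of a point of \<open>D\<close> and an interior point is interior: solving for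
  the interior point shows that all nearby points are such combinations as well.\<close>

lemma comb_interior:
  assumes y: "y \<in> surface K" "y = a *\<^sub>R x + s *\<^sub>R z" and x: "x \<in> D" and z: "z \<in> U"
    and as: "0 \<le> a" "0 < s"
  shows "y \<notin> surface_boundary K D"
proof -
  obtain V where V: "open V" "U = surface K \<inter> V"
    using open_U by (auto simp: openin_open)
  define h where "h = (\<lambda>y. (1 / s) *\<^sub>R (y - a *\<^sub>R x))"
  have hy: "h y = z" using y as by (simp add: h_def)
  have zs: "z \<in> surface K" using z U_subset_surface by blast
  have ch: "isCont h y" unfolding h_def by (intro continuous_intros)
  have cs: "isCont (scl K) (h y)" "isCont (\<lambda>y. scl K (h y)) y"
    using continuous_on_scl[of UNIV "\<lambda>x. x" K] continuous_on_scl[of UNIV h K]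
    unfolding h_def by (auto simp: continuous_on_eq_continuous_at intro!: continuous_intros)
  have "scl K (h y) = 1" using hy zs scl_surface by simp
  then have c2: "isCont (\<lambda>y. (1 / scl K (h y)) *\<^sub>R h y) y"
    by (intro continuous_intros cs ch) auto
  have e1: "\<forall>\<^sub>F y' in nhds y. scl K (h y') > 0"
    using order_tendstoD(1)[OF cs(2)[unfolded isCont_def], of 0] \<open>scl K (h y) = 1\<close>
    by (auto simp: eventually_at_filter elim: eventually_mono)
  have e2: "\<forall>\<^sub>F y' in nhds y. (1 / scl K (h y')) *\<^sub>R h y' \<in> V"
    using topological_tendstoD[OF c2[unfolded isCont_def] V(1)] \<open>scl K (h y) = 1\<close> hy z V(2)
    by (auto simp: eventually_at_filter elim: eventually_mono)
  have e3: "\<forall>\<^sub>F y' in nhds y. K < 0 \<longrightarrow> h y' $ 3 > 0"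
  proof (cases "K < 0")
    case True
    have "isCont (\<lambda>y. h y $ 3) y" using ch by (intro continuous_intros)
    then show ?thesis
      using order_tendstoD(1)[of "\<lambda>y. h y $ 3" "h y $ 3" "at y" 0] surface_nth_3_pos[OF zs] True hy
      by (auto simp: eventually_at_filter isCont_def elim: eventually_mono)
  qed simp
  obtain W where W: "open W" "y \<in> W" "\<And>y'. y' \<in> W \<Longrightarrow> scl K (h y') > 0 \<and>
      (1 / scl K (h y')) *\<^sub>R h y' \<in> V \<and> (K < 0 \<longrightarrow> h y' $ 3 > 0)"
    using eventually_conj[OF e1 eventually_conj[OF e2 e3]] unfolding eventually_nhds by auto
  have "surface K \<inter> W \<subseteq> D"
  proof
    fix y' assume y': "y' \<in> surface K \<inter> W"
    define u where "u = (1 / scl K (h y')) *\<^sub>R h y'"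
    have u: "u \<in> U" using W(3)[of y'] y' V(2) normalize_in_surface[of K "h y'"] by (auto simp: u_def)
    have "y' = a *\<^sub>R x + (s * scl K (h y')) *\<^sub>R u"
      using W(3)[of y'] y' as by (simp add: u_def h_def)
    then show "y' \<in> D"
      using geodesically_convex_comb[OF convex_D x, of u a "s * scl K (h y')" y']
        u U_subset_D as W(3)[of y'] y' by (auto simp: less_imp_le)
  qed
  then show ?thesis using W y by (intro notin_boundary[of "surface K \<inter> W"]) (auto simp: openin_open_Int)
qed

text \<open>If \<open>- z\<close> were in \<open>D\<close>, the normalised sum \<open>x\<close> of a
  boundary point \<open>y\<close> and \<open>- z\<close> would be in \<open>D\<close> too. Then
  \<open>y\<close> is a combination of \<open>x\<close> and the interior point \<open>z\<close> with
  positive coefficients, so it is interior. The existence of a boundary point is essential, as the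
  whole sphere shows.\<close>

lemma antipode_notin:
  assumes K: "K > 0" and z: "z \<in> U" shows "- z \<notin> D"
proof
  assume mz: "- z \<in> D"
  obtain y where y: "y \<in> surface_boundary K D" using boundary_nonempty by blast
  then have yD: "y \<in> D" and ys: "y \<in> surface K" using boundary_subset D_subset_surface by auto
  have ne: "y \<noteq> z" using y z U_disjoint_boundary by blast
  define m where "m = scl K (1 *\<^sub>R y + 1 *\<^sub>R (- z))"
  define x where "x = (1 / m) *\<^sub>R (1 *\<^sub>R y + 1 *\<^sub>R (- z))"
  have mx: "m > 0" "x \<in> surface K" unfolding m_def x_def
    using comb_normalize[OF ys, of "- z" 1 1] mz D_subset_surface ne by auto
  then have "x \<in> D"
    using geodesically_convex_comb[OF convex_D yD mz, of "1 / m" "1 / m" x]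
    by (simp add: x_def algebra_simps)
  moreover have "y = m *\<^sub>R x + 1 *\<^sub>R z" using mx by (simp add: x_def)
  ultimately show False using comb_interior[OF ys, of m x 1 z] z mx y by auto
qed

text \<open>Of two points on the same side of \<open>z\<close> on a geodesic, one lies between
  \<open>z\<close> and the other unless they coincide, and a point strictly between is interior. The
  sign of \<open>a - r * a'\<close> decides which of the two it would be.\<close>

lemma boundary_points_same_side:
  assumes y: "y \<in> surface_boundary K D" "y = a *\<^sub>R z + b *\<^sub>R v"
    and y': "y' \<in> surface_boundary K D" "y' = a' *\<^sub>R z + b' *\<^sub>R v"
    and z: "z \<in> U" and bb: "b * b' > 0"
  shows "y = y'"
proof -
  define r where "r = b / b'"
  have b': "b' \<noteq> 0" using bb by auto
  have r: "r > 0" using bb by (simp add: r_def zero_less_divide_iff zero_less_mult_iff)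
  have b: "b = r * b'" using b' by (simp add: r_def)
  have D: "y \<in> D" "y' \<in> D" using y y' boundary_subset by auto
  have S: "y \<in> surface K" "y' \<in> surface K" using D D_subset_surface by auto
  have e1: "y = r *\<^sub>R y' + (a - r * a') *\<^sub>R z"
    unfolding y y' b by (simp add: algebra_simps)
  have e2: "y' = (1 / r) *\<^sub>R y + (- (a - r * a') / r) *\<^sub>R z"
    using r unfolding y y' b by (simp add: algebra_simps add_divide_distrib diff_divide_distrib)
  have "\<not> a - r * a' > 0" using comb_interior[OF S(1) e1 D(2) z] r y by auto
  moreover have "\<not> - (a - r * a') / r > 0" using comb_interior[OF S(2) e2 D(1) z] r y' by auto
  ultimately have "a - r * a' = 0" using r by (auto simp: divide_le_0_iff not_less)
  then have "y = r *\<^sub>R y'" using e1 by simp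
  then show ?thesis using surface_scaleR[OF S(2), of r] S(1) r by auto
qed

text \<open>A geodesic through the interior point \<open>z\<close> has two sides at
  \<open>z\<close>, each with at most one boundary point. A vanishing coordinate along
  \<open>v\<close> would mean \<open>z\<close> or \<open>- z\<close>, and neither is a boundary
  point.\<close>

lemma three_boundary_points:
  assumes n: "n \<noteq> 0" and z: "z \<in> U" "n \<bullet> z = 0"
    and y: "y1 \<in> surface_boundary K D" "y2 \<in> surface_boundary K D" "y3 \<in> surface_boundary K D"
      "n \<bullet> y1 = 0" "n \<bullet> y2 = 0" "n \<bullet> y3 = 0"
  shows "y1 = y2 \<or> y1 = y3 \<or> y2 = y3"
proof -
  have zs: "z \<in> surface K" using z U_subset_surface by blast
  obtain v w where f: "frame K z v w" "n \<bullet> v = 0" using frame_in_plane[OF zs z(2)] .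
  have coords: "\<exists>a b. y = a *\<^sub>R z + b *\<^sub>R v \<and> b \<noteq> 0"
    if yy: "y \<in> surface_boundary K D" "n \<bullet> y = 0" for y
  proof -
    obtain a b where ab: "y = a *\<^sub>R z + b *\<^sub>R v" using frame_plane[OF f(1) n z(2) f(2) yy(2)] .
    have "b \<noteq> 0"
    proof
      assume "b = 0"
      then have ya: "y = a *\<^sub>R z" using ab by simp
      moreover have "y \<in> D" "y \<in> surface K" using yy boundary_subset D_subset_surface by auto
      ultimately have "a = 1 \<or> K > 0 \<and> a = - 1" using surface_scaleR[OF zs, of a] by auto
      then show False using ya \<open>y \<in> D\<close> antipode_notin z yy U_disjoint_boundary by auto
    qed
    then show ?thesis using ab by blast
  qed
  obtain a1 b1 a2 b2 a3 b3 where
    e: "y1 = a1 *\<^sub>R z + b1 *\<^sub>R v" "y2 = a2 *\<^sub>R z + b2 *\<^sub>R v" "y3 = a3 *\<^sub>R z + b3 *\<^sub>R v"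
    and b: "b1 \<noteq> 0" "b2 \<noteq> 0" "b3 \<noteq> 0"
    using coords[OF y(1,4)] coords[OF y(2,5)] coords[OF y(3,6)] by blast
  have "b1 * b2 > 0 \<or> b1 * b3 > 0 \<or> b2 * b3 > 0"
    using b by (auto simp: zero_less_mult_iff)
  then show ?thesis
    using boundary_points_same_side[OF y(1) e(1) y(2) e(2) z(1)]
      boundary_points_same_side[OF y(1) e(1) y(3) e(3) z(1)]
      boundary_points_same_side[OF y(2) e(2) y(3) e(3) z(1)] by blast
qed

lemma exists_U_positive:
  assumes n: "n \<noteq> 0" and z: "z \<in> U" "n \<bullet> z = 0"
  obtains u where "u \<in> U" "n \<bullet> u > 0"
proof -
  have zs: "z \<in> surface K" using z U_subset_surface by blast
  obtain v w where f: "frame K z v w" "n \<bullet> v = 0" using frame_in_plane[OF zs z(2)] .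
  have nw: "n \<bullet> w \<noteq> 0" using frame_orth_zero[OF f(1) z(2) f(2)] n by blast
  obtain V where V: "open V" "U = surface K \<inter> V" using open_U by (auto simp: openin_open)
  have "isCont (geo K z w) 0" using geo_has_deriv has_vector_derivative_continuous by blast
  then have "\<forall>\<^sub>F t in at 0. geo K z w t \<in> V"
    using z V by (intro topological_tendstoD) (auto simp: isCont_def)
  then obtain d where d: "d > 0" "\<And>t. t \<noteq> 0 \<Longrightarrow> \<bar>t\<bar> < d \<Longrightarrow> geo K z w t \<in> V"
    unfolding eventually_at by (auto simp: dist_norm)
  obtain e where e: "e > 0" "e < d" "K > 0 \<Longrightarrow> e < pi / sqrt K"
  proof (cases "K > 0")
    case True
    define P where "P = pi / sqrt K"
    have "P > 0" using True by (simp add: P_def)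
    then show ?thesis using that[of "min (d / 2) (P / 2)"] d unfolding P_def[symmetric]
      by (simp add: min_less_iff_disj)
  next
    case False
    then show ?thesis using that[of "d / 2"] d by auto
  qed
  have se: "sn K e > 0" using e by (intro sn_pos) auto
  have val: "n \<bullet> geo K z w t = sn K t * (n \<bullet> w)" for t
    using z by (simp add: geo_def inner_add_right)
  have inU: "geo K z w e \<in> U" "geo K z w (- e) \<in> U"
    using d(2)[of e] d(2)[of "- e"] e V(2) geo_in_surface[OF frame_swap[OF f(1)]] by auto
  show ?thesis
  proof (cases "n \<bullet> w > 0")
    case True
    then show ?thesis using that[OF inU(1)] se val by simp
  next
    case False
    then show ?thesis using that[OF inU(2)] se nw val[of "- e"] by (simp add: mult_less_0_iff)
  qed
qed

lemma unbounded_geodesic: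
  assumes "K \<le> 0" "frame K z v w" "range (geo K z v) \<subseteq> D"
  shows False
proof -
  obtain B where B: "\<And>x. x \<in> D \<Longrightarrow> norm x \<le> B"
    using compact_imp_bounded[OF compact_D] by (auto simp: bounded_iff)
  have "v \<noteq> 0" using assms(2) by (auto simp: frame_def form_simps)
  \<comment> \<open>Chosen so that the points at \<open>t\<close> and \<open>- t\<close> with
    \<open>sn K t = b\<close> differ by a vector of length \<open>2 * (B + 1)\<close>, too long for
    a set of norm at most \<open>B\<close>.\<close>
  define b where "b = (B + 1) / norm v"
  have "(sqrt (1 - K * b\<^sup>2))\<^sup>2 + K * b\<^sup>2 = 1" "sqrt (1 - K * b\<^sup>2) > 0"
    using assms(1) mult_nonpos_nonneg[of K "b\<^sup>2"] by auto
  then obtain t where t: "sn K t = b" using cs_sn_surj[of "sqrt (1 - K * b\<^sup>2)" K b] by metis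
  have "norm (geo K z v t - geo K z v (- t)) \<le> norm (geo K z v t) + norm (geo K z v (- t))"
    by (rule norm_triangle_ineq4)
  also have "\<dots> \<le> B + B" using assms(3) by (intro add_mono B) auto
  also have "geo K z v t - geo K z v (- t) = b *\<^sub>R v + b *\<^sub>R v"
    by (simp add: geo_def t)
  also have "\<dots> = (2 * b) *\<^sub>R v"
    by (simp flip: scaleR_2)
  finally have "2 * (\<bar>b\<bar> * norm v) \<le> 2 * B" by simp
  moreover have "b * norm v = B + 1" using \<open>v \<noteq> 0\<close> by (simp add: b_def)
  moreover have "b * norm v \<le> \<bar>b\<bar> * norm v" by (intro mult_right_mono) auto
  ultimately show False by linarith
qed

text \<open>Starting from an interior point on the positive side, a path can leave \<open>D\<close>
  only through the boundary. If that side had no boundary points, the half-surface would be filled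
  up to its edge, and \<open>D\<close> would contain the whole geodesic. On the sphere this puts
  \<open>- z\<close> into \<open>D\<close>; otherwise it contradicts compactness.\<close>

lemma boundary_positive:
  assumes n: "n \<noteq> 0" and z: "z \<in> U" "n \<bullet> z = 0"
  obtains y where "y \<in> surface_boundary K D" "n \<bullet> y > 0"
proof (rule ccontr)
  assume "\<not> thesis"
  with that have nob: "\<not> n \<bullet> y > 0" if "y \<in> surface_boundary K D" for y using that by blast
  obtain u where u: "u \<in> U" "n \<bullet> u > 0" using exists_U_positive[OF n z] .
  have us: "u \<in> surface K" and uD: "u \<in> D" using u U_subset_surface U_subset_D by auto
  have zs: "z \<in> surface K" using z U_subset_surface by blast
  have mem: "h \<in> D" if h: "h \<in> surface K" "n \<bullet> h = 0" for h
  proof -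
    \<comment> \<open>\<open>X\<close> is the straight segment from \<open>u\<close> to
      \<open>h\<close>, and \<open>\<rho>\<close> its projection to the surface. The parameter 1 is
      left out: before it the functional \<open>n\<close> is positive, so \<open>X\<close> is
      nonzero and no boundary point is met. The endpoint \<open>h\<close> then follows because
      \<open>D\<close> is closed.\<close>
    define X where "X = (\<lambda>t::real. (1 - t) *\<^sub>R u + t *\<^sub>R h)"
    define \<rho> where "\<rho> = (\<lambda>t. (1 / scl K (X t)) *\<^sub>R X t)"
    have nX: "n \<bullet> X t = (1 - t) * (n \<bullet> u)" for t using h by (simp add: X_def inner_add_right)
    have X: "scl K (X t) > 0" "\<rho> t \<in> surface K" if t: "t \<in> {0..<1}" for t
    proof -
      have "X t \<noteq> 0" using nX[of t] t u by auto
      then show "scl K (X t) > 0" "\<rho> t \<in> surface K"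
        using comb_normalize[OF us h(1), of "1 - t" t] t unfolding \<rho>_def X_def by auto
    qed
    have cX: "continuous_on S X" for S unfolding X_def by (intro continuous_intros)
    have c\<rho>: "continuous_on {0..<1} \<rho>"
      unfolding \<rho>_def using X by (intro continuous_intros cX) force
    have conn: "connected (\<rho> ` {0..<1})"
      using c\<rho> by (intro connected_continuous_image) auto
    have sub: "\<rho> ` {0..<1} \<subseteq> D"
    proof (rule ccontr)
      assume "\<not> \<rho> ` {0..<1} \<subseteq> D"
      moreover have "\<rho> 0 = u" using scl_surface[OF us] by (simp add: \<rho>_def X_def)
      then have "\<rho> ` {0..<1} \<inter> D \<noteq> {}" using uD by force
      moreover have "connectedin (top_of_set (surface K)) (\<rho> ` {0..<1})"
        using conn X(2) by (auto simp: connectedin_subtopology)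
      ultimately have "\<rho> ` {0..<1} \<inter> surface_boundary K D \<noteq> {}"
        unfolding surface_boundary_def by (intro connectedin_Int_frontier_of) auto
      then obtain t where t: "t \<in> {0..<1}" "\<rho> t \<in> surface_boundary K D" by blast
      have "n \<bullet> \<rho> t > 0" using nX[of t] X(1)[OF t(1)] t u by (simp add: \<rho>_def)
      then show False using nob t(2) by blast
    qed
    have "scl K (X 1) = 1" using scl_surface[OF h(1)] by (simp add: X_def)
    moreover have "isCont (\<lambda>t. scl K (X t)) 1" "isCont X 1"
      using continuous_on_scl[OF cX[of UNIV], of K] cX[of UNIV]
      by (auto simp: continuous_on_eq_continuous_at)
    ultimately have "isCont \<rho> 1" unfolding \<rho>_def by (intro continuous_intros) auto
    then have "(\<rho> \<longlongrightarrow> \<rho> 1) (at_left 1)" by (simp add: isCont_def filterlim_at_split)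
    moreover have "\<rho> 1 = h" using scl_surface[OF h(1)] by (simp add: \<rho>_def X_def)
    moreover have "\<forall>\<^sub>F t in at_left 1. \<rho> t \<in> D"
    proof -
      have "\<forall>\<^sub>F t in at_left (1::real). t \<in> {0<..<1}" by (rule eventually_at_leftI[of 0]) auto
      then show ?thesis by (rule eventually_mono) (use sub in force)
    qed
    ultimately show ?thesis
      using Lim_in_closed_set[OF compact_imp_closed[OF compact_D], of \<rho> "at_left 1" h] by auto
  qed
  show False
  proof (cases "K > 0")
    case True
    then have "- z \<in> surface K" using zs by (auto simp: surface_def form_simps)
    then show False using mem[of "- z"] antipode_notin[OF True z(1)] z by simp
  next
    case False
    obtain v w where f: "frame K z v w" "n \<bullet> v = 0" using frame_in_plane[OF zs z(2)] .
    have "range (geo K z v) \<subseteq> D"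
      using mem geo_in_surface[OF f(1)] z f(2) by (auto simp: geo_def inner_add_right)
    then show False using unbounded_geodesic f(1) False by auto
  qed
qed

lemma one_sided:
  assumes "{x \<in> surface K. n \<bullet> x = 0} \<inter> U = {}"
  shows "(\<forall>x\<in>D. n \<bullet> x \<ge> 0) \<or> (\<forall>x\<in>D. n \<bullet> x \<le> 0)"
proof -
  have nz: "n \<bullet> x \<noteq> 0" if "x \<in> U" for x using assms that U_subset_surface by blast
  have cl: "closed {x. n \<bullet> x \<ge> 0}" "closed {x. n \<bullet> x \<le> 0}"
    by (auto intro!: closed_Collect_le continuous_intros)
  have "(\<forall>x\<in>U. n \<bullet> x > 0) \<or> (\<forall>x\<in>U. n \<bullet> x < 0)"
  proof (rule ccontr)
    assume "\<not> ?thesis"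
    then obtain x y where xy: "x \<in> U" "y \<in> U" "n \<bullet> x \<le> 0" "n \<bullet> y \<ge> 0" by (meson not_less)
    have "connected ((\<lambda>x. n \<bullet> x) ` U)"
      by (intro connected_continuous_image continuous_intros connected_U)
    then have "0 \<in> (\<lambda>x. n \<bullet> x) ` U" using xy connectedD_interval by blast
    then show False using nz by force
  qed
  then have "U \<subseteq> {x. n \<bullet> x \<ge> 0} \<or> U \<subseteq> {x. n \<bullet> x \<le> 0}" by (auto intro: less_imp_le)
  then show ?thesis using closure_minimal cl D_subset_closure by blast
qed

end

subsection \<open>Supporting geodesics\<close>

lemma finite_no_three:
  fixes A :: "real set"
  assumes "\<And>x y z. x \<in> A \<Longrightarrow> y \<in> A \<Longrightarrow> z \<in> A \<Longrightarrow> x < y \<Longrightarrow> y < z \<Longrightarrow> False"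
  shows "finite A"
proof (rule ccontr)
  assume "infinite A"
  then obtain B where B: "B \<subseteq> A" "finite B" "card B = 3" using infinite_arbitrarily_large by blast
  define xs where "xs = sorted_list_of_set B"
  have xs: "sorted_wrt (<) xs" "set xs = B" "length xs = 3"
    using B by (auto simp: xs_def)
  then have "xs ! 0 < xs ! 1" "xs ! 1 < xs ! 2" "xs ! 0 \<in> A" "xs ! 1 \<in> A" "xs ! 2 \<in> A"
    using B(1) nth_mem by (auto simp: sorted_wrt_iff_nth_less)
  then show False using assms by blast
qed

text \<open>If \<open>f1\<close> and \<open>f3\<close> have the same sign on \<open>D\<close>, the
  contact point of \<open>f2\<close> annihilates both. If their signs differ, \<open>f2\<close>
  shares its sign with one of them, and at the contact point of that one the relation equates a
  nonnegative with a nonpositive number.\<close>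

lemma three_one_sided:
  fixes f1 f2 f3 :: "'a \<Rightarrow> real"
  assumes s: "s1 > 0" "s2 > 0" "s3 > 0" and eq: "\<And>y. s2 * f2 y = s1 * f1 y + s3 * f3 y"
    and y: "y1 \<in> D" "f1 y1 = 0" "y2 \<in> D" "f2 y2 = 0" "y3 \<in> D" "f3 y3 = 0"
    and one: "(\<forall>y\<in>D. f1 y \<ge> 0) \<or> (\<forall>y\<in>D. f1 y \<le> 0)"
      "(\<forall>y\<in>D. f2 y \<ge> 0) \<or> (\<forall>y\<in>D. f2 y \<le> 0)"
      "(\<forall>y\<in>D. f3 y \<ge> 0) \<or> (\<forall>y\<in>D. f3 y \<le> 0)"
  obtains y where "y \<in> D" "f1 y = 0" "f3 y = 0"
proof -
  have e1: "s2 * f2 y1 = s3 * f3 y1" using eq[of y1] y by simp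
  have e2: "s1 * f1 y2 + s3 * f3 y2 = 0" using eq[of y2] y by simp
  have e3: "s2 * f2 y3 = s1 * f1 y3" using eq[of y3] y by simp
  have "(f1 y2 = 0 \<and> f3 y2 = 0) \<or> f3 y1 = 0 \<or> f1 y3 = 0"
    using one
  proof (elim disjE)
    assume a: "\<forall>y\<in>D. f1 y \<ge> 0" "\<forall>y\<in>D. f2 y \<ge> 0" "\<forall>y\<in>D. f3 y \<ge> 0"
    then have "s1 * f1 y2 \<ge> 0" "s3 * f3 y2 \<ge> 0"
      using y s by (simp_all add: zero_le_mult_iff mult_le_0_iff)
    then have "s1 * f1 y2 = 0" "s3 * f3 y2 = 0" using e2 by linarith+
    then show ?thesis using s by simp
  next
    assume a: "\<forall>y\<in>D. f1 y \<ge> 0" "\<forall>y\<in>D. f2 y \<ge> 0" "\<forall>y\<in>D. f3 y \<le> 0"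
    then have "s2 * f2 y1 \<ge> 0" "s3 * f3 y1 \<le> 0"
      using y s by (simp_all add: zero_le_mult_iff mult_le_0_iff)
    then have "s3 * f3 y1 = 0" using e1 by linarith+
    then show ?thesis using s by simp
  next
    assume a: "\<forall>y\<in>D. f1 y \<ge> 0" "\<forall>y\<in>D. f2 y \<le> 0" "\<forall>y\<in>D. f3 y \<ge> 0"
    then have "s1 * f1 y2 \<ge> 0" "s3 * f3 y2 \<ge> 0"
      using y s by (simp_all add: zero_le_mult_iff mult_le_0_iff)
    then have "s1 * f1 y2 = 0" "s3 * f3 y2 = 0" using e2 by linarith+
    then show ?thesis using s by simp
  next
    assume a: "\<forall>y\<in>D. f1 y \<ge> 0" "\<forall>y\<in>D. f2 y \<le> 0" "\<forall>y\<in>D. f3 y \<le> 0"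
    then have "s1 * f1 y3 \<ge> 0" "s2 * f2 y3 \<le> 0"
      using y s by (simp_all add: zero_le_mult_iff mult_le_0_iff)
    then have "s1 * f1 y3 = 0" using e3 by linarith+
    then show ?thesis using s by simp
  next
    assume a: "\<forall>y\<in>D. f1 y \<le> 0" "\<forall>y\<in>D. f2 y \<ge> 0" "\<forall>y\<in>D. f3 y \<ge> 0"
    then have "s1 * f1 y3 \<le> 0" "s2 * f2 y3 \<ge> 0"
      using y s by (simp_all add: zero_le_mult_iff mult_le_0_iff)
    then have "s1 * f1 y3 = 0" using e3 by linarith+
    then show ?thesis using s by simp
  next
    assume a: "\<forall>y\<in>D. f1 y \<le> 0" "\<forall>y\<in>D. f2 y \<ge> 0" "\<forall>y\<in>D. f3 y \<le> 0"
    then have "s1 * f1 y2 \<le> 0" "s3 * f3 y2 \<le> 0"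
      using y s by (simp_all add: zero_le_mult_iff mult_le_0_iff)
    then have "s1 * f1 y2 = 0" "s3 * f3 y2 = 0" using e2 by linarith+
    then show ?thesis using s by simp
  next
    assume a: "\<forall>y\<in>D. f1 y \<le> 0" "\<forall>y\<in>D. f2 y \<le> 0" "\<forall>y\<in>D. f3 y \<ge> 0"
    then have "s2 * f2 y1 \<le> 0" "s3 * f3 y1 \<ge> 0"
      using y s by (simp_all add: zero_le_mult_iff mult_le_0_iff)
    then have "s3 * f3 y1 = 0" using e1 by linarith+
    then show ?thesis using s by simp
  next
    assume a: "\<forall>y\<in>D. f1 y \<le> 0" "\<forall>y\<in>D. f2 y \<le> 0" "\<forall>y\<in>D. f3 y \<le> 0"
    then have "s1 * f1 y2 \<le> 0" "s3 * f3 y2 \<le> 0"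
      using y s by (simp_all add: zero_le_mult_iff mult_le_0_iff)
    then have "s1 * f1 y2 = 0" "s3 * f3 y2 = 0" using e2 by linarith+
    then show ?thesis using s by simp
  qed
  then show ?thesis using that[of y1] that[of y2] that[of y3] y by blast
qed

lemma frame_dual:
  assumes "frame K x v w"
  obtains n where "n \<bullet> x = 0" "n \<bullet> w = 0" "n \<bullet> v = 1"
proof -
  obtain m where m: "m \<noteq> 0" "m \<bullet> x = 0" "m \<bullet> w = 0"
    using frame_normal_exists[OF frame_swap[OF assms]] .
  then have "m \<bullet> v \<noteq> 0" using frame_orth_zero[OF assms] by blast
  then show ?thesis using that[of "(1 / (m \<bullet> v)) *\<^sub>R m"] m by simp
qed

text \<open>The linear relation between the unit vectors at angles \<open>a\<close>,
  \<open>b\<close> and \<open>c\<close>. Its coefficients are positive when the angles increase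
  within a range shorter than \<open>pi\<close>.\<close>

lemma sin_three: "sin (c - a) * sin b = sin (c - b) * sin a + sin (b - a) * sin (c::real)"
  "sin (c - a) * cos b = sin (c - b) * cos a + sin (b - a) * cos c"
proof -
  have "sin (c - a) * sin b - (sin (c - b) * sin a + sin (b - a) * sin c) = 0"
    by (simp add: sin_diff algebra_simps)
  then show "sin (c - a) * sin b = sin (c - b) * sin a + sin (b - a) * sin c" by simp
  have "sin (c - a) * cos b - (sin (c - b) * cos a + sin (b - a) * cos c) = 0"
    by (simp add: sin_diff algebra_simps)
  then show "sin (c - a) * cos b = sin (c - b) * cos a + sin (b - a) * cos c" by simp
qed

context convex_domain
begin

definition supporting :: "(real^3) set set" where
  "supporting = geodesics_meeting K D - geodesics_meeting K U"

text \<open>Up to signs, one of three normals of supporting geodesics through \<open>x\<close> is a positive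
  combination of the other two, so at a contact point of that geodesic all three functionals vanish;
  the contact point is then \<open>x\<close> or \<open>- x\<close>.\<close>

lemma three_supporting:
  assumes f: "frame K x v w"
    and \<alpha>: "0 < \<alpha>1" "\<alpha>1 < \<alpha>2" "\<alpha>2 < \<alpha>3" "\<alpha>3 < pi"
    and sup: "\<And>\<alpha>. \<alpha> \<in> {\<alpha>1, \<alpha>2, \<alpha>3} \<Longrightarrow> range (geo K x (cos \<alpha> *\<^sub>R v + sin \<alpha> *\<^sub>R w)) \<in> supporting"
  shows "x \<in> D \<or> - x \<in> D"
proof -
  obtain nv where nv: "nv \<bullet> x = 0" "nv \<bullet> w = 0" "nv \<bullet> v = 1" using frame_dual[OF f] .
  obtain nw where nw: "nw \<bullet> x = 0" "nw \<bullet> v = 0" "nw \<bullet> w = 1" using frame_dual[OF frame_swap[OF f]] .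
  \<comment> \<open>\<open>m \<alpha>\<close> annihilates \<open>x\<close> and the direction with
    angle \<alpha>, so it is an explicit normal of that geodesic; unlike \<open>nrm\<close> it
    depends on \<alpha> by a formula and obeys the sine relation.\<close>
  define m where "m = (\<lambda>\<alpha>. sin \<alpha> *\<^sub>R nv - cos \<alpha> *\<^sub>R nw)"
  have m: "m \<alpha> \<noteq> 0" if "\<alpha> \<in> {\<alpha>1, \<alpha>2, \<alpha>3}" for \<alpha>
  proof -
    have "m \<alpha> \<bullet> v = sin \<alpha>" using nv nw by (simp add: m_def inner_diff_left)
    moreover have "sin \<alpha> > 0" using that \<alpha> by (intro sin_gt_zero) auto
    ultimately show ?thesis by auto
  qed
  have eq: "range (geo K x (cos \<alpha> *\<^sub>R v + sin \<alpha> *\<^sub>R w)) = {y \<in> surface K. m \<alpha> \<bullet> y = 0}"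
    if "\<alpha> \<in> {\<alpha>1, \<alpha>2, \<alpha>3}" for \<alpha>
    using nv nw by (intro range_geo_eq_plane[OF frame_rot[OF f] m[OF that]])
      (auto simp: m_def inner_diff_left inner_add_right)
  have one: "(\<forall>y\<in>D. m \<alpha> \<bullet> y \<ge> 0) \<or> (\<forall>y\<in>D. m \<alpha> \<bullet> y \<le> 0)" if "\<alpha> \<in> {\<alpha>1, \<alpha>2, \<alpha>3}" for \<alpha>
    using sup[OF that] unfolding eq[OF that]
    by (intro one_sided) (auto simp: supporting_def geodesics_meeting_def)
  have touch: "\<exists>y\<in>D. m \<alpha> \<bullet> y = 0" if "\<alpha> \<in> {\<alpha>1, \<alpha>2, \<alpha>3}" for \<alpha>
    using sup[OF that] unfolding eq[OF that] by (auto simp: supporting_def geodesics_meeting_def)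
  obtain y1 y2 y3 where y: "y1 \<in> D" "m \<alpha>1 \<bullet> y1 = 0" "y2 \<in> D" "m \<alpha>2 \<bullet> y2 = 0" "y3 \<in> D" "m \<alpha>3 \<bullet> y3 = 0"
    using touch[of \<alpha>1] touch[of \<alpha>2] touch[of \<alpha>3] by auto
  have s: "sin (\<alpha>3 - \<alpha>2) > 0" "sin (\<alpha>3 - \<alpha>1) > 0" "sin (\<alpha>2 - \<alpha>1) > 0"
    using \<alpha> by (auto intro!: sin_gt_zero)
  have comb: "sin (\<alpha>3 - \<alpha>1) * (m \<alpha>2 \<bullet> y) = sin (\<alpha>3 - \<alpha>2) * (m \<alpha>1 \<bullet> y) + sin (\<alpha>2 - \<alpha>1) * (m \<alpha>3 \<bullet> y)" for y
  proof -
    have "sin (\<alpha>3 - \<alpha>1) * (m \<alpha>2 \<bullet> y)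
        = (sin (\<alpha>3 - \<alpha>1) * sin \<alpha>2) * (nv \<bullet> y) - (sin (\<alpha>3 - \<alpha>1) * cos \<alpha>2) * (nw \<bullet> y)"
      by (simp add: m_def inner_diff_left algebra_simps)
    also have "\<dots> = sin (\<alpha>3 - \<alpha>2) * (m \<alpha>1 \<bullet> y) + sin (\<alpha>2 - \<alpha>1) * (m \<alpha>3 \<bullet> y)"
      unfolding sin_three[of \<alpha>3 \<alpha>1 \<alpha>2] by (simp add: m_def inner_diff_left algebra_simps)
    finally show ?thesis .
  qed
  obtain y where yD: "y \<in> D" "m \<alpha>1 \<bullet> y = 0" "m \<alpha>3 \<bullet> y = 0"
    using three_one_sided[OF s comb y one[of \<alpha>1] one[of \<alpha>2] one[of \<alpha>3]] by auto
  have e: "sin \<alpha>1 * (nv \<bullet> y) = cos \<alpha>1 * (nw \<bullet> y)" "sin \<alpha>3 * (nv \<bullet> y) = cos \<alpha>3 * (nw \<bullet> y)"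
    using yD by (simp_all add: m_def inner_diff_left)
  have s31: "sin (\<alpha>3 - \<alpha>1) = sin \<alpha>3 * cos \<alpha>1 - cos \<alpha>3 * sin \<alpha>1" by (rule sin_diff)
  have "sin (\<alpha>3 - \<alpha>1) * (nw \<bullet> y) = sin \<alpha>3 * (cos \<alpha>1 * (nw \<bullet> y)) - sin \<alpha>1 * (cos \<alpha>3 * (nw \<bullet> y))"
    by (simp add: s31 algebra_simps)
  then have "sin (\<alpha>3 - \<alpha>1) * (nw \<bullet> y) = 0" by (simp flip: e)
  then have nwy: "nw \<bullet> y = 0" using s by simp
  moreover have "sin \<alpha>1 > 0" using \<alpha> by (intro sin_gt_zero) auto
  ultimately have nvy: "nv \<bullet> y = 0" using e by simp
  obtain a b c where "y = a *\<^sub>R x + b *\<^sub>R v + c *\<^sub>R w" using frame_decomp[OF f] .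
  then have "y = a *\<^sub>R x" using nvy nwy nv nw by (simp add: inner_add_right)
  moreover have "x \<in> surface K" using f by (simp add: frame_def)
  moreover have "y \<in> surface K" using yD D_subset_surface by blast
  ultimately have "y = x \<or> y = - x" using surface_scaleR[of x K a] by auto
  then show ?thesis using yD by auto
qed

lemma supporting_one_sided:
  assumes "g \<in> supporting"
  shows "(\<forall>y\<in>D. nrm K g \<bullet> y \<ge> 0) \<or> (\<forall>y\<in>D. nrm K g \<bullet> y \<le> 0)"
proof (rule one_sided)
  have "g \<in> geodesics K" "g \<inter> U = {}" using assms by (auto simp: supporting_def geodesics_meeting_def)
  then show "{x \<in> surface K. nrm K g \<bullet> x = 0} \<inter> U = {}" using geodesic_eq_nrm by blast
qed

text \<open>A geodesic crossing strictly between two points of \<open>D\<close> has points of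
  \<open>D\<close> strictly on both sides, so it cannot support \<open>D\<close>. The factor
  \<open>e\<close> covers a segment that runs through the antipodal image of \<open>D\<close> as
  well.\<close>

lemma no_three_contacts:
  assumes f: "frame K p v w" and l: "l1 < l2" "l2 < l3" and short: "K > 0 \<Longrightarrow> l3 - l1 < pi / sqrt K"
    and D: "e *\<^sub>R geo K p v l1 \<in> D" "e *\<^sub>R geo K p v l3 \<in> D" and e: "e \<noteq> 0"
    and \<alpha>: "0 < \<alpha>" "\<alpha> < pi" and sup: "crossing K (geo K p v) (\<lambda>_. w) (l2, \<alpha>) \<in> supporting"
  shows False
proof -
  define g where "g = crossing K (geo K p v) (\<lambda>_. w) (l2, \<alpha>)"
  have "g \<in> sep K (geo K p v l1) (geo K p v l3)"
    using crossing_image[OF f, of l1 l3] l short \<alpha> unfolding g_def by force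
  then have neg: "(nrm K g \<bullet> geo K p v l1) * (nrm K g \<bullet> geo K p v l3) < 0" by (simp add: sep_def)
  have "e * e > 0" using e not_square_less_zero[of e] by (simp add: less_le)
  then have "(e * e) * ((nrm K g \<bullet> geo K p v l1) * (nrm K g \<bullet> geo K p v l3)) < 0"
    using neg by (rule mult_pos_neg)
  then have "(nrm K g \<bullet> (e *\<^sub>R geo K p v l1)) * (nrm K g \<bullet> (e *\<^sub>R geo K p v l3)) < 0"
    by (simp add: algebra_simps)
  then show False using supporting_one_sided[OF sup[folded g_def]] D
    by (meson mult_nonneg_nonneg mult_nonpos_nonpos not_less)
qed

lemma meeting_U_measurable: "geodesics_meeting K U \<in> sets (geodesic_borel K)"
proof -
  obtain V where V: "open V" "U = surface K \<inter> V" using open_U by (auto simp: openin_open)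
  have "geodesics_meeting K U = geodesics_meeting K V"
    using geodesic_subset_surface[of _ K] V(2) by (auto simp: geodesics_meeting_def)
  then show ?thesis using geodesics_meeting_open[OF V(1)] by simp
qed

lemma supporting_measurable: "supporting \<in> sets (geodesic_borel K)"
  unfolding supporting_def
  using meeting_U_measurable geodesics_meeting_compact[OF compact_D] by (rule sets.Diff[rotated])

text \<open>At a position outside \<open>D\<close> and its antipodal image at most two angles give a
  supporting geodesic. Of the positions in either set, only the first and the last can carry a
  transversal supporting geodesic, so at most two are exceptional for each sign. This holds even if
  the segment runs along a side of \<open>D\<close>.\<close>

lemma supporting_chart_null:
  assumes \<mu>: "invariant_geodesic_measure K \<mu>" and f: "frame K p v w"
    and ab: "a < b" and short: "K > 0 \<Longrightarrow> b - a < pi / sqrt K"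
  shows "supporting \<inter> sep K (geo K p v a) (geo K p v b) \<in> null_sets \<mu>"
proof -
  let ?c = "crossing K (geo K p v) (\<lambda>_. w)"
  let ?E = "supporting \<inter> sep K (geo K p v a) (geo K p v b)"
  have meas: "?E \<in> sets \<mu>"
    using supporting_measurable sep_measurable[OF f ab short] sets_invariant[OF \<mu>] by auto
  define B where "B = (\<lambda>e. {l \<in> {a<..<b}. e *\<^sub>R geo K p v l \<in> D \<and> (\<exists>\<alpha>. 0 < \<alpha> \<and> \<alpha> < pi \<and> ?c (l, \<alpha>) \<in> supporting)})"
  have finB: "finite (B e)" if "e \<noteq> 0" for e
  proof (rule finite_no_three)
    fix l1 l2 l3 assume l: "l1 \<in> B e" "l2 \<in> B e" "l3 \<in> B e" "l1 < l2" "l2 < l3"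
    obtain \<alpha> where \<alpha>: "0 < \<alpha>" "\<alpha> < pi" "?c (l2, \<alpha>) \<in> supporting" using l by (auto simp: B_def)
    show False
    proof (rule no_three_contacts[OF f l(4,5) _ _ _ that \<alpha>])
      show "l3 - l1 < pi / sqrt K" if "K > 0" using short[OF that] l(1,3) by (auto simp: B_def)
    qed (use l in \<open>auto simp: B_def\<close>)
  qed
  have inner: "(\<integral>\<^sup>+\<alpha>\<in>{0<..<pi}. ennreal (sin \<alpha>) * indicator ?E (?c (l, \<alpha>)) \<partial>lborel) = 0"
    if l: "l \<in> {a<..<b}" "l \<notin> B 1 \<union> B (- 1)" for l
  proof -
    define A where "A = {\<alpha>. 0 < \<alpha> \<and> \<alpha> < pi \<and> ?c (l, \<alpha>) \<in> supporting}"
    have "finite A"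
    proof (rule finite_no_three)
      fix \<alpha>1 \<alpha>2 \<alpha>3 assume \<alpha>: "\<alpha>1 \<in> A" "\<alpha>2 \<in> A" "\<alpha>3 \<in> A" "\<alpha>1 < \<alpha>2" "\<alpha>2 < \<alpha>3"
      have "geo K p v l \<in> D \<or> - geo K p v l \<in> D"
        by (rule three_supporting[OF frame_geo[OF f, of l], of \<alpha>1 \<alpha>2 \<alpha>3])
          (use \<alpha> crossing_eq[OF f, of l] in \<open>auto simp: A_def cross_dir_def\<close>)
      then show False using l \<alpha>(1) by (auto simp: A_def B_def)
    qed
    then have "AE \<alpha> in lborel. \<alpha> \<notin> A"
      by (intro AE_not_in countable_imp_null_set_lborel countable_finite)
    then have "(\<integral>\<^sup>+\<alpha>\<in>{0<..<pi}. ennreal (sin \<alpha>) * indicator ?E (?c (l, \<alpha>)) \<partial>lborel)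
        = (\<integral>\<^sup>+\<alpha>. 0 \<partial>(lborel::real measure))"
      by (intro nn_integral_cong_AE) (auto simp: A_def indicator_def elim!: eventually_mono)
    then show ?thesis by simp
  qed
  have "AE l in lborel. l \<notin> B 1 \<union> B (- 1)"
    using finB by (intro AE_not_in countable_imp_null_set_lborel countable_finite) auto
  then have "(\<integral>\<^sup>+l\<in>{a<..<b}. (\<integral>\<^sup>+\<alpha>\<in>{0<..<pi}. ennreal (sin \<alpha>) * indicator ?E (?c (l, \<alpha>)) \<partial>lborel) \<partial>lborel)
      = (\<integral>\<^sup>+l. 0 \<partial>(lborel::real measure))"
  proof (intro nn_integral_cong_AE, elim eventually_mono)
    fix l assume l: "l \<notin> B 1 \<union> B (- 1)"
    show "(\<integral>\<^sup>+\<alpha>\<in>{0<..<pi}. ennreal (sin \<alpha>) * indicator ?E (?c (l, \<alpha>)) \<partial>lborel) * indicator {a<..<b} l = 0"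
      using inner[OF _ l] by (cases "l \<in> {a<..<b}") auto
  qed
  then have "emeasure \<mu> ?E = 0"
    using chart_formula[OF \<mu> f ab short meas] by simp
  then show ?thesis using meas by (intro null_setsI)
qed

end

text \<open>Charts cover the space of geodesics only locally. A countable dense set has points on
  both sides of any geodesic arbitrarily close to a point \<open>p\<close> of it; two points at
  distance less than \<open>norm p\<close> from \<open>p\<close> cannot be antipodal, so they span a
  chart.\<close>

lemma countable_sep_cover:
  obtains T where "countable T" "T \<subseteq> surface K"
    "\<And>g. g \<in> geodesics K \<Longrightarrow> \<exists>p\<in>T. \<exists>q\<in>T. g \<in> sep K p q \<and> (K > 0 \<longrightarrow> q \<noteq> - p)"
proof -
  obtain T where T: "countable T" "T \<subseteq> surface K" "surface K \<subseteq> closure T"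
    using separable[of "surface K"] by metis
  have "\<exists>p\<in>T. \<exists>q\<in>T. g \<in> sep K p q \<and> (K > 0 \<longrightarrow> q \<noteq> - p)" if g: "g \<in> geodesics K" for g
  proof -
    obtain p v w where f: "frame K p v w" "g = range (geo K p v)" using geodesicE[OF g] .
    define n where "n = nrm K g"
    have n: "n \<bullet> p = 0" "n \<bullet> v = 0" using nrm_range_geo[OF f] by (auto simp: n_def)
    have nw: "n \<bullet> w \<noteq> 0" using frame_orth_zero[OF f(1) n] nrm(1)[OF g] by (auto simp: n_def)
    have p0: "norm p > 0" using surface_nonzero[of p K] f by (simp add: frame_def)
    have close: "\<exists>x\<in>T. s * (n \<bullet> x) > 0 \<and> norm (x - p) < norm p" if s: "s = 1 \<or> s = - 1" for s :: real
    proof -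
      have "isCont (geo K p w) 0" using geo_has_deriv has_vector_derivative_continuous by blast
      then have "\<forall>\<^sub>F t in at 0. dist (geo K p w t) p < norm p"
        using p0 by (auto simp: isCont_def tendsto_iff)
      then obtain d where d: "d > 0" "\<And>t. t \<noteq> 0 \<Longrightarrow> \<bar>t\<bar> < d \<Longrightarrow> dist (geo K p w t) p < norm p"
        unfolding eventually_at by (auto simp: dist_norm)
      obtain e where e: "e > 0" "e < d" "K > 0 \<Longrightarrow> e < pi / sqrt K"
      proof (cases "K > 0")
        case True
        define P where "P = pi / sqrt K"
        have "P > 0" using True by (simp add: P_def)
        then show ?thesis using that[of "min (d / 2) (P / 2)"] d unfolding P_def[symmetric]
          by (simp add: min_less_iff_disj)
      next
        case False
        then show ?thesis using that[of "d / 2"] d by auto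
      qed
      have se: "sn K e > 0" using e by (intro sn_pos) auto
      define t where "t = (if s * (n \<bullet> w) > 0 then e else - e)"
      have "n \<bullet> geo K p w t = sn K t * (n \<bullet> w)" using n by (simp add: geo_def inner_add_right)
      then have pos: "s * (n \<bullet> geo K p w t) > 0"
        using se s nw by (auto simp: t_def zero_less_mult_iff mult_less_0_iff)
      define W where "W = {x. s * (n \<bullet> x) > 0} \<inter> ball p (norm p)"
      have "open W" unfolding W_def
        by (intro open_Int open_ball open_Collect_less continuous_intros)
      moreover have "geo K p w t \<in> W \<inter> closure T"
        using pos d(2)[of t] e geo_in_surface[OF frame_swap[OF f(1)]] T(3)
        by (auto simp: W_def t_def dist_commute split: if_splits)
      ultimately have "W \<inter> T \<noteq> {}" using open_Int_closure_eq_empty[of W T] by blast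
      then show ?thesis by (auto simp: W_def dist_norm norm_minus_commute)
    qed
    obtain x where x: "x \<in> T" "n \<bullet> x > 0" "norm (x - p) < norm p" using close[of 1] by auto
    obtain y where y: "y \<in> T" "n \<bullet> y < 0" "norm (y - p) < norm p" using close[of "- 1"] by auto
    have "y \<noteq> - x"
    proof
      assume "y = - x"
      then have "(x - p) + (y - p) = - (2 *\<^sub>R p)" by (simp add: scaleR_2)
      then have "2 * norm p = norm ((x - p) + (y - p))" by simp
      also have "\<dots> \<le> norm (x - p) + norm (y - p)" by (rule norm_triangle_ineq)
      finally show False using x y by simp
    qed
    moreover have "g \<in> sep K x y" using g x y by (simp add: sep_def n_def mult_pos_neg)
    ultimately show ?thesis using x y by blast
  qed
  then show ?thesis using that T by blast
qed

context convex_domain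
begin

lemma supporting_null:
  assumes \<mu>: "invariant_geodesic_measure K \<mu>"
  shows "supporting \<in> null_sets \<mu>"
proof -
  obtain T where T: "countable T" "T \<subseteq> surface K"
    and cover: "\<And>g. g \<in> geodesics K \<Longrightarrow> \<exists>p\<in>T. \<exists>q\<in>T. g \<in> sep K p q \<and> (K > 0 \<longrightarrow> q \<noteq> - p)"
    using countable_sep_cover[of K] by metis
  define I where "I = {(p, q) \<in> T \<times> T. K > 0 \<longrightarrow> q \<noteq> - p}"
  have null: "supporting \<inter> sep K p q \<in> null_sets \<mu>" if "(p, q) \<in> I" for p q
  proof (cases "p = q")
    case True
    then have "sep K p q = {}" by (auto simp: sep_def not_less)
    then show ?thesis by simp
  next
    case False
    have pq: "p \<in> surface K" "q \<in> surface K" "K > 0 \<Longrightarrow> q \<noteq> - p" using that T by (auto simp: I_def)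
    define d where "d = arc_of_chord K (chord K p q)"
    obtain v w where f: "frame K p v w" "geo K p v d = q" "d > 0" "K > 0 \<Longrightarrow> d < pi / sqrt K"
      unfolding d_def by (rule minimal_segment[OF pq(1,2) False]) (use pq(3) in auto)
    show ?thesis using supporting_chart_null[OF \<mu> f(1,3)] f by simp
  qed
  have "countable I" by (rule countable_subset[of _ "T \<times> T"]) (auto simp: I_def T)
  then have "(\<Union>(p, q)\<in>I. supporting \<inter> sep K p q) \<in> null_sets \<mu>"
    using null by (intro null_sets_UN') auto
  moreover have "supporting \<subseteq> (\<Union>(p, q)\<in>I. supporting \<inter> sep K p q)"
  proof
    fix g assume g: "g \<in> supporting"
    then have "g \<in> geodesics K" by (auto simp: supporting_def geodesics_meeting_def)
    then show "g \<in> (\<Union>(p, q)\<in>I. supporting \<inter> sep K p q)" using cover[of g] g by (auto simp: I_def)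
  qed
  ultimately show ?thesis
    using null_sets_subset supporting_measurable sets_invariant[OF \<mu>] by metis
qed

end

subsection \<open>Length as a limit of inscribed polygons\<close>

text \<open>For \<open>K < 0\<close> the form is indefinite, so this needs an argument: the arc
  between distinct points is positive, \<open>arsinh\<close> is odd, and \<open>sqrt\<close> has the
  sign of its argument, so the sign carries back to the form.\<close>

lemma chord_form_nonneg:
  assumes p: "p \<in> surface K" and q: "q \<in> surface K"
  shows "form K (q - p) (q - p) \<ge> 0"
proof (cases "K < 0 \<and> p \<noteq> q")
  case True
  then have K: "K < 0" and ne: "p \<noteq> q" by auto
  have "arc_of_chord K (chord K p q) > 0"
    by (rule minimal_segment[OF p q ne]) (use K in auto)
  then have "chord K p q > 0" using K by (simp add: arc_of_chord_def zero_less_divide_iff zero_less_mult_iff)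
  then show ?thesis by (simp add: chord_def)
next
  case False
  then consider "p = q" | "K \<ge> 0" by linarith
  then show ?thesis by cases (simp_all add: form_def sgn_real_def)
qed

text \<open>Caratheodory's form of the derivative at 0: arc and chord differ by a factor that tends
  to 1, with no exception for chords of length 0.\<close>

lemma arc_of_chord_factor: "\<exists>H. (\<forall>y. arc_of_chord K y = H y * y) \<and> isCont H 0 \<and> H 0 = 1"
  using arc_of_chord_has_deriv[of K] unfolding CARAT_DERIV by simp

text \<open>Both ends of the interval move, and \<open>t\<close> lies somewhere in it. The errors on
  the two sides of \<open>t\<close> are proportional to their own lengths, so their sum is
  proportional to the length of the whole interval.\<close>

lemma straddle_derivative:
  fixes c :: "real \<Rightarrow> 'a::real_normed_vector"
  assumes c: "(c has_vector_derivative d) (at t)"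
    and s: "\<And>k. s k \<le> t" "\<And>k. t \<le> r k" "\<And>k. s k < r k"
    and lim: "(\<lambda>k. r k - s k) \<longlonglongrightarrow> 0"
  shows "(\<lambda>k::nat. (1 / (r k - s k)) *\<^sub>R (c (r k) - c (s k))) \<longlonglongrightarrow> d"
proof (rule LIMSEQ_I)
  fix e :: real assume e: "e > 0"
  have "\<forall>e>0. \<exists>\<delta>>0. \<forall>y. norm (y - t) < \<delta> \<longrightarrow> norm (c y - c t - (y - t) *\<^sub>R d) \<le> e * norm (y - t)"
    using c unfolding has_vector_derivative_def has_derivative_at_alt by simp
  from this[rule_format, OF half_gt_zero[OF e]]
  have "\<exists>\<delta>>0. \<forall>y. norm (y - t) < \<delta> \<longrightarrow> norm (c y - c t - (y - t) *\<^sub>R d) \<le> e / 2 * norm (y - t)" .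
  then obtain \<delta> where \<delta>: "\<delta> > 0"
    "\<And>y. \<bar>y - t\<bar> < \<delta> \<Longrightarrow> norm (c y - c t - (y - t) *\<^sub>R d) \<le> e / 2 * \<bar>y - t\<bar>" by auto
  obtain k0 where k0: "\<And>k. k \<ge> k0 \<Longrightarrow> norm (r k - s k - 0) < \<delta>"
    using LIMSEQ_D[OF lim \<delta>(1)] by blast
  have "norm ((1 / (r k - s k)) *\<^sub>R (c (r k) - c (s k)) - d) < e" if "k \<ge> k0" for k
  proof -
    define h where "h = r k - s k"
    have h: "h > 0" "h < \<delta>" using s(3)[of k] k0[OF that] by (auto simp: h_def)
    have 1: "norm (c (r k) - c t - (r k - t) *\<^sub>R d) \<le> e / 2 * (r k - t)"
      using \<delta>(2)[of "r k"] s[of k] h by (auto simp: h_def)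
    have 2: "norm (c (s k) - c t - (s k - t) *\<^sub>R d) \<le> e / 2 * (t - s k)"
      using \<delta>(2)[of "s k"] s[of k] h by (auto simp: h_def)
    have "c (r k) - c (s k) - h *\<^sub>R d
        = (c (r k) - c t - (r k - t) *\<^sub>R d) - (c (s k) - c t - (s k - t) *\<^sub>R d)"
      by (simp add: h_def algebra_simps)
    then have "norm (c (r k) - c (s k) - h *\<^sub>R d)
        \<le> norm (c (r k) - c t - (r k - t) *\<^sub>R d) + norm (c (s k) - c t - (s k - t) *\<^sub>R d)"
      by (simp only: norm_triangle_ineq4)
    also have "\<dots> \<le> e / 2 * (r k - t) + e / 2 * (t - s k)"
      using 1 2 by (rule add_mono)
    also have "\<dots> = e / 2 * h" by (simp add: h_def field_simps)
    finally have 3: "norm (c (r k) - c (s k) - h *\<^sub>R d) \<le> e / 2 * h" .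
    have "(1 / h) *\<^sub>R (c (r k) - c (s k)) - d = (1 / h) *\<^sub>R (c (r k) - c (s k) - h *\<^sub>R d)"
      using h by (simp add: algebra_simps)
    then have "norm ((1 / h) *\<^sub>R (c (r k) - c (s k)) - d) = (1 / h) * norm (c (r k) - c (s k) - h *\<^sub>R d)"
      using h by simp
    also have "\<dots> \<le> (1 / h) * (e / 2 * h)" using 3 h by (intro mult_left_mono) auto
    also have "\<dots> = e / 2" using h by simp
    also have "\<dots> < e" using e by simp
    finally show ?thesis by (simp add: h_def)
  qed
  then show "\<exists>k0. \<forall>k\<ge>k0. norm ((1 / (r k - s k)) *\<^sub>R (c (r k) - c (s k)) - d) < e" by blast
qed

definition dyadic_arc :: "real \<Rightarrow> (real \<Rightarrow> real^3) \<Rightarrow> nat \<Rightarrow> nat \<Rightarrow> real" where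
  "dyadic_arc K c k i = arc_of_chord K (chord K (c (real i / 2^k)) (c (real (Suc i) / 2^k)))"

lemma sqrt_form_scaleR:
  assumes "a \<ge> 0"
  shows "sqrt (form K (a *\<^sub>R x) (a *\<^sub>R x)) = a * sqrt (form K x x)"
proof -
  have "form K (a *\<^sub>R x) (a *\<^sub>R x) = a\<^sup>2 * form K x x" by (simp add: form_simps power2_eq_square)
  then show ?thesis using assms by (simp add: real_sqrt_mult)
qed

text \<open>The index picks the dyadic interval containing \<open>t\<close>. Its chord divided by
  its length is the norm of a difference quotient straddling \<open>t\<close>, and replacing chord
  by arc costs a factor tending to 1.\<close>

lemma dyadic_arc_limit:
  assumes c: "(c has_vector_derivative d) (at t)" and t: "0 \<le> t"
  shows "(\<lambda>k. 2^k * dyadic_arc K c k (nat \<lfloor>2^k * t\<rfloor>)) \<longlonglongrightarrow> sqrt (form K d d)"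
proof -
  define i where "i = (\<lambda>k. nat \<lfloor>2^k * t\<rfloor>)"
  define s where "s = (\<lambda>k. real (i k) / 2^k)"
  define r where "r = (\<lambda>k. real (Suc (i k)) / 2^k)"
  have i: "real (i k) \<le> 2^k * t" "2^k * t < real (Suc (i k))" for k
  proof -
    have "real (i k) = real_of_int \<lfloor>2^k * t\<rfloor>" using t by (simp add: i_def)
    then show "real (i k) \<le> 2^k * t" "2^k * t < real (Suc (i k))"
      using floor_correct[of "2^k * t"] unfolding of_nat_Suc by linarith+
  qed
  have rs: "r k - s k = (1 / 2)^k" for k
    by (simp add: r_def s_def field_simps power_one_over)
  have half: "(0::real) \<le> 1 / 2" by simp
  have "(\<lambda>k. (1 / (r k - s k)) *\<^sub>R (c (r k) - c (s k))) \<longlonglongrightarrow> d"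
  proof (rule straddle_derivative[OF c])
    show "s k \<le> t" for k using i(1)[of k] by (simp add: s_def field_simps)
    show "t \<le> r k" for k using i(2)[of k] by (simp add: r_def field_simps)
    show "s k < r k" for k using rs[of k] by (metis diff_gt_0_iff_gt zero_less_power zero_less_divide_1_iff zero_less_numeral)
    show "(\<lambda>k. r k - s k) \<longlonglongrightarrow> 0" unfolding rs by (rule LIMSEQ_power_zero) simp
  qed
  then have "(\<lambda>k. sqrt (form K ((1 / (r k - s k)) *\<^sub>R (c (r k) - c (s k)))
      ((1 / (r k - s k)) *\<^sub>R (c (r k) - c (s k))))) \<longlonglongrightarrow> sqrt (form K d d)"
    by (intro tendsto_real_sqrt tendsto_form)
  also have "(\<lambda>k. sqrt (form K ((1 / (r k - s k)) *\<^sub>R (c (r k) - c (s k)))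
      ((1 / (r k - s k)) *\<^sub>R (c (r k) - c (s k))))) = (\<lambda>k. 2^k * chord K (c (s k)) (c (r k)))"
    unfolding rs sqrt_form_scaleR[OF zero_le_divide_1_iff[THEN iffD2, OF zero_le_power[OF half]]]
    by (simp add: chord_def power_one_over)
  finally have lim: "(\<lambda>k. 2^k * chord K (c (s k)) (c (r k))) \<longlonglongrightarrow> sqrt (form K d d)" .
  have "(\<lambda>k. (1 / 2)^k * (2^k * chord K (c (s k)) (c (r k)))) \<longlonglongrightarrow> 0 * sqrt (form K d d)"
    by (intro tendsto_mult lim LIMSEQ_power_zero) simp
  then have ch0: "(\<lambda>k. chord K (c (s k)) (c (r k))) \<longlonglongrightarrow> 0"
    by (simp add: power_one_over)
  obtain H where H: "\<And>y. arc_of_chord K y = H y * y" "isCont H 0" "H 0 = 1"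
    using arc_of_chord_factor[of K] by blast
  have "(\<lambda>k. H (chord K (c (s k)) (c (r k)))) \<longlonglongrightarrow> 1"
    using isCont_tendsto_compose[OF H(2) ch0] H(3) by simp
  from tendsto_mult[OF this lim]
  have "(\<lambda>k. 2^k * arc_of_chord K (chord K (c (s k)) (c (r k)))) \<longlonglongrightarrow> sqrt (form K d d)"
    by (simp add: H(1) mult_ac)
  then show ?thesis by (simp add: dyadic_arc_def s_def r_def i_def)
qed

text \<open>The sum of arcs is the integral of a step function with value
  \<open>2^k * dyadic_arc K c k i\<close> on each dyadic interval. It tends to the speed almost
  everywhere, and the Lipschitz bound provides the dominating constant.\<close>

lemma curve_length_dyadic:
  assumes surf: "\<And>t. t \<in> {0..1} \<Longrightarrow> c t \<in> surface K"
    and lip: "\<And>s t. s \<in> {0..1} \<Longrightarrow> t \<in> {0..1} \<Longrightarrow> norm (c t - c s) \<le> B * \<bar>t - s\<bar>"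
    and S: "finite S" and der: "\<And>t. t \<in> {0<..<1} - S \<Longrightarrow>
      (c has_vector_derivative vector_derivative c (at t)) (at t)"
    and nonneg: "\<And>k i. k \<ge> k1 \<Longrightarrow> i < 2^k \<Longrightarrow> dyadic_arc K c k i \<ge> 0"
  shows "(\<lambda>k. ennreal (\<Sum>i<2^k. dyadic_arc K c k i)) \<longlonglongrightarrow> curve_length K c"
proof -
  define I where "I = (\<lambda>k i::nat. {real i / 2^k ..< real (Suc i) / 2^k})"
  define \<phi> where "\<phi> = (\<lambda>k t. \<Sum>i<2^k. ennreal (2^k * dyadic_arc K c k i) * indicator (I k i) t)"
  define \<psi> where "\<psi> = (\<lambda>t. ennreal (sqrt (form K (vector_derivative c (at t)) (vector_derivative c (at t))))
      * indicator {0..1} t)"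
  have B: "B \<ge> 0" using lip[of 0 1] norm_ge_zero[of "c 1 - c 0"] by (auto simp del: norm_ge_zero)
  have int_\<phi>: "(\<integral>\<^sup>+t. \<phi> k t \<partial>lborel) = ennreal (\<Sum>i<2^k. dyadic_arc K c k i)" if "k \<ge> k1" for k
  proof -
    have "(\<integral>\<^sup>+t. \<phi> k t \<partial>lborel) = (\<Sum>i<2^k. ennreal (2^k * dyadic_arc K c k i) * emeasure lborel (I k i))"
      unfolding \<phi>_def by (subst nn_integral_sum) (auto simp: I_def nn_integral_cmult_indicator)
    also have "\<dots> = (\<Sum>i<2^k. ennreal (dyadic_arc K c k i))"
    proof (rule sum.cong[OF refl])
      fix i assume "i \<in> {..<2^k::nat}"
      then have nn: "dyadic_arc K c k i \<ge> 0" using nonneg that by simp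
      have "real i / 2^k \<le> real (Suc i) / 2^k" by (simp add: divide_right_mono)
      then have "emeasure lborel (I k i) = ennreal (1 / 2^k)"
        by (simp add: I_def diff_divide_distrib[symmetric])
      then show "ennreal (2^k * dyadic_arc K c k i) * emeasure lborel (I k i) = ennreal (dyadic_arc K c k i)"
        using nn by (simp flip: ennreal_mult)
    qed
    also have "\<dots> = ennreal (\<Sum>i<2^k. dyadic_arc K c k i)"
      using nonneg that by (intro sum_ennreal) auto
    finally show ?thesis .
  qed
  have mem_I: "t \<in> I k i \<longleftrightarrow> i = nat \<lfloor>2^k * t\<rfloor>" if "0 \<le> t" for t k i
  proof -
    have "t \<in> I k i \<longleftrightarrow> real i \<le> 2^k * t \<and> 2^k * t < real i + 1"
      by (auto simp: I_def field_simps)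
    also have "\<dots> \<longleftrightarrow> \<lfloor>2^k * t\<rfloor> = int i" by (auto simp: floor_eq_iff)
    also have "\<dots> \<longleftrightarrow> i = nat \<lfloor>2^k * t\<rfloor>" using that by auto
    finally show ?thesis .
  qed
  have idx: "nat \<lfloor>2^k * t\<rfloor> < 2^k" if "0 \<le> t" "t < 1" for t :: real and k
  proof -
    have "2^k * t < 2^k" using that by simp
    then have "\<lfloor>2^k * t\<rfloor> < 2^k" by (simp add: floor_less_iff)
    then show ?thesis using that by (simp add: nat_less_iff)
  qed
  have \<phi>_eq: "\<phi> k t = ennreal (2^k * dyadic_arc K c k (nat \<lfloor>2^k * t\<rfloor>))" if "0 \<le> t" "t < 1" for t k
  proof -
    have "\<phi> k t = (\<Sum>i<2^k. if i = nat \<lfloor>2^k * t\<rfloor> then ennreal (2^k * dyadic_arc K c k i) else 0)"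
      unfolding \<phi>_def using mem_I[OF that(1)] by (intro sum.cong) (auto simp: indicator_def)
    then show ?thesis using idx[OF that] by simp
  qed
  have \<phi>_out: "\<phi> k t = 0" if "t < 0 \<or> t > 1" for k t
  proof -
    have "t \<notin> I k i" if "i < 2^k" for i
    proof
      assume t: "t \<in> I k i"
      have "0 \<le> real i / 2^k" by simp
      moreover have "real (Suc i) \<le> 2^k" using that by (metis Suc_leI of_nat_le_iff of_nat_numeral of_nat_power)
      then have "real (Suc i) / 2^k \<le> 1" by simp
      moreover have "real i / 2^k \<le> t" "t < real (Suc i) / 2^k" using t by (auto simp: I_def)
      ultimately show False using \<open>t < 0 \<or> t > 1\<close> by linarith
    qed
    then show ?thesis unfolding \<phi>_def by (intro sum.neutral) auto
  qed
  have "AE t in lborel. t \<notin> S \<union> {0, 1}"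
    using S by (intro AE_not_in countable_imp_null_set_lborel countable_finite) auto
  then have conv: "AE t in lborel. (\<lambda>k. \<phi> k t) \<longlonglongrightarrow> \<psi> t"
  proof (rule eventually_mono)
    fix t assume t: "t \<notin> S \<union> {0, 1}"
    show "(\<lambda>k. \<phi> k t) \<longlonglongrightarrow> \<psi> t"
    proof (cases "t \<in> {0<..<1}")
      case True
      then have "(\<lambda>k. 2^k * dyadic_arc K c k (nat \<lfloor>2^k * t\<rfloor>))
          \<longlonglongrightarrow> sqrt (form K (vector_derivative c (at t)) (vector_derivative c (at t)))"
        using t by (intro dyadic_arc_limit der) auto
      then show ?thesis using True \<phi>_eq by (simp add: \<psi>_def tendsto_ennrealI)
    next
      case False
      then have "t < 0 \<or> t > 1" using t by auto
      then show ?thesis using \<phi>_out by (auto simp: \<psi>_def)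
    qed
  qed
  obtain H where H: "\<And>y. arc_of_chord K y = H y * y" "isCont H 0" "H 0 = 1"
    using arc_of_chord_factor[of K] by blast
  \<comment> \<open>Any bound larger than \<open>H 0 = 1\<close> would serve; this 2 reappears in
    the dominating constant \<open>2 * B\<close>.\<close>
  have "\<forall>\<^sub>F y in at 0. H y < 2"
    using H(2,3) by (intro order_tendstoD) (auto simp: isCont_def)
  then obtain \<delta> where \<delta>: "\<delta> > 0" "\<And>y. \<bar>y\<bar> < \<delta> \<Longrightarrow> H y \<le> 2"
    unfolding eventually_at using H(3) by (auto simp: dist_norm) (metis less_imp_le one_le_numeral)
  have "(\<lambda>k. B * (1 / 2)^k) \<longlonglongrightarrow> B * 0" by (intro tendsto_intros LIMSEQ_power_zero) simp
  then have "\<forall>\<^sub>F k in sequentially. B * (1 / 2)^k < \<delta>"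
    using \<delta>(1) by (intro order_tendstoD(2)) auto
  then obtain k0 where k0: "\<And>k. k \<ge> k0 \<Longrightarrow> B * (1 / 2)^k < \<delta>"
    unfolding eventually_sequentially by blast
  have bound: "2^k * dyadic_arc K c k i \<le> 2 * B" if k: "k \<ge> k0" and i: "i < 2^k" for k i
  proof -
    define y where "y = chord K (c (real i / 2^k)) (c (real (Suc i) / 2^k))"
    have "real (Suc i) \<le> 2^k" using i by (metis Suc_leI of_nat_le_iff of_nat_numeral of_nat_power)
    then have in01: "real i / 2^k \<in> {0..1}" "real (Suc i) / 2^k \<in> {0..1}" using i by auto
    have y0: "y \<ge> 0" using chord_form_nonneg[OF surf surf] in01 by (simp add: y_def chord_def)
    have "y \<le> norm (c (real (Suc i) / 2^k) - c (real i / 2^k))"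
      unfolding y_def chord_def by (rule real_le_lsqrt) (auto intro: form_le_norm)
    also have "\<dots> \<le> B * \<bar>real (Suc i) / 2^k - real i / 2^k\<bar>" by (rule lip[OF in01])
    also have "\<bar>real (Suc i) / 2^k - real i / 2^k\<bar> = (1 / 2)^k"
      by (simp add: diff_divide_distrib[symmetric] power_one_over)
    finally have yB: "y \<le> B * (1 / 2)^k" .
    then have "H y \<le> 2" using \<delta>(2)[of y] k0[OF k] y0 by auto
    then have "arc_of_chord K y \<le> 2 * y" unfolding H(1) using y0 by (intro mult_right_mono)
    also have "\<dots> \<le> 2 * (B * (1 / 2)^k)" using yB by simp
    finally have "2^k * arc_of_chord K y \<le> 2^k * (2 * (B * (1 / 2)^k))" by (intro mult_left_mono) auto
    also have "\<dots> = 2 * B" by (simp add: power_one_over)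
    finally show ?thesis by (simp add: dyadic_arc_def y_def)
  qed
  have meas: "\<phi> k \<in> borel_measurable lborel" for k
    unfolding \<phi>_def I_def by measurable
  \<comment> \<open>The shift makes both kinds of index large enough: from \<open>k0\<close> on the
    bound holds, from \<open>k1\<close> on the arcs are nonnegative.\<close>
  define u where "u = (\<lambda>k. \<phi> (k + (k0 + k1)))"
  \<comment> \<open>\<open>\<psi>\<close> is only an almost everywhere limit, and
    \<open>lborel\<close> is not complete, so its measurability is not at hand. The lower limit is
    measurable and agrees with it almost everywhere.\<close>
  define u' where "u' = (\<lambda>t. liminf (\<lambda>k. u k t))"
  have convu: "AE t in lborel. (\<lambda>k. u k t) \<longlonglongrightarrow> \<psi> t"
    using conv unfolding u_def by (rule eventually_mono) (rule LIMSEQ_ignore_initial_segment)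
  have u'\<psi>: "AE t in lborel. u' t = \<psi> t"
    using convu by (rule eventually_mono) (auto simp: u'_def intro!: lim_imp_Liminf)
  have "(\<lambda>k. \<integral>\<^sup>+t. u k t \<partial>lborel) \<longlonglongrightarrow> (\<integral>\<^sup>+t. u' t \<partial>lborel)"
  proof (rule nn_integral_dominated_convergence[where w = "\<lambda>t. ennreal (2 * B) * indicator {0..1} t"])
    show "u k \<in> borel_measurable lborel" for k using meas by (simp add: u_def)
    then show "u' \<in> borel_measurable lborel" unfolding u'_def by measurable
    show "AE t in lborel. u k t \<le> ennreal (2 * B) * indicator {0..1} t" for k
      using AE_lborel_singleton[of "1::real"]
    proof (rule eventually_mono)
      fix t :: real assume "t \<noteq> 1"
      show "u k t \<le> ennreal (2 * B) * indicator {0..1} t"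
      proof (cases "0 \<le> t \<and> t < 1")
        case True
        then show ?thesis using \<phi>_eq bound[OF _ idx] by (auto simp: u_def intro!: ennreal_leI)
      next
        case False
        then show ?thesis using \<phi>_out[of t] \<open>t \<noteq> 1\<close> by (auto simp: u_def)
      qed
    qed
    show "(\<integral>\<^sup>+t. ennreal (2 * B) * indicator {0..1::real} t \<partial>lborel) < \<infinity>"
      by (subst nn_integral_cmult_indicator) (auto simp: ennreal_mult_less_top)
    show "AE t in lborel. (\<lambda>k. u k t) \<longlonglongrightarrow> u' t"
      using convu u'\<psi> by eventually_elim auto
  qed simp_all
  moreover have "(\<integral>\<^sup>+t. u' t \<partial>lborel) = curve_length K c"
    unfolding curve_length_def using u'\<psi> by (intro nn_integral_cong_AE) (auto simp: \<psi>_def)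
  moreover have "(\<integral>\<^sup>+t. u k t \<partial>lborel) = ennreal (\<Sum>i<2^(k + (k0 + k1)). dyadic_arc K c (k + (k0 + k1)) i)" for k
    unfolding u_def by (rule int_\<phi>) simp
  ultimately have "(\<lambda>k. ennreal (\<Sum>i<2^(k + (k0 + k1)). dyadic_arc K c (k + (k0 + k1)) i)) \<longlonglongrightarrow> curve_length K c"
    by simp
  then show ?thesis by (rule LIMSEQ_offset)
qed

subsection \<open>Regularity of the boundary curve\<close>

text \<open>The mean value inequality with finitely many corners, by integrating the derivative. The
  result is a single regularity statement for both kinds of boundary curve.\<close>

lemma lipschitz_of_bounded_derivative:
  fixes c :: "real \<Rightarrow> 'a::euclidean_space"
  assumes cont: "continuous_on {0..1} c" and S: "finite S"
    and der: "\<And>t. t \<in> {0<..<1} - S \<Longrightarrow> (c has_vector_derivative c' t) (at t)"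
    and bd: "\<And>t. t \<in> {0<..<1} - S \<Longrightarrow> norm (c' t) \<le> B" and B: "0 \<le> B"
    and st: "s \<in> {0..1}" "t \<in> {0..1}"
  shows "norm (c t - c s) \<le> B * \<bar>t - s\<bar>"
proof -
  have le: "norm (c t - c s) \<le> B * (t - s)" if st: "0 \<le> s" "s \<le> t" "t \<le> 1" for s t
  proof -
    define g where "g = (\<lambda>x. if x \<in> {0<..<1} - S then c' x else 0)"
    have "(g has_integral (c t - c s)) {s..t}"
    proof (rule fundamental_theorem_of_calculus_interior_strong)
      show "finite (S \<union> {0, 1})" using S by simp
      show "continuous_on {s..t} c" using cont by (rule continuous_on_subset) (use st in auto)
      fix x assume "x \<in> {s<..<t} - (S \<union> {0, 1})"
      then have "x \<in> {0<..<1} - S" using st by auto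
      then show "(c has_vector_derivative g x) (at x)" using der by (simp add: g_def)
    qed (use st in auto)
    then have "norm (c t - c s) \<le> B * measure lborel {s..t}"
      by (rule has_integral_bound_real[OF B finite.emptyI]) (use bd B in \<open>auto simp: g_def\<close>)
    then show ?thesis using st by simp
  qed
  show ?thesis using le[of s t] le[of t s] st by (cases "s \<le> t") (auto simp: norm_minus_commute)
qed

lemma C1_regular:
  assumes "C1_closed_curve c"
  obtains B where "0 \<le> B"
    "\<And>t. t \<in> {0<..<1} \<Longrightarrow> (c has_vector_derivative vector_derivative c (at t)) (at t)"
    "\<And>t. t \<in> {0<..<1} \<Longrightarrow> norm (vector_derivative c (at t)) \<le> B"
proof -
  have c: "c C1_differentiable_on UNIV" using assms by (simp add: C1_closed_curve_def)
  then have "continuous_on {0..1} (\<lambda>x. vector_derivative c (at x))"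
    unfolding C1_differentiable_on_eq by (auto intro: continuous_on_subset)
  then have "bounded ((\<lambda>x. vector_derivative c (at x)) ` {0..1})"
    by (intro compact_imp_bounded compact_continuous_image) auto
  then obtain B where B: "B > 0" "\<And>x. x \<in> {0..1} \<Longrightarrow> norm (vector_derivative c (at x)) \<le> B"
    by (auto simp: bounded_pos)
  moreover have "(c has_vector_derivative vector_derivative c (at t)) (at t)" for t
    using c unfolding C1_differentiable_on_eq by (simp add: vector_derivative_works)
  ultimately show ?thesis using that[of B] by auto
qed

text \<open>On each side the curve is an affine reparametrisation of some \<open>geo\<close>, whose
  derivative is continuous up to the break points and hence bounded.\<close>

lemma polygon_regular:
  assumes "geodesic_polygon K c"
  obtains B S where "0 \<le> B" "finite S"
    "\<And>t. t \<in> {0<..<1} - S \<Longrightarrow> (c has_vector_derivative vector_derivative c (at t)) (at t)"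
    "\<And>t. t \<in> {0<..<1} - S \<Longrightarrow> norm (vector_derivative c (at t)) \<le> B"
proof -
  obtain n :: nat and \<tau> where \<tau>: "\<tau> 0 = 0" "\<tau> n = 1" and
    seg: "\<And>i. i < n \<Longrightarrow> \<exists>\<sigma> v. unit_geodesic K \<sigma> \<and> v > 0 \<and> (\<forall>t\<in>{\<tau> i..\<tau> (Suc i)}. c t = \<sigma> (v * (t - \<tau> i)))"
    using assms unfolding geodesic_polygon_def by blast
  have "\<exists>p u v. \<forall>t\<in>{\<tau> i..\<tau> (Suc i)}. c t = geo K p u (v * (t - \<tau> i))" if i: "i < n" for i
  proof -
    obtain \<sigma> v where \<sigma>: "unit_geodesic K \<sigma>" "\<forall>t\<in>{\<tau> i..\<tau> (Suc i)}. c t = \<sigma> (v * (t - \<tau> i))"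
      using seg[OF i] by blast
    obtain u w where "\<sigma> = geo K (\<sigma> 0) u" by (rule unit_geodesic_eq_geo[OF \<sigma>(1)])
    then show ?thesis using \<sigma>(2) by metis
  qed
  then obtain p u v where c: "\<And>i t. i < n \<Longrightarrow> t \<in> {\<tau> i..\<tau> (Suc i)} \<Longrightarrow> c t = geo K (p i) (u i) (v i * (t - \<tau> i))"
    by metis
  define d where "d = (\<lambda>i t. v i *\<^sub>R geo_vel K (p i) (u i) (v i * (t - \<tau> i)))"
  have der: "((\<lambda>t. geo K (p i) (u i) (v i * (t - \<tau> i))) has_vector_derivative d i t) (at t)" for i t
  proof -
    have "((\<lambda>t. v i * (t - \<tau> i)) has_real_derivative v i) (at t)"
      by (auto intro!: derivative_eq_intros)
    then have "((\<lambda>t. v i * (t - \<tau> i)) has_vector_derivative v i) (at t)"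
      by (simp add: has_real_derivative_iff_has_vector_derivative)
    from vector_diff_chain_at[OF this geo_has_deriv] show ?thesis by (simp add: d_def o_def)
  qed
  have cvel: "continuous_on S (geo_vel K p v)" for S p v
    by (meson continuous_at_imp_continuous_on geo_vel_has_deriv has_vector_derivative_continuous)
  have "continuous_on {\<tau> i..\<tau> (Suc i)} (d i)" for i
    unfolding d_def by (intro continuous_intros continuous_on_compose2[OF cvel[of UNIV]]) auto
  then have "bounded (\<Union>i\<in>{..<n}. d i ` {\<tau> i..\<tau> (Suc i)})"
    by (intro bounded_UN ballI compact_imp_bounded compact_continuous_image) auto
  then obtain B where B: "B > 0" "\<And>i t. i < n \<Longrightarrow> t \<in> {\<tau> i..\<tau> (Suc i)} \<Longrightarrow> norm (d i t) \<le> B"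
    unfolding bounded_pos by auto
  have main: "(c has_vector_derivative vector_derivative c (at t)) (at t) \<and> norm (vector_derivative c (at t)) \<le> B"
    if t: "t \<in> {0<..<1} - \<tau> ` {..n}" for t
  proof -
    obtain i where i: "i < n" "\<not> t < \<tau> i" "t < \<tau> (Suc i)"
      using ex_least_nat_less[of "\<lambda>j. t < \<tau> j" n] t \<tau> by auto
    have ti: "t \<in> {\<tau> i<..<\<tau> (Suc i)}" using i t by (auto simp: less_le)
    have "(c has_vector_derivative d i t) (at t)"
      using der by (rule has_vector_derivative_transform_within_open[where S = "{\<tau> i<..<\<tau> (Suc i)}"])
        (use ti c[OF i(1)] in auto)
    then show ?thesis using B(2)[OF i(1), of t] ti vector_derivative_at by fastforce
  qed
  show ?thesis by (rule that[of B "\<tau> ` {..n}"]) (use main B in auto)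
qed

subsection \<open>Counting crossings of inscribed polygons\<close>

definition sign_changes :: "(real \<Rightarrow> real) \<Rightarrow> nat \<Rightarrow> nat set" where
  "sign_changes f k = {i. i < 2^k \<and> f (real i / 2^k) * f (real (Suc i) / 2^k) < 0}"

lemma finite_sign_changes: "finite (sign_changes f k)"
  by (simp add: sign_changes_def)

text \<open>Each sign change encloses a zero in its own open dyadic interval, and these intervals
  are disjoint. The zeros therefore avoid 0 and 1, where a closed curve fails to be
  injective.\<close>

lemma card_sign_changes_le:
  assumes cont: "continuous_on {0..1} f"
    and zeros: "\<And>x y z. x \<in> {0<..<1} \<Longrightarrow> y \<in> {0<..<1} \<Longrightarrow> z \<in> {0<..<1} \<Longrightarrow>
      f x = 0 \<Longrightarrow> f y = 0 \<Longrightarrow> f z = 0 \<Longrightarrow> x = y \<or> x = z \<or> y = z"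
  shows "card (sign_changes f k) \<le> 2"
proof (rule ccontr)
  have "\<exists>z. real i / 2^k < z \<and> z < real (Suc i) / 2^k \<and> f z = 0 \<and> z \<in> {0<..<1}"
    if i: "i \<in> sign_changes f k" for i
  proof -
    have "real (Suc i) \<le> 2^k" using i unfolding sign_changes_def
      by (metis (mono_tags, lifting) Suc_leI mem_Collect_eq of_nat_le_iff of_nat_numeral of_nat_power)
    then have le1: "real (Suc i) / 2^k \<le> 1" by simp
    have ge0: "0 \<le> real i / 2^k" by simp
    have lt: "real i / 2^k < real (Suc i) / 2^k" by (simp add: divide_strict_right_mono)
    have "continuous_on {real i / 2^k .. real (Suc i) / 2^k} f"
      using cont by (rule continuous_on_subset) (use le1 ge0 in auto)
    moreover have "f (real i / 2^k) * f (real (Suc i) / 2^k) < 0" using i by (simp add: sign_changes_def)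
    ultimately obtain z where "real i / 2^k < z" "z < real (Suc i) / 2^k" "f z = 0"
      using sign_change_zero lt by blast
    moreover from this have "0 < z" "z < 1" using le1 ge0 by linarith+
    ultimately show ?thesis by auto
  qed
  then obtain z where z: "\<And>i. i \<in> sign_changes f k \<Longrightarrow>
    real i / 2^k < z i \<and> z i < real (Suc i) / 2^k \<and> f (z i) = 0 \<and> z i \<in> {0<..<1}" by metis
  have zi: "z i \<noteq> z j" if "i \<in> sign_changes f k" "j \<in> sign_changes f k" "i < j" for i j
  proof -
    have "real (Suc i) / 2^k \<le> real j / 2^k" using that(3) by (simp add: divide_right_mono)
    then show ?thesis using z[OF that(1)] z[OF that(2)] by linarith
  qed
  then have zne: "z i \<noteq> z j" if "i \<in> sign_changes f k" "j \<in> sign_changes f k" "i \<noteq> j" for i j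
    using that by (cases i j rule: linorder_cases) force+
  assume "\<not> card (sign_changes f k) \<le> 2"
  then have "3 \<le> card (sign_changes f k)" by simp
  then obtain B where B: "B \<subseteq> sign_changes f k" "card B = 3"
    by (meson obtain_subset_with_card_n)
  then obtain i j l where "i \<noteq> j" "i \<noteq> l" "j \<noteq> l" "i \<in> B" "j \<in> B" "l \<in> B"
    by (auto simp: card_3_iff)
  then show False using zeros[of "z i" "z j" "z l"] z[of i] z[of j] z[of l] zne B(1) by blast
qed

lemma discrete_sign_change:
  fixes b :: "nat \<Rightarrow> real"
  assumes "m < n" "\<And>i. m \<le> i \<Longrightarrow> i \<le> n \<Longrightarrow> b i \<noteq> 0" "b m * b n < 0"
  obtains i where "m \<le> i" "i < n" "b i * b (Suc i) < 0"
proof -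
  have "\<exists>i\<ge>m. i < n \<and> b i * b (Suc i) < 0"
  proof (rule ccontr)
    assume "\<not> ?thesis"
    then have no: "b i * b (Suc i) \<ge> 0" if "m \<le> i" "i < n" for i using that not_less by blast
    have "b m * b j > 0" if "m \<le> j" "j \<le> n" for j
      using that
    proof (induction j rule: dec_induct)
      case base
      then show ?case using assms(2)[of m] by (simp add: zero_less_mult_iff) linarith
    next
      case (step j)
      then have "b m * b j > 0" "b j * b (Suc j) \<ge> 0" "b (Suc j) \<noteq> 0" using no[of j] assms(2)[of "Suc j"] by auto
      then show ?case by (auto simp: zero_less_mult_iff zero_le_mult_iff)
    qed
    then show False using assms(1,3) by (metis less_imp_le not_less order_refl)
  qed
  then show ?thesis using that by blast
qed

text \<open>On a closed curve the sign must change on the way to vertex \<open>j\<close> and change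
  back on the way home. Nonzero values at all vertices keep both changes from hiding at a
  vertex.\<close>

lemma card_sign_changes_ge:
  assumes nz: "\<And>i. i \<le> 2^k \<Longrightarrow> f (real i / 2^k) \<noteq> 0" and loop: "f 0 = f 1"
    and j: "j \<le> 2^k" "f (real j / 2^k) * f 0 < 0"
  shows "card (sign_changes f k) \<ge> 2"
proof -
  define b where "b = (\<lambda>i::nat. f (real i / 2^k))"
  have b0: "b 0 = f 0" "b (2^k) = f 0" using loop by (simp_all add: b_def)
  have bj: "b j * f 0 < 0" using j by (simp add: b_def)
  have "\<not> f 0 * f 0 < 0" by (simp add: not_less)
  then have j0: "0 < j" "j < 2^k" using j(1) bj b0 by (cases "j = 0"; cases "j = 2^k"; auto)+
  obtain i1 where i1: "i1 < j" "b i1 * b (Suc i1) < 0"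
    by (rule discrete_sign_change[of 0 j b]) (use j0 nz j bj b0 in \<open>auto simp: b_def mult.commute\<close>)
  obtain i2 where i2: "j \<le> i2" "i2 < 2^k" "b i2 * b (Suc i2) < 0"
    by (rule discrete_sign_change[of j "2^k" b]) (use j0 nz j bj b0 in \<open>auto simp: b_def\<close>)
  have "{i1, i2} \<subseteq> sign_changes f k"
    using i1 i2 j0 unfolding sign_changes_def b_def by auto
  moreover have "card {i1, i2} = 2" using i1 i2 by auto
  ultimately show ?thesis using card_mono[OF finite_sign_changes] by metis
qed

lemma eventually_dyadic_near:
  fixes P :: "real \<Rightarrow> bool"
  assumes t: "0 \<le> t" "t \<le> 1" and \<delta>: "\<delta> > 0" "\<And>s. s \<in> {0..1} \<Longrightarrow> \<bar>s - t\<bar> < \<delta> \<Longrightarrow> P s"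
  shows "\<forall>\<^sub>F k::nat in sequentially. \<exists>j::nat. j \<le> 2^k \<and> P (real j / 2^k)"
proof -
  have "(\<lambda>k::nat. (1 / 2 :: real)^k) \<longlonglongrightarrow> 0" by (rule LIMSEQ_power_zero) simp
  then have "\<forall>\<^sub>F k::nat in sequentially. (1 / 2 :: real)^k < \<delta>" using \<delta>(1) by (rule order_tendstoD)
  then show ?thesis
  proof (rule eventually_mono)
    fix k :: nat assume k: "(1 / 2 :: real)^k < \<delta>"
    define j where "j = nat \<lfloor>2^k * t\<rfloor>"
    have jr: "real j = real_of_int \<lfloor>2^k * t\<rfloor>" using t by (simp add: j_def)
    have j: "real j \<le> 2^k * t" "2^k * t < real j + 1"
      using floor_correct[of "2^k * t"] unfolding jr by linarith+
    have "2^k * t \<le> 2^k" using t by simp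
    then have "real j \<le> 2^k" using j(1) by linarith
    then have j2: "j \<le> 2^k" by simp
    have a: "real j / 2^k \<le> t" using j(1) by (simp add: field_simps)
    have "t < real j / 2^k + (1 / 2)^k" using j(2) by (simp add: field_simps power_one_over)
    then have "\<bar>real j / 2^k - t\<bar> < \<delta>" using a k by linarith
    moreover have "real j / 2^k \<in> {0..1}" using j2 by auto
    ultimately show "\<exists>j::nat. j \<le> 2^k \<and> P (real j / 2^k)" using j2 \<delta>(2) by blast
  qed
qed

section \<open>Crossing counts of polygons inscribed in the boundary\<close>

locale convex_domain_curve = convex_domain +
  fixes c :: "real \<Rightarrow> real^3"
  assumes cont: "continuous_on {0..1} c" and loop: "c 0 = c 1"
    and inj: "\<And>s t. s \<in> {0<..<1} \<Longrightarrow> t \<in> {0<..<1} \<Longrightarrow> c s = c t \<Longrightarrow> s = t"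
    and image: "c ` {0..1} = surface_boundary K D"
begin

text \<open>As a sum of indicators the count integrates term by term over \<mu>; for a fixed
  geodesic it is the number of sign changes of one real function along the curve.\<close>

definition crossings :: "nat \<Rightarrow> (real^3) set \<Rightarrow> ennreal" where
  "crossings k g = (\<Sum>i<2^k. indicator (sep K (c (real i / 2^k)) (c (real (Suc i) / 2^k))) g)"

lemma c_surface: "t \<in> {0..1} \<Longrightarrow> c t \<in> surface K"
  and c_D: "t \<in> {0..1} \<Longrightarrow> c t \<in> D"
  using image boundary_subset D_subset_surface by blast+

lemma dyadic_in_unit: "i \<le> 2^k \<Longrightarrow> real i / 2^k \<in> {0..1}"
  by (auto simp: divide_le_eq)

lemma crossings_eq:
  assumes g: "g \<in> geodesics K"
  shows "crossings k g = of_nat (card (sign_changes (\<lambda>t. nrm K g \<bullet> c t) k))"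
proof -
  have "crossings k g = (\<Sum>i\<in>{..<2^k}. if i \<in> sign_changes (\<lambda>t. nrm K g \<bullet> c t) k then 1 else 0)"
    unfolding crossings_def
    by (intro sum.cong) (auto simp: indicator_def sep_def sign_changes_def g)
  also have "\<dots> = (\<Sum>i\<in>{..<2^k} \<inter> sign_changes (\<lambda>t. nrm K g \<bullet> c t) k. 1)"
    by (rule sum.inter_restrict[symmetric]) simp
  also have "{..<2^k} \<inter> sign_changes (\<lambda>t. nrm K g \<bullet> c t) k = sign_changes (\<lambda>t. nrm K g \<bullet> c t) k"
    by (auto simp: sign_changes_def)
  finally show ?thesis by simp
qed

lemma crossings_outside:
  assumes "g \<in> geodesics K" "g \<inter> U = {}"
  shows "crossings k g = 0"
proof -
  have one: "(\<forall>x\<in>D. nrm K g \<bullet> x \<ge> 0) \<or> (\<forall>x\<in>D. nrm K g \<bullet> x \<le> 0)"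
    using assms geodesic_eq_nrm[OF assms(1)] by (intro one_sided) auto
  have "sign_changes (\<lambda>t. nrm K g \<bullet> c t) k = {}"
  proof -
    have "\<not> (nrm K g \<bullet> c (real i / 2^k)) * (nrm K g \<bullet> c (real (Suc i) / 2^k)) < 0" if "i < 2^k" for i
    proof -
      have "c (real i / 2^k) \<in> D" "c (real (Suc i) / 2^k) \<in> D"
        using that by (auto intro!: c_D dyadic_in_unit simp del: of_nat_Suc)
      then show ?thesis using one by (meson mult_nonneg_nonneg mult_nonpos_nonpos not_less)
    qed
    then show ?thesis by (auto simp: sign_changes_def)
  qed
  then show ?thesis using crossings_eq[OF assms(1)] by simp
qed

lemma crossings_le:
  assumes g: "g \<in> geodesics K" "g \<inter> U \<noteq> {}"
  shows "crossings k g \<le> 2"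
proof -
  obtain z where z: "z \<in> U" "nrm K g \<bullet> z = 0" using g geodesic_eq_nrm[OF g(1)] by blast
  have "card (sign_changes (\<lambda>t. nrm K g \<bullet> c t) k) \<le> 2"
  proof (rule card_sign_changes_le)
    show "continuous_on {0..1} (\<lambda>t. nrm K g \<bullet> c t)" by (intro continuous_intros cont)
    fix x1 x2 x3 :: real assume x: "x1 \<in> {0<..<1}" "x2 \<in> {0<..<1}" "x3 \<in> {0<..<1}"
      "nrm K g \<bullet> c x1 = 0" "nrm K g \<bullet> c x2 = 0" "nrm K g \<bullet> c x3 = 0"
    have "c x1 \<in> surface_boundary K D" "c x2 \<in> surface_boundary K D" "c x3 \<in> surface_boundary K D"
      using x unfolding image[symmetric] by auto
    then have "c x1 = c x2 \<or> c x1 = c x3 \<or> c x2 = c x3"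
      using three_boundary_points[OF nrm(1)[OF g(1)] z] x by blast
    then show "x1 = x2 \<or> x1 = x3 \<or> x2 = x3" using inj x by blast
  qed
  then have "of_nat (card (sign_changes (\<lambda>t. nrm K g \<bullet> c t) k)) \<le> (of_nat 2 :: ennreal)"
    by (simp only: of_nat_le_iff)
  then show ?thesis using crossings_eq[OF g(1)] by simp
qed

text \<open>Some boundary point lies on the side opposite to \<open>c 0\<close>. Its parameter need
  not be dyadic, but by continuity all nearby parameters give points on the same side, and fine
  dyadic partitions contain one of them.\<close>

lemma crossings_eventually:
  assumes g: "g \<in> geodesics K" "g \<inter> U \<noteq> {}"
    and off: "\<And>k i. i \<le> 2^k \<Longrightarrow> c (real i / 2^k) \<notin> g"
  shows "\<forall>\<^sub>F k in sequentially. crossings k g = 2"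
proof -
  define f where "f = (\<lambda>t. nrm K g \<bullet> c t)"
  obtain z where z: "z \<in> U" "nrm K g \<bullet> z = 0" using g geodesic_eq_nrm[OF g(1)] by blast
  have nz: "f (real i / 2^k) \<noteq> 0" if "i \<le> 2^k" for i k
    using off[OF that] mem_geodesic_iff[OF g(1) c_surface[OF dyadic_in_unit[OF that]]] by (simp add: f_def)
  have f0: "f 0 \<noteq> 0" using nz[of 0 0] by simp
  have "\<exists>y\<in>surface_boundary K D. (nrm K g \<bullet> y) * f 0 < 0"
  proof (cases "f 0 < 0")
    case True
    obtain y where "y \<in> surface_boundary K D" "nrm K g \<bullet> y > 0"
      using boundary_positive[OF nrm(1)[OF g(1)] z] by blast
    then show ?thesis using True by (auto intro!: bexI[of _ y] mult_pos_neg)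
  next
    case False
    have "- nrm K g \<noteq> 0" "- nrm K g \<bullet> z = 0" using nrm(1)[OF g(1)] z by auto
    then obtain y where "y \<in> surface_boundary K D" "- nrm K g \<bullet> y > 0"
      using boundary_positive[of "- nrm K g" z] z by blast
    then show ?thesis using False f0 by (auto intro!: bexI[of _ y] mult_neg_pos)
  qed
  then obtain t where t: "0 \<le> t" "t \<le> 1" "f t * f 0 < 0"
    unfolding image[symmetric] by (auto simp: f_def)
  have "continuous_on {0..1} (\<lambda>t. f t * f 0)" unfolding f_def by (intro continuous_intros cont)
  then obtain \<delta> where \<delta>: "\<delta> > 0"
    "\<And>s. s \<in> {0..1} \<Longrightarrow> dist s t < \<delta> \<Longrightarrow> dist (f s * f 0) (f t * f 0) < - (f t * f 0)"
    using t unfolding continuous_on_iff by (metis atLeastAtMost_iff neg_0_less_iff_less)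
  have "\<forall>\<^sub>F k::nat in sequentially. \<exists>j::nat. j \<le> 2^k \<and> f (real j / 2^k) * f 0 < 0"
  proof (rule eventually_dyadic_near[OF t(1,2) \<delta>(1)])
    fix s :: real assume "s \<in> {0..1}" "\<bar>s - t\<bar> < \<delta>"
    then have "dist (f s * f 0) (f t * f 0) < - (f t * f 0)" using \<delta>(2) by (simp add: dist_real_def)
    then show "f s * f 0 < 0" by (simp add: dist_real_def)
  qed
  then show ?thesis
  proof (rule eventually_mono)
    fix k assume "\<exists>j\<le>2^k. f (real j / 2^k) * f 0 < 0"
    then obtain j :: nat where j: "j \<le> 2^k" "f (real j / 2^k) * f 0 < 0" by blast
    have "f 0 = f 1" using loop by (simp add: f_def)
    then have "2 \<le> card (sign_changes f k)" using nz j by (intro card_sign_changes_ge[of k f j]) auto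
    then have "(of_nat 2 :: ennreal) \<le> of_nat (card (sign_changes f k))" by (simp only: of_nat_le_iff)
    then have "2 \<le> crossings k g" using crossings_eq[OF g(1), of k] by (simp add: f_def)
    then show "crossings k g = 2" using crossings_le[OF g] by (simp add: antisym)
  qed
qed

lemma dyadic_null:
  assumes \<mu>: "invariant_geodesic_measure K \<mu>"
  shows "AE g in \<mu>. \<forall>k i. i \<le> 2^k \<longrightarrow> c (real i / 2^k) \<notin> g"
proof -
  have "AE g in \<mu>. c (real i / 2^k) \<notin> g" if "i \<le> 2^k" for i k
  proof -
    have "geodesics_meeting K {c (real i / 2^k)} \<in> null_sets \<mu>"
      by (rule pencil_null[OF \<mu> c_surface[OF dyadic_in_unit[OF that]]])
    then have "AE g in \<mu>. g \<notin> geodesics_meeting K {c (real i / 2^k)}" by (rule AE_not_in)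
    then show ?thesis
      using AE_space by eventually_elim (auto simp: geodesics_meeting_def space_invariant[OF \<mu>])
  qed
  then show ?thesis by (simp add: AE_all_countable)
qed

lemma emeasure_meeting_U:
  assumes \<mu>: "invariant_geodesic_measure K \<mu>"
    and lip: "\<And>s t. s \<in> {0..1} \<Longrightarrow> t \<in> {0..1} \<Longrightarrow> norm (c t - c s) \<le> B * \<bar>t - s\<bar>"
    and S: "finite S" and der: "\<And>t. t \<in> {0<..<1} - S \<Longrightarrow>
      (c has_vector_derivative vector_derivative c (at t)) (at t)"
  shows "emeasure \<mu> (geodesics_meeting K U) = curve_length K c"
proof -
  let ?G = "geodesics_meeting K U"
  let ?c = "\<lambda>k i. c (real i / 2^k)"
  have G: "?G \<in> sets \<mu>" using meeting_U_measurable sets_invariant[OF \<mu>] by simp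
  \<comment> \<open>For \<open>K > 0\<close> antipodal points have ambient distance
    \<open>2 / sqrt K\<close>. Once the Lipschitz bound for a side is smaller, neighbouring vertices
    are not antipodal and the formula for a segment applies to every side.\<close>
  have "(\<lambda>k. B * (1 / 2)^k) \<longlonglongrightarrow> B * 0" by (intro tendsto_intros LIMSEQ_power_zero) simp
  then have "\<forall>\<^sub>F k in sequentially. B * (1 / 2)^k < 2 / sqrt \<bar>K\<bar> \<or> K = 0"
    by (cases "K = 0") (auto elim: eventually_mono dest: order_tendstoD(2)[of _ _ _ "2 / sqrt \<bar>K\<bar>"])
  then obtain k1 where k1: "\<And>k. k \<ge> k1 \<Longrightarrow> B * (1 / 2)^k < 2 / sqrt \<bar>K\<bar> \<or> K = 0"
    unfolding eventually_sequentially by blast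
  have edge: "sep K (?c k i) (?c k (Suc i)) \<in> sets \<mu>"
    "emeasure \<mu> (sep K (?c k i) (?c k (Suc i))) = ennreal (2 * dyadic_arc K c k i)"
    "dyadic_arc K c k i \<ge> 0" if k: "k \<ge> k1" and i: "i < 2^k" for k i
  proof -
    have u: "real i / 2^k \<in> {0..1}" "real (Suc i) / 2^k \<in> {0..1}"
      using i by (auto intro!: dyadic_in_unit simp del: of_nat_Suc atLeastAtMost_iff)
    have ne: "?c k (Suc i) \<noteq> - ?c k i" if K: "K > 0"
    proof
      assume "?c k (Suc i) = - ?c k i"
      then have "norm (?c k (Suc i) - ?c k i) = 2 * norm (?c k i)"
        by (metis diff_minus_eq_add minus_diff_eq norm_minus_cancel norm_scaleR real_norm_def scaleR_2 abs_numeral minus_add_distrib uminus_add_conv_diff)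
      moreover have "norm (?c k i) = 1 / sqrt K"
      proof -
        have "form K x x = x \<bullet> x" for x :: "real^3" using K by (simp add: form_def inner_vec_def sum_3)
        then have "?c k i \<bullet> ?c k i = 1 / K" using surface_form[OF c_surface[OF u(1)]] K by auto
        then show ?thesis by (simp add: norm_eq_sqrt_inner real_sqrt_divide)
      qed
      moreover have "norm (?c k (Suc i) - ?c k i) \<le> B * (1 / 2)^k"
      proof -
        have "\<bar>real (Suc i) / 2^k - real i / 2^k\<bar> = (1 / 2)^k"
          by (simp add: diff_divide_distrib[symmetric] power_one_over)
        then show ?thesis using lip[OF u] by simp
      qed
      ultimately show False using k1[OF k] K by auto
    qed
    note em = emeasure_sep[OF \<mu> c_surface[OF u(1)] c_surface[OF u(2)] ne]
    show "sep K (?c k i) (?c k (Suc i)) \<in> sets \<mu>"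
      "emeasure \<mu> (sep K (?c k i) (?c k (Suc i))) = ennreal (2 * dyadic_arc K c k i)"
      "dyadic_arc K c k i \<ge> 0"
      using em unfolding dyadic_arc_def by auto
  qed
  define L where "L = (\<lambda>k. \<Sum>i<2^k. dyadic_arc K c k i)"
  have limL: "(\<lambda>k. ennreal (L k)) \<longlonglongrightarrow> curve_length K c"
    unfolding L_def by (rule curve_length_dyadic[OF c_surface lip S der edge(3)])
  then have lim: "(\<lambda>k. 2 * ennreal (L k)) \<longlonglongrightarrow> 2 * curve_length K c"
    by (intro tendsto_intros) auto
  have int: "(\<integral>\<^sup>+g. crossings k g \<partial>\<mu>) = 2 * ennreal (L k)" if k: "k \<ge> k1" for k
  proof -
    have "(\<integral>\<^sup>+g. crossings k g \<partial>\<mu>) = (\<Sum>i<2^k. emeasure \<mu> (sep K (?c k i) (?c k (Suc i))))"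
      unfolding crossings_def using edge(1)[OF k] by (subst nn_integral_sum) auto
    also have "\<dots> = (\<Sum>i<2^k. ennreal (2 * dyadic_arc K c k i))"
      using edge(2)[OF k] by (intro sum.cong) auto
    also have "\<dots> = ennreal (\<Sum>i<2^k. 2 * dyadic_arc K c k i)"
      using edge(3)[OF k] by (intro sum_ennreal) auto
    also have "(\<Sum>i<2^k. 2 * dyadic_arc K c k i) = 2 * L k" by (simp add: L_def sum_distrib_left)
    finally have "(\<integral>\<^sup>+g. crossings k g \<partial>\<mu>) = ennreal (2 * L k)" .
    moreover have "L k \<ge> 0" unfolding L_def using edge(3)[OF k] by (intro sum_nonneg) auto
    ultimately show ?thesis by (simp add: ennreal_mult)
  qed
  \<comment> \<open>The pointwise bound on the count holds for every \<open>k\<close>, so no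
    sufficiently fine inscribed polygon is longer than the measure of the geodesics meeting
    \<open>U\<close>.\<close>
  have le: "2 * ennreal (L k) \<le> 2 * emeasure \<mu> ?G" if k: "k \<ge> k1" for k
  proof -
    have "(\<integral>\<^sup>+g. crossings k g \<partial>\<mu>) \<le> (\<integral>\<^sup>+g. 2 * indicator ?G g \<partial>\<mu>)"
    proof (rule nn_integral_mono)
      fix g assume "g \<in> space \<mu>"
      then have g: "g \<in> geodesics K" using space_invariant[OF \<mu>] by simp
      show "crossings k g \<le> 2 * indicator ?G g"
        using crossings_outside[OF g] crossings_le[OF g] g
        by (cases "g \<inter> U = {}") (auto simp: geodesics_meeting_def)
    qed
    then show ?thesis using int[OF k] G by (simp add: nn_integral_cmult_indicator)
  qed
  have "2 * emeasure \<mu> ?G = (\<integral>\<^sup>+g. 2 * indicator ?G g \<partial>\<mu>)" using G by (simp add: nn_integral_cmult_indicator)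
  \<comment> \<open>Off the geodesics through a vertex the counts are eventually constant, so the
    lower limit is the exact value. The shift by \<open>k1\<close> leaves only polygons without
    antipodal neighbours, for which the counts are known to be measurable.\<close>
  also have "\<dots> = (\<integral>\<^sup>+g. liminf (\<lambda>k. crossings (k + k1) g) \<partial>\<mu>)"
  proof (rule nn_integral_cong_AE)
    show "AE g in \<mu>. 2 * indicator ?G g = liminf (\<lambda>k. crossings (k + k1) g)"
      using dyadic_null[OF \<mu>] AE_space
    proof eventually_elim
      fix g assume off: "\<forall>k i. i \<le> 2^k \<longrightarrow> c (real i / 2^k) \<notin> g" and "g \<in> space \<mu>"
      then have g: "g \<in> geodesics K" using space_invariant[OF \<mu>] by simp
      have "(\<lambda>k. crossings k g) \<longlonglongrightarrow> 2 * indicator ?G g"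
      proof (cases "g \<inter> U = {}")
        case True
        then show ?thesis using crossings_outside[OF g] by (auto simp: geodesics_meeting_def)
      next
        case False
        then have "2 * indicator ?G g = (2::ennreal)" using g by (simp add: geodesics_meeting_def)
        then show ?thesis
          using crossings_eventually[OF g False] off by (auto intro: tendsto_eventually)
      qed
      then have "(\<lambda>k. crossings (k + k1) g) \<longlonglongrightarrow> 2 * indicator ?G g" by (rule LIMSEQ_ignore_initial_segment)
      then show "2 * indicator ?G g = liminf (\<lambda>k. crossings (k + k1) g)"
        by (simp add: lim_imp_Liminf)
    qed
  qed
  also have "\<dots> \<le> liminf (\<lambda>k. \<integral>\<^sup>+g. crossings (k + k1) g \<partial>\<mu>)"
    using edge(1) by (intro nn_integral_liminf) (auto simp: crossings_def intro!: borel_measurable_sum borel_measurable_indicator)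
  also have "\<dots> = 2 * curve_length K c"
  proof (rule lim_imp_Liminf)
    show "(\<lambda>k. \<integral>\<^sup>+g. crossings (k + k1) g \<partial>\<mu>) \<longlonglongrightarrow> 2 * curve_length K c"
      using LIMSEQ_ignore_initial_segment[OF lim, of k1] by (simp add: int)
  qed simp
  finally have "2 * emeasure \<mu> ?G \<le> 2 * curve_length K c" .
  moreover have "2 * curve_length K c \<le> 2 * emeasure \<mu> ?G"
    using lim le by (intro LIMSEQ_le_const2[OF lim]) blast
  ultimately have "2 * emeasure \<mu> ?G = 2 * curve_length K c" by (rule antisym)
  then show ?thesis by (simp add: ennreal_mult_cancel_left)
qed

end

theorem mainTheorem8:
  fixes K :: real and \<mu> :: "(real^3) set measure"
    and D :: "(real^3) set" and c :: "real \<Rightarrow> real^3"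
  assumes "invariant_geodesic_measure K \<mu>"
    and "compact_domain K D"
    and "geodesically_convex K D"
    and "parametrizes_closed_curve c (surface_boundary K D)"
    and "geodesic_polygon K c \<or> C1_closed_curve c"
  shows "geodesics_meeting K D \<in> sets \<mu> \<and>
         emeasure \<mu> (geodesics_meeting K D) = curve_length K c"
proof -
  note \<mu> = assms(1)
  obtain U where U: "compact D" "openin (top_of_set (surface K)) U" "connected U" "U \<noteq> {}"
    "D = top_of_set (surface K) closure_of U"
    using assms(2) unfolding compact_domain_def by blast
  have path: "simple_path c" "c 0 = c 1" "c ` {0..1} = surface_boundary K D"
    using assms(4) unfolding parametrizes_closed_curve_def path_image_def pathstart_def pathfinish_def
    by auto
  interpret convex_domain_curve K D U c
  proof
    show "surface_boundary K D \<noteq> {}" unfolding path(3)[symmetric] by auto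
    show "continuous_on {0..1} c" using path(1) simple_path_imp_path unfolding path_def by blast
    show "s = t" if "s \<in> {0<..<1}" "t \<in> {0<..<1}" "c s = c t" for s t
      using path(1) that unfolding simple_path_def loop_free_def by force
  qed (use U assms(3) path in auto)
  obtain B S where B: "0 \<le> B" and S: "finite S" and
    der: "\<And>t. t \<in> {0<..<1} - S \<Longrightarrow> (c has_vector_derivative vector_derivative c (at t)) (at t)" and
    bd: "\<And>t. t \<in> {0<..<1} - S \<Longrightarrow> norm (vector_derivative c (at t)) \<le> B"
    using assms(5)
  proof
    assume "geodesic_polygon K c"
    then show ?thesis using that by (elim polygon_regular) blast
  next
    assume "C1_closed_curve c"
    then show ?thesis using that[of _ "{}"] by (elim C1_regular) auto
  qed
  have inner: "emeasure \<mu> (geodesics_meeting K U) = curve_length K c"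
    by (rule emeasure_meeting_U[OF \<mu> lipschitz_of_bounded_derivative[OF cont S der bd B] S der])
  have DU: "geodesics_meeting K D = geodesics_meeting K U \<union> supporting"
    using U_subset_D by (auto simp: supporting_def geodesics_meeting_def)
  have meas: "geodesics_meeting K D \<in> sets \<mu>" "geodesics_meeting K U \<in> sets \<mu>"
    using geodesics_meeting_compact[OF U(1)] meeting_U_measurable sets_invariant[OF \<mu>] by auto
  have "emeasure \<mu> (geodesics_meeting K D) = emeasure \<mu> (geodesics_meeting K U)"
    unfolding DU by (rule emeasure_Un_null_set[OF meas(2) supporting_null[OF \<mu>]])
  then show ?thesis using inner meas by simp
qed

end
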